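(* Let $\widetilde F$ (on $\partial\Omega$) and $\widetilde G$ (on $\Gamma_+$) be the $\mathbb{C}^N$-valued boundary data described in the context, and assume that there exists an $N$-dimensional vector valued function $\Phi$ with $$\Phi\in H^2(\Omega),\qquad \Phi|_{\partial\Omega}=\widetilde F,\qquad \partial_\nu\Phi|_{\Gamma_+}=\widetilde G .$$ Then for each $\epsilon>0$ there exists a unique minimizer $V_{\min,\epsilon}\in H^2(\Omega)$ of the functional $$J_\epsilon(V)=\int_\Omega\left|L(V(\mathbf{x}))+D_N^{-1}S_N\,\mathbf{n}^2(\mathbf{x})V(\mathbf{x})\right|^2d\mathbf{x}+\epsilon\|V\|_{H^2(\Omega)}^2$$ on the set of $N$-dimensional vector valued functions $V\in H^2(\Omega)$ satisfying the boundary conditions $$V=\widetilde F\ \text{ on }\partial\Omega,\qquad \partial_\nu V=\widetilde G\ \text{ on }\Gamma_+ .$$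
   Context: Points of $\mathbb{R}^n$ are written $\mathbf{x}=(x_1,\dots,x_{n-1},z)$, so $x_n=z$. Let $R\ge 1$, $\Omega=(-R,R)^n\subset\mathbb{R}^n$, and $\Gamma_+=\{\mathbf{x}\in\partial\Omega: z=R\}$; $\nu$ is the unit outward normal on $\partial\Omega$ (so $\partial_\nu=\partial_z$ on $\Gamma_+$). Boundary values are understood in the sense of traces. Coefficients: $a_{ij}\in C^1(\mathbb{R}^n)$, $b_j\in C(\mathbb{R}^n)$, $c\in C(\mathbb{R}^n)$ ($i,j=1,\dots,n$) are real-valued with $a_{ij}=a_{ji}$; there are constants $0<\mu_1\le\mu_2$ with $\mu_1|\xi|^2\le\sum_{i,j=1}^n a_{ij}(\mathbf{x})\xi_i\xi_j\le\mu_2|\xi|^2$ for all $\mathbf{x},\xi\in\mathbb{R}^n$; and for $\mathbf{x}\in\mathbb{R}^n\setminus\Omega$, $a_{ij}(\mathbf{x})=1$ if $i=j$, $a_{ij}(\mathbf{x})=0$ if $i\ne j$, $b_j(\mathbf{x})=c(\mathbf{x})=0$. The operator is $$Lu=\sum_{i,j=1}^n a_{ij}(\mathbf{x})u_{x_ix_j}+\sum_{i=1}^n b_i(\mathbf{x})u_{x_i}+c(\mathbf{x})u,$$ applied componentwise to vector valued functions. The refractive index $\mathbf{n}\in C^1(\mathbb{R}^n)$ is a real-valued scalar function with $\mathbf{n}=1$ on $\mathbb{R}^n\setminus\Omega$. Let $0<\underline{k}<\overline{k}<\infty$, $k_0=(\underline{k}+\overline{k})/2$, and $\phi_m(k)=(k-k_0)^{m-1}\exp(k-k_0)$,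 $m\ge1$. Let $\{\Psi_m\}_{m\ge1}$ be the orthonormal basis of $L^2(\underline{k},\overline{k})$ obtained from $\{\phi_m\}_{m\ge 1}$ by Gram–Schmidt orthonormalization. Fix an integer $N\ge1$. Define the $N\times N$ matrices $D_N=(d_{mr})$, $S_N=(s_{mr})$ by $$d_{mr}=\int_{\underline{k}}^{\overline{k}}\Psi_m(k)\Psi_r'(k)\,dk,\qquad s_{mr}=\int_{\underline{k}}^{\overline{k}}\bigl(k^2\Psi_r'(k)+2k\Psi_r(k)\bigr)\Psi_m(k)\,dk .$$ It is known that $d_{mm}=1$ and $d_{mr}=0$ for $r<m$, so $D_N$ is invertible. Boundary data: $g\in C^1[0,\infty)$ is nonvanishing on $[\underline{k},\overline{k}]$, and $F(\mathbf{x},k)$ ($\mathbf{x}\in\partial\Omega$), $G(\mathbf{x},k)$ ($\mathbf{x}\in\Gamma_+$), $k\in(\underline{k},\overline{k})$, are the given (complex-valued) data: measurements of a wave field $u(\mathbf{x},k)$ on $\partial\Omega$ and of $\partial_z u(\mathbf{x},k)$ on $\Gamma_+$. The vectors $\widetilde F(\mathbf{x})$, $\widetilde G(\mathbf{x})$ have components $\widetilde F_m(\mathbf{x})=\int_{\underline{k}}^{\overline{k}}\frac{F(\mathbf{x},k)}{g(k)}\Psi_m(k)\,dk$ ($\mathbf{x}\in\partial\Omega$) and $\widetilde G_m(\mathbf{x})=\int_{\underline{k}}^{\overline{k}}\frac{G(\mathbf{x},k)}{g(k)}\Psi_m(k)\,dk$ ($\mathbf{x}\in\Gamma_+$), $m=1,\dots,N$.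 The theorem involves the data only through $\widetilde F$ and $\widetilde G$. Vector valued functions are $\mathbb{C}^N$-valued. Such a function belongs to a Hilbert space such as $H^2(\Omega)$ if every component does; its norm is the square root of the sum of squares of the norms of the components. *)

theory Defs
  imports "HOL-Analysis.Analysis"
begin

section \<open>Classical differentiability\<close>

definition partial :: "'n::finite \<Rightarrow> (real^'n \<Rightarrow> 'b::real_normed_vector) \<Rightarrow> real^'n \<Rightarrow> 'b" where
  "partial i f x = frechet_derivative f (at x) (axis i 1)"

primrec C_k :: "nat \<Rightarrow> (real^'n::finite \<Rightarrow> 'b::real_normed_vector) \<Rightarrow> bool" where
  "C_k 0 f \<longleftrightarrow> continuous_on UNIV f"
| "C_k (Suc k) f \<longleftrightarrow> (\<forall>x. f differentiable (at x)) \<and> (\<forall>i. C_k k (partial i f))"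

definition smooth :: "(real^'n::finite \<Rightarrow> 'b::real_normed_vector) \<Rightarrow> bool" where
  "smooth f \<longleftrightarrow> (\<forall>k. C_k k f)"

primrec partials :: "'n::finite list \<Rightarrow> (real^'n \<Rightarrow> 'b::real_normed_vector) \<Rightarrow> real^'n \<Rightarrow> 'b" where
  "partials [] f = f"
| "partials (i # \<alpha>) f = partial i (partials \<alpha> f)"

definition test_function :: "(real^'n::finite) set \<Rightarrow> (real^'n \<Rightarrow> real) \<Rightarrow> bool" where
  "test_function \<Omega> \<phi> \<longleftrightarrow>
     smooth \<phi> \<and> compact (closure {x. \<phi> x \<noteq> 0}) \<and> closure {x. \<phi> x \<noteq> 0} \<subseteq> \<Omega>"


section \<open>Square integrable functions and Sobolev spaces\<close>

text \<open>
  Elements of the spaces below are represented by functions on the whole space; only their values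
  on the domain matter, and functions that agree almost everywhere there are the same element.
\<close>

definition L2 :: "'a measure \<Rightarrow> ('a \<Rightarrow> complex) \<Rightarrow> bool" where
  "L2 M f \<longleftrightarrow> f \<in> borel_measurable M \<and> integrable M (\<lambda>x. (norm (f x))\<^sup>2)"

definition L2_norm :: "'a measure \<Rightarrow> ('a \<Rightarrow> complex) \<Rightarrow> real" where
  "L2_norm M f = sqrt (\<integral>x. (norm (f x))\<^sup>2 \<partial>M)"

definition locally_integrable :: "(real^'n::finite) set \<Rightarrow> (real^'n \<Rightarrow> complex) \<Rightarrow> bool" where
  "locally_integrable \<Omega> u \<longleftrightarrow> (\<forall>K. compact K \<and> K \<subseteq> \<Omega> \<longrightarrow> set_integrable lebesgue K u)"

text \<open>
  A list \<^term>\<open>\<alpha>\<close> of coordinate indices stands for the derivative in these coordinates one after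
  the other. Since test functions are smooth, the order of the list is irrelevant.
\<close>

definition has_weak_deriv ::
  "(real^'n::finite) set \<Rightarrow> 'n list \<Rightarrow> (real^'n \<Rightarrow> complex) \<Rightarrow> (real^'n \<Rightarrow> complex) \<Rightarrow> bool" where
  "has_weak_deriv \<Omega> \<alpha> u v \<longleftrightarrow>
     locally_integrable \<Omega> u \<and> locally_integrable \<Omega> v \<and>
     (\<forall>\<phi>. test_function \<Omega> \<phi> \<longrightarrow>
        (LINT x:\<Omega>|lebesgue. partials \<alpha> \<phi> x *\<^sub>R u x) =
        (-1) ^ length \<alpha> * (LINT x:\<Omega>|lebesgue. \<phi> x *\<^sub>R v x))"

text \<open>Weak derivatives are unique only up to a null set; one representative is chosen.\<close>

definition weak_deriv ::
  "(real^'n::finite) set \<Rightarrow> 'n list \<Rightarrow> (real^'n \<Rightarrow> complex) \<Rightarrow> real^'n \<Rightarrow> complex" where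
  "weak_deriv \<Omega> \<alpha> u = (SOME v. has_weak_deriv \<Omega> \<alpha> u v)"

text \<open>The sorted lists represent each multi-index of order at most \<^term>\<open>k\<close> exactly once.\<close>

definition multi_indices :: "nat \<Rightarrow> 'n::{finite,linorder} list set" where
  "multi_indices k = {\<alpha>. sorted \<alpha> \<and> length \<alpha> \<le> k}"

definition Hk :: "nat \<Rightarrow> (real^'n::{finite,linorder}) set \<Rightarrow> (real^'n::_ \<Rightarrow> complex) \<Rightarrow> bool" where
  "Hk k \<Omega> u \<longleftrightarrow>
     L2 (lebesgue_on \<Omega>) u \<and>
     (\<forall>\<alpha>\<in>multi_indices k. \<exists>v. L2 (lebesgue_on \<Omega>) v \<and> has_weak_deriv \<Omega> \<alpha> u v)"

definition Hk_norm :: "nat \<Rightarrow> (real^'n::{finite,linorder}) set \<Rightarrow> (real^'n::_ \<Rightarrow> complex) \<Rightarrow> real" where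
  "Hk_norm k \<Omega> u =
     sqrt (\<Sum>\<alpha>\<in>multi_indices k. (L2_norm (lebesgue_on \<Omega>) (weak_deriv \<Omega> \<alpha> u))\<^sup>2)"

definition Hk_vec ::
  "nat \<Rightarrow> (real^'n::{finite,linorder}) set \<Rightarrow> (real^'n::_ \<Rightarrow> complex^'m::finite) \<Rightarrow> bool" where
  "Hk_vec k \<Omega> V \<longleftrightarrow> (\<forall>m. Hk k \<Omega> (\<lambda>x. V x $ m))"

definition Hk_norm_vec ::
  "nat \<Rightarrow> (real^'n::{finite,linorder}) set \<Rightarrow> (real^'n::_ \<Rightarrow> complex^'m::finite) \<Rightarrow> real" where
  "Hk_norm_vec k \<Omega> V = sqrt (\<Sum>m\<in>UNIV. (Hk_norm k \<Omega> (\<lambda>x. V x $ m))\<^sup>2)"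


section \<open>The cube, its surface measure, and traces\<close>

definition cube :: "real \<Rightarrow> (real^'n::finite) set" where
  "cube R = {x. \<forall>i. -R < x $ i \<and> x $ i < R}"

definition z_index :: "'n::{finite,linorder}" where
  "z_index = Max UNIV"

definition Gamma_plus :: "real \<Rightarrow> (real^'n::{finite,linorder}) set" where
  "Gamma_plus R = {x \<in> frontier (cube R). x $ z_index = R}"

text \<open>
  The \<open>(n-1)\<close>-dimensional Lebesgue measure on the hyperplane where coordinate \<^term>\<open>i\<close> equals
  \<^term>\<open>s\<close>, as a Borel measure on the whole space: product Lebesgue measure in the other
  coordinates, pushed forward by the isometric embedding.
\<close>

definition hyperplane_measure :: "'n::finite \<Rightarrow> real \<Rightarrow> (real^'n) measure" where
  "hyperplane_measure i s =
     distr (\<Pi>\<^sub>M j\<in>UNIV - {i}. lborel) borel (\<lambda>y. \<chi> j. if j = i then s else y j)"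

text \<open>
  The edges of the cube, where faces overlap, are null sets. Completion makes every
  almost-everywhere modification of a measurable boundary function measurable.
\<close>

definition cube_surface_measure :: "real \<Rightarrow> (real^'n::finite) measure" where
  "cube_surface_measure R =
     completion (measure_of UNIV (sets borel)
       (\<lambda>A. \<Sum>i\<in>UNIV. \<Sum>s\<in>{-R, R}. emeasure (hyperplane_measure i s) (A \<inter> frontier (cube R))))"

text \<open>
  The trace operator from \<open>H\<^sup>1\<close> of the cube to \<open>L\<^sup>2\<close> of the boundary is the continuous extension of
  \<open>u \<mapsto> u|\<Gamma>\<close> from the dense subspace of functions smooth up to the boundary. Its graph, for the
  part \<^term>\<open>\<Gamma>\<close> of the boundary, is the following relation; the trace is an element of \<open>L\<^sup>2\<close>, so
  determined only up to null sets of the surface measure.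
\<close>

definition has_trace ::
  "real \<Rightarrow> (real^'n::{finite,linorder}) set \<Rightarrow> (real^'n::_ \<Rightarrow> complex) \<Rightarrow> (real^'n::_ \<Rightarrow> complex) \<Rightarrow> bool" where
  "has_trace R \<Gamma> u h \<longleftrightarrow>
     Hk 1 (cube R) u \<and> L2 (restrict_space (cube_surface_measure R) \<Gamma>) h \<and>
     (\<exists>w :: nat \<Rightarrow> real^'n::_ \<Rightarrow> complex. (\<forall>j. smooth (w j)) \<and>
        (\<lambda>j. Hk_norm 1 (cube R) (\<lambda>x. w j x - u x)) \<longlonglongrightarrow> 0 \<and>
        (\<lambda>j. L2_norm (restrict_space (cube_surface_measure R) \<Gamma>) (\<lambda>x. w j x - h x)) \<longlonglongrightarrow> 0)"

text \<open>
  On \<^term>\<open>Gamma_plus R\<close> the unit outward normal is the \<open>z\<close>-direction, so the normal derivative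
  is the trace of the \<open>z\<close>-derivative.
\<close>

definition admissible ::
  "real \<Rightarrow> (real^'n::{finite,linorder} \<Rightarrow> complex^'m::finite) \<Rightarrow> (real^'n::_ \<Rightarrow> complex^'m) \<Rightarrow>
     (real^'n::_ \<Rightarrow> complex^'m) \<Rightarrow> bool" where
  "admissible R Ft Gt V \<longleftrightarrow>
     Hk_vec 2 (cube R) V \<and>
     (\<forall>m. has_trace R (frontier (cube R)) (\<lambda>x. V x $ m) (\<lambda>x. Ft x $ m)) \<and>
     (\<forall>m. has_trace R (Gamma_plus R)
            (weak_deriv (cube R) [z_index] (\<lambda>x. V x $ m)) (\<lambda>x. Gt x $ m))"


section \<open>The basis in the wave number\<close>

text \<open>The indices of the two families are \<open>m \<ge> 1\<close>; the recursion is Gram-Schmidt orthonormalization.\<close>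

definition phi :: "real \<Rightarrow> real \<Rightarrow> nat \<Rightarrow> real \<Rightarrow> real" where
  "phi kl ku m k = (k - (kl + ku) / 2) ^ (m - 1) * exp (k - (kl + ku) / 2)"

function Psi :: "real \<Rightarrow> real \<Rightarrow> nat \<Rightarrow> real \<Rightarrow> real" where
  "Psi kl ku m =
     (let w = (\<lambda>k. phi kl ku m k -
                 (\<Sum>r\<in>{1..<m}. (LINT t:{kl<..<ku}|lebesgue. phi kl ku m t * Psi kl ku r t) * Psi kl ku r k))
      in (\<lambda>k. w k / sqrt (LINT t:{kl<..<ku}|lebesgue. (w t)\<^sup>2)))"
  by pat_completeness auto
termination
  by (relation "Wellfounded.measure (\<lambda>(kl, ku, m). m)") auto

declare Psi.simps [simp del]

text \<open>The index types are identified with \<open>1, \<dots>, N\<close> by their order.\<close>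

definition pos :: "'m::{finite,linorder} \<Rightarrow> nat" where
  "pos m = card {j. j \<le> m}"

definition D_matrix :: "real \<Rightarrow> real \<Rightarrow> real^'m::{finite,linorder}^'m::_" where
  "D_matrix kl ku = (\<chi> m r.
     LINT k:{kl<..<ku}|lebesgue. Psi kl ku (pos m) k * deriv (Psi kl ku (pos r)) k)"

definition S_matrix :: "real \<Rightarrow> real \<Rightarrow> real^'m::{finite,linorder}^'m::_" where
  "S_matrix kl ku = (\<chi> m r.
     LINT k:{kl<..<ku}|lebesgue.
       (k\<^sup>2 * deriv (Psi kl ku (pos r)) k + 2 * k * Psi kl ku (pos r) k) * Psi kl ku (pos m) k)"

definition boundary_coeffs ::
  "real \<Rightarrow> real \<Rightarrow> (real \<Rightarrow> complex) \<Rightarrow> (real^'n::finite \<Rightarrow> real \<Rightarrow> complex) \<Rightarrow>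
     real^'n \<Rightarrow> complex^'m::{finite,linorder}" where
  "boundary_coeffs kl ku g F x = (\<chi> m.
     LINT k:{kl<..<ku}|lebesgue. F x k / g k * complex_of_real (Psi kl ku (pos m) k))"


section \<open>The operator and the functional\<close>

definition L_op ::
  "real \<Rightarrow> ('n::finite \<Rightarrow> 'n \<Rightarrow> real^'n \<Rightarrow> real) \<Rightarrow> ('n \<Rightarrow> real^'n \<Rightarrow> real) \<Rightarrow> (real^'n \<Rightarrow> real) \<Rightarrow>
     (real^'n \<Rightarrow> complex) \<Rightarrow> real^'n \<Rightarrow> complex" where
  "L_op R a b c u x =
     (\<Sum>i\<in>UNIV. \<Sum>j\<in>UNIV. complex_of_real (a i j x) * weak_deriv (cube R) [i, j] u x) +
     (\<Sum>i\<in>UNIV. complex_of_real (b i x) * weak_deriv (cube R) [i] u x) +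
     complex_of_real (c x) * u x"

definition L_op_vec ::
  "real \<Rightarrow> ('n::finite \<Rightarrow> 'n \<Rightarrow> real^'n \<Rightarrow> real) \<Rightarrow> ('n \<Rightarrow> real^'n \<Rightarrow> real) \<Rightarrow> (real^'n \<Rightarrow> real) \<Rightarrow>
     (real^'n \<Rightarrow> complex^'m::finite) \<Rightarrow> real^'n \<Rightarrow> complex^'m" where
  "L_op_vec R a b c V x = (\<chi> m. L_op R a b c (\<lambda>y. V y $ m) x)"

definition J ::
  "real \<Rightarrow> real \<Rightarrow> real \<Rightarrow> ('n::{finite,linorder} \<Rightarrow> 'n \<Rightarrow> real^'n::_ \<Rightarrow> real) \<Rightarrow>
     ('n \<Rightarrow> real^'n::_ \<Rightarrow> real) \<Rightarrow> (real^'n::_ \<Rightarrow> real) \<Rightarrow> (real^'n::_ \<Rightarrow> real) \<Rightarrow> real \<Rightarrow>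
     (real^'n::_ \<Rightarrow> complex^'m::{finite,linorder}) \<Rightarrow> real" where
  "J R kl ku a b c n \<epsilon> V =
     (LINT x:cube R|lebesgue.
        (norm (L_op_vec R a b c V x +
               map_matrix complex_of_real (matrix_inv (D_matrix kl ku) ** S_matrix kl ku) *v
                 ((n x)\<^sup>2 *\<^sub>R V x)))\<^sup>2) +
     \<epsilon> * (Hk_norm_vec 2 (cube R) V)\<^sup>2"

end

theory Submission
  imports Defs "HOL-Computational_Algebra.Polynomial"
begin

text \<open>
  The functional is a quadratic form on the Hilbert space of second order Sobolev functions, and the
  regularization term makes it coercive, so the minimizer comes from the parallelogram identity and
  completeness. Let \<open>Q\<close> be the functional and \<open>I\<close> its infimum over the admissible set \<open>A\<close>, which is
  an affine subspace. Writing \<open>V\<close> and \<open>W\<close> in \<open>A\<close> as midpoint plus and minus half difference, the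
  parallelogram identity gives \<open>Q(V - W) \<le> 2 Q V + 2 Q W - 4 I\<close>. Hence a minimizing sequence is
  Cauchy for \<open>Q\<close>, and two minimizers are at \<open>Q\<close>-distance zero. Since \<open>Q\<close> dominates \<open>\<epsilon>\<close> times the
  squared Sobolev norm and is in turn dominated by a multiple of it, both statements carry over to
  the Sobolev norm. This argument is \<open>quadratic_minimizer_exists_unique\<close>; the rest supplies its
  hypotheses.

  The hypotheses need the following facts about the function spaces. Weak derivatives are unique up
  to null sets (\<open>weak_deriv_unique\<close>), because the indicator function of a box is a pointwise limit
  of test functions and the boxes generate the Borel sets; only then is the chosen representative of
  a weak derivative linear almost everywhere, and only then does the Sobolev norm satisfy the
  parallelogram identity. The Sobolev spaces are complete (\<open>Hk_complete\<close>), because the square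
  integrable functions are (\<open>L2_complete\<close>) and the defining identity of a weak derivative survives
  limits in the mean.

  The admissible set is affine and closed. A trace is a limit of restrictions of smooth functions,
  so for a fixed boundary function closedness is a diagonal argument (\<open>has_trace_closed\<close>); it uses
  that smooth functions are Sobolev functions, which is integration by parts. The condition on the
  normal derivative is handled in the same way, since the \<open>z\<close>-derivative is a contraction from
  second order to first order Sobolev functions. Finally every component of \<open>L V + D\<^sup>-\<^sup>1 S n\<^sup>2 V\<close> is
  a finite combination of derivatives of \<open>V\<close> of order at most two whose coefficients are continuous,
  hence bounded on the cube; such an operator is linear almost everywhere and bounded from the
  Sobolev space to the square integrable functions.
\<close>


section \<open>Calculus of smooth functions\<close>

lemma partial_eqI: "(f has_derivative f') (at x) \<Longrightarrow> partial i f x = f' (axis i 1)"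
  unfolding partial_def using frechet_derivative_at by metis

lemma partial_lincomb:
  assumes "f differentiable (at x)" "g differentiable (at x)"
  shows "partial i (\<lambda>x. s *\<^sub>R f x + t *\<^sub>R g x) x = s *\<^sub>R partial i f x + t *\<^sub>R partial i g x"
proof -
  from assms have "(f has_derivative frechet_derivative f (at x)) (at x)"
    "(g has_derivative frechet_derivative g (at x)) (at x)"
    by (simp_all add: frechet_derivative_works)
  then have "((\<lambda>x. s *\<^sub>R f x + t *\<^sub>R g x) has_derivative
      (\<lambda>h. s *\<^sub>R frechet_derivative f (at x) h + t *\<^sub>R frechet_derivative g (at x) h)) (at x)"
    by (auto intro!: derivative_eq_intros)
  from partial_eqI[OF this] show ?thesis by (simp add: partial_def)
qed

lemma partial_scaleR:
  fixes \<phi> :: "real^'n::finite \<Rightarrow> real"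
  assumes "\<phi> differentiable (at x)" "f differentiable (at x)"
  shows "partial i (\<lambda>x. \<phi> x *\<^sub>R f x) x = \<phi> x *\<^sub>R partial i f x + partial i \<phi> x *\<^sub>R f x"
proof -
  from assms have "(\<phi> has_derivative frechet_derivative \<phi> (at x)) (at x)"
    "(f has_derivative frechet_derivative f (at x)) (at x)"
    by (simp_all add: frechet_derivative_works)
  then have "((\<lambda>x. \<phi> x *\<^sub>R f x) has_derivative
      (\<lambda>h. \<phi> x *\<^sub>R frechet_derivative f (at x) h + frechet_derivative \<phi> (at x) h *\<^sub>R f x)) (at x)"
    by (rule has_derivative_scaleR)
  from partial_eqI[OF this] show ?thesis by (simp add: partial_def)
qed

text \<open>
  The recursion asks for differentiability only, so continuity of the lower derivatives has to be
  recovered level by level.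
\<close>

lemma C_k_Suc_imp_C_k: "C_k (Suc k) f \<Longrightarrow> C_k k f"
proof (induction k arbitrary: f)
  case 0
  then show ?case
    by (auto intro!: differentiable_imp_continuous_on simp: differentiable_on_def
        intro: differentiable_at_withinI)
next
  case (Suc k)
  then show ?case by (metis C_k.simps(2))
qed

lemma C_k_lincomb:
  "C_k k f \<Longrightarrow> C_k k g \<Longrightarrow> C_k k (\<lambda>x. s *\<^sub>R f x + t *\<^sub>R g x)"
proof (induction k arbitrary: f g)
  case 0
  then show ?case by (auto intro!: continuous_intros)
next
  case (Suc k)
  then have "partial i (\<lambda>x. s *\<^sub>R f x + t *\<^sub>R g x) = (\<lambda>x. s *\<^sub>R partial i f x + t *\<^sub>R partial i g x)" for i
    by (intro ext partial_lincomb) auto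
  with Suc show ?case by auto
qed

lemma C_k_scaleR_const: "C_k k f \<Longrightarrow> C_k k (\<lambda>x. s *\<^sub>R f x)"
  using C_k_lincomb[of k f f s 0] by simp

lemma C_k_scaleR:
  fixes \<phi> :: "real^'n::finite \<Rightarrow> real"
  shows "C_k k \<phi> \<Longrightarrow> C_k k f \<Longrightarrow> C_k k (\<lambda>x. \<phi> x *\<^sub>R f x)"
proof (induction k arbitrary: \<phi> f)
  case 0
  then show ?case by (auto intro!: continuous_intros)
next
  case (Suc k)
  have eq: "partial i (\<lambda>x. \<phi> x *\<^sub>R f x) = (\<lambda>x. 1 *\<^sub>R (\<phi> x *\<^sub>R partial i f x) + 1 *\<^sub>R (partial i \<phi> x *\<^sub>R f x))" for i
    using Suc.prems by (intro ext) (simp add: partial_scaleR)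
  have "C_k k \<phi>" "C_k k f" using Suc.prems by (auto intro: C_k_Suc_imp_C_k simp del: C_k.simps)
  then have "C_k k (partial i (\<lambda>x. \<phi> x *\<^sub>R f x))" for i
    unfolding eq using Suc.prems by (intro C_k_lincomb Suc.IH) auto
  then show ?case using Suc.prems by auto
qed

lemma C_k_const: "C_k k (\<lambda>_::real^'n::finite. c)"
proof (induction k arbitrary: c)
  case 0
  then show ?case by simp
next
  case (Suc k)
  have "partial i (\<lambda>_::real^'n. c) = (\<lambda>_. 0)" for i
    by (intro ext partial_eqI[of _ "\<lambda>_. 0", simplified]) auto
  with Suc[of 0] show ?case by simp
qed

lemma smooth_lincomb: "smooth f \<Longrightarrow> smooth g \<Longrightarrow> smooth (\<lambda>x. s *\<^sub>R f x + t *\<^sub>R g x)"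
  unfolding smooth_def using C_k_lincomb by blast

lemma smooth_scaleR:
  fixes \<phi> :: "real^'n::finite \<Rightarrow> real"
  shows "smooth \<phi> \<Longrightarrow> smooth f \<Longrightarrow> smooth (\<lambda>x. \<phi> x *\<^sub>R f x)"
  unfolding smooth_def using C_k_scaleR by blast

lemma smooth_prod:
  fixes f :: "'i \<Rightarrow> real^'n::finite \<Rightarrow> real"
  shows "(\<And>i. i \<in> I \<Longrightarrow> smooth (f i)) \<Longrightarrow> smooth (\<lambda>x. \<Prod>i\<in>I. f i x)"
proof (induction I rule: infinite_finite_induct)
  case (insert i I)
  then show ?case using smooth_scaleR[of "f i" "\<lambda>x. \<Prod>i\<in>I. f i x"] by simp
qed (auto simp: smooth_def C_k_const)

lemma smooth_partial: "smooth f \<Longrightarrow> smooth (partial i f)"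
  unfolding smooth_def by (metis C_k.simps(2))

lemma smooth_differentiable: "smooth f \<Longrightarrow> f differentiable (at x)"
  unfolding smooth_def by (metis C_k.simps(2))

lemma smooth_continuous_on: "smooth f \<Longrightarrow> continuous_on S f"
  unfolding smooth_def by (metis C_k.simps(1) continuous_on_subset subset_UNIV)

lemma smooth_partials: "smooth f \<Longrightarrow> smooth (partials \<alpha> f)"
  by (induction \<alpha>) (auto simp: smooth_partial)

lemma partials_append: "partials (\<alpha> @ \<beta>) f = partials \<alpha> (partials \<beta> f)"
  by (induction \<alpha>) auto


section \<open>Symmetry of second partial derivatives\<close>

lemma has_vector_derivative_along_axis:
  assumes "f differentiable (at (y + s *\<^sub>R axis i 1))"
  shows "((\<lambda>s. f (y + s *\<^sub>R axis i 1)) has_vector_derivative partial i f (y + s *\<^sub>R axis i 1)) (at s)"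
proof -
  have "(f has_derivative frechet_derivative f (at (y + s *\<^sub>R axis i 1))) (at (y + s *\<^sub>R axis i 1))"
    using assms by (simp add: frechet_derivative_works)
  moreover have "((\<lambda>s. y + s *\<^sub>R axis i (1::real)) has_vector_derivative axis i 1) (at s)"
    by (auto intro!: derivative_eq_intros simp: has_vector_derivative_def)
  ultimately show ?thesis
    unfolding partial_def
    using vector_derivative_diff_chain_within[of "\<lambda>s. y + s *\<^sub>R axis i 1" "axis i 1" s UNIV f]
    by (auto simp: o_def intro: has_derivative_at_withinI)
qed

text \<open>
  The mean value theorem is applied first along the direction \<open>i\<close> and then along \<open>j\<close>. The left-hand
  side does not change when \<open>i\<close> and \<open>j\<close> are exchanged, while the order of differentiation on the
  right does.
\<close>

lemma second_difference_mean_value: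
  fixes f :: "real^'n::finite \<Rightarrow> real"
  assumes f: "smooth f" and h: "h > 0"
  shows "\<exists>s t. 0 < s \<and> s < h \<and> 0 < t \<and> t < h \<and>
    f (x + h *\<^sub>R axis i 1 + h *\<^sub>R axis j 1) - f (x + h *\<^sub>R axis i 1) - f (x + h *\<^sub>R axis j 1) + f x =
    h * h * partial j (partial i f) (x + s *\<^sub>R axis i 1 + t *\<^sub>R axis j 1)"
proof -
  define F where "F s = f (x + h *\<^sub>R axis j 1 + s *\<^sub>R axis i 1) - f (x + s *\<^sub>R axis i 1)" for s
  have "DERIV F s :> partial i f (x + h *\<^sub>R axis j 1 + s *\<^sub>R axis i 1) - partial i f (x + s *\<^sub>R axis i 1)" for s
    unfolding F_def has_real_derivative_iff_has_vector_derivative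
    by (intro has_vector_derivative_diff has_vector_derivative_along_axis smooth_differentiable f)
  then obtain s where s: "0 < s" "s < h" and
    Fs: "F h - F 0 = (h - 0) * (partial i f (x + h *\<^sub>R axis j 1 + s *\<^sub>R axis i 1) - partial i f (x + s *\<^sub>R axis i 1))"
    using MVT2[OF h, of F "\<lambda>s. partial i f (x + h *\<^sub>R axis j 1 + s *\<^sub>R axis i 1) - partial i f (x + s *\<^sub>R axis i 1)"]
    by blast
  define G where "G t = partial i f (x + s *\<^sub>R axis i 1 + t *\<^sub>R axis j 1)" for t
  have "DERIV G t :> partial j (partial i f) (x + s *\<^sub>R axis i 1 + t *\<^sub>R axis j 1)" for t
    unfolding G_def has_real_derivative_iff_has_vector_derivative
    by (intro has_vector_derivative_along_axis smooth_differentiable smooth_partial f)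
  then obtain t where t: "0 < t" "t < h" and
    Gt: "G h - G 0 = (h - 0) * partial j (partial i f) (x + s *\<^sub>R axis i 1 + t *\<^sub>R axis j 1)"
    using MVT2[OF h, of G "\<lambda>t. partial j (partial i f) (x + s *\<^sub>R axis i 1 + t *\<^sub>R axis j 1)"]
    by blast
  show ?thesis
    using s t Fs Gt by (intro exI[of _ s] exI[of _ t]) (simp add: F_def G_def add_ac)
qed

text \<open>
  Both mixed derivatives, taken at points that tend to \<open>x\<close>, equal the same second difference
  quotient.
\<close>

lemma smooth_partial_commute:
  fixes f :: "real^'n::finite \<Rightarrow> real"
  assumes f: "smooth f"
  shows "partial i (partial j f) = partial j (partial i f)"
proof
  fix x
  define e where "e = (axis i 1 :: real^'n)"
  define e' where "e' = (axis j 1 :: real^'n)"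
  define h where "h n = 1 / real (Suc n)" for n
  have hpos: "h n > 0" for n by (simp add: h_def)
  have hlim: "h \<longlonglongrightarrow> 0" unfolding h_def by (rule LIMSEQ_Suc[OF lim_1_over_n])
  have "\<exists>s t s' t'. 0 < s \<and> s < h n \<and> 0 < t \<and> t < h n \<and> 0 < s' \<and> s' < h n \<and> 0 < t' \<and> t' < h n \<and>
    partial j (partial i f) (x + s *\<^sub>R e + t *\<^sub>R e') = partial i (partial j f) (x + s' *\<^sub>R e' + t' *\<^sub>R e)" for n
  proof -
    obtain s t where 1: "0 < s" "s < h n" "0 < t" "t < h n"
      "f (x + h n *\<^sub>R e + h n *\<^sub>R e') - f (x + h n *\<^sub>R e) - f (x + h n *\<^sub>R e') + f x =
        h n * h n * partial j (partial i f) (x + s *\<^sub>R e + t *\<^sub>R e')"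
      using second_difference_mean_value[OF f hpos[of n], of x i j] unfolding e_def e'_def by blast
    obtain s' t' where 2: "0 < s'" "s' < h n" "0 < t'" "t' < h n"
      "f (x + h n *\<^sub>R e' + h n *\<^sub>R e) - f (x + h n *\<^sub>R e') - f (x + h n *\<^sub>R e) + f x =
        h n * h n * partial i (partial j f) (x + s' *\<^sub>R e' + t' *\<^sub>R e)"
      using second_difference_mean_value[OF f hpos[of n], of x j i] unfolding e_def e'_def by blast
    have "x + h n *\<^sub>R e + h n *\<^sub>R e' = x + h n *\<^sub>R e' + h n *\<^sub>R e" by simp
    from 1(5)[unfolded this] 2(5) have "h n * h n * partial j (partial i f) (x + s *\<^sub>R e + t *\<^sub>R e') =
      h n * h n * partial i (partial j f) (x + s' *\<^sub>R e' + t' *\<^sub>R e)"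
      by linarith
    with hpos[of n] 1 2 show ?thesis by auto
  qed
  then obtain s t s' t' where b: "\<And>n. 0 < s n \<and> s n < h n" "\<And>n. 0 < t n \<and> t n < h n"
    "\<And>n. 0 < s' n \<and> s' n < h n" "\<And>n. 0 < t' n \<and> t' n < h n"
    and eq: "\<And>n. partial j (partial i f) (x + s n *\<^sub>R e + t n *\<^sub>R e') = partial i (partial j f) (x + s' n *\<^sub>R e' + t' n *\<^sub>R e)"
    by metis
  have small: "u \<longlonglongrightarrow> 0" if "\<And>n. 0 < u n \<and> u n < h n" for u :: "nat \<Rightarrow> real"
    by (rule tendsto_sandwich[OF _ _ tendsto_const hlim]) (auto intro!: always_eventually less_imp_le simp: that)
  have line: "(\<lambda>n. x + u n *\<^sub>R v + u' n *\<^sub>R v') \<longlonglongrightarrow> x" if "u \<longlonglongrightarrow> 0" "u' \<longlonglongrightarrow> 0" for u u' v v'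
    using tendsto_add[OF tendsto_add[OF tendsto_const[of x] tendsto_scaleR[OF that(1) tendsto_const[of v]]]
        tendsto_scaleR[OF that(2) tendsto_const[of v']]] by simp
  have cont: "isCont (partial i' (partial j' f)) x" for i' j'
    using smooth_continuous_on[OF smooth_partial[OF smooth_partial[OF f]], of UNIV]
    by (simp add: continuous_on_eq_continuous_at)
  have "(\<lambda>n. partial j (partial i f) (x + s n *\<^sub>R e + t n *\<^sub>R e')) \<longlonglongrightarrow> partial j (partial i f) x"
    by (intro isCont_tendsto_compose[OF cont] line small b)
  moreover have "(\<lambda>n. partial i (partial j f) (x + s' n *\<^sub>R e' + t' n *\<^sub>R e)) \<longlonglongrightarrow> partial i (partial j f) x"
    by (intro isCont_tendsto_compose[OF cont] line small b)
  ultimately show "partial i (partial j f) x = partial j (partial i f) x"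
    unfolding eq using LIMSEQ_unique by blast
qed


section \<open>Smooth bump functions on boxes\<close>

text \<open>
  The family of all \<open>p(1/t) exp(-1/t)\<close>, extended by zero to \<open>t \<le> 0\<close>. Allowing every polynomial \<open>p\<close>
  makes the family closed under differentiation.
\<close>

definition flat_exp :: "real poly \<Rightarrow> real \<Rightarrow> real" where
  "flat_exp p t = (if t > 0 then poly p (1 / t) * exp (- 1 / t) else 0)"

lemma poly_times_exp_minus_tendsto_0:
  fixes p :: "real poly"
  shows "((\<lambda>y. poly p y * exp (- y)) \<longlongrightarrow> 0) at_top"
proof -
  have "((\<lambda>y. \<Sum>i\<le>degree p. coeff p i * (y ^ i / exp y)) \<longlongrightarrow> (\<Sum>i\<le>degree p. coeff p i * 0)) at_top"
    by (intro tendsto_sum tendsto_mult tendsto_const tendsto_power_div_exp_0)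
  then show ?thesis
    by (simp add: poly_altdef sum_distrib_right exp_minus divide_inverse mult.assoc)
qed

text \<open>
  For positive \<open>t\<close> the chain rule gives the polynomial \<open>X\<^sup>2 (p - p')\<close>, since \<open>1/t\<close> has the
  derivative \<open>-1/t\<^sup>2\<close>. At zero the difference quotient is again of the form \<open>q(y) exp(-y)\<close> with \<open>y =
  1/t\<close>, and the exponential beats every polynomial.
\<close>

lemma flat_exp_has_derivative:
  "(flat_exp p has_real_derivative flat_exp ([:0, 0, 1:] * (p - pderiv p)) t) (at t)"
proof -
  consider "t > 0" | "t < 0" | "t = 0" by linarith
  then show ?thesis
  proof cases
    case 1
    have "((\<lambda>t. poly p (1 / t) * exp (- 1 / t)) has_real_derivative
        flat_exp ([:0, 0, 1:] * (p - pderiv p)) t) (at t)"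
      using 1 unfolding flat_exp_def
      by (auto intro!: derivative_eq_intros DERIV_chain2[OF poly_DERIV] simp: field_simps power2_eq_square)
    then show ?thesis
      by (rule has_field_derivative_transform_within_open[of _ _ _ "{0<..}"])
        (use 1 in \<open>auto simp: flat_exp_def\<close>)
  next
    case 2
    have "((\<lambda>t. 0) has_real_derivative 0) (at t)" by simp
    then have "(flat_exp p has_real_derivative 0) (at t)"
      by (rule has_field_derivative_transform_within_open[of _ _ _ "{..<0}"])
        (use 2 in \<open>auto simp: flat_exp_def\<close>)
    then show ?thesis using 2 by (simp add: flat_exp_def)
  next
    case 3
    have "((\<lambda>h. poly (pCons 0 p) (inverse h) * exp (- inverse h)) \<longlongrightarrow> 0) (at_right (0::real))"
      by (rule filterlim_compose[OF poly_times_exp_minus_tendsto_0 filterlim_inverse_at_top_right])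
    then have "((\<lambda>h. (flat_exp p (0 + h) - flat_exp p 0) / h) \<longlongrightarrow> 0) (at_right 0)"
      by (rule Lim_transform_eventually)
        (auto simp: flat_exp_def eventually_at_right_field field_simps intro!: exI[of _ 1])
    moreover have "((\<lambda>h. (flat_exp p (0 + h) - flat_exp p 0) / h) \<longlongrightarrow> 0) (at_left 0)"
      by (rule Lim_transform_eventually[OF tendsto_const])
        (auto simp: flat_exp_def eventually_at_left_field intro!: exI[of _ "-1"])
    ultimately show ?thesis
      unfolding 3 by (simp add: DERIV_def filterlim_at_split flat_exp_def)
  qed
qed

lemma C_k_flat_exp: "C_k k (\<lambda>x::real^'n::finite. flat_exp p (\<alpha> * x $ i + \<beta>))"
proof (induction k arbitrary: p)
  case 0
  have "continuous_on UNIV (flat_exp p)"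
    using flat_exp_has_derivative[of p]
    by (meson DERIV_isCont continuous_at_imp_continuous_on)
  then show ?case
    by (auto intro!: continuous_on_compose2[of UNIV "flat_exp p"] continuous_intros)
next
  case (Suc k)
  define q where "q = [:0, 0, 1:] * (p - pderiv p)"
  have d: "((\<lambda>x::real^'n. flat_exp p (\<alpha> * x $ i + \<beta>)) has_derivative
      (\<lambda>h. flat_exp q (\<alpha> * x $ i + \<beta>) * (\<alpha> * h $ i))) (at x)" for x
  proof -
    have "(flat_exp p has_derivative (*) (flat_exp q (\<alpha> * x $ i + \<beta>))) (at (\<alpha> * x $ i + \<beta>))"
      using flat_exp_has_derivative unfolding q_def has_field_derivative_def .
    moreover have "((\<lambda>x::real^'n. \<alpha> * x $ i + \<beta>) has_derivative (\<lambda>h. \<alpha> * h $ i)) (at x)"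
      by (auto intro!: derivative_eq_intros bounded_linear_imp_has_derivative bounded_linear_vec_nth)
    ultimately show ?thesis
      by (rule has_derivative_compose[rotated])
  qed
  have "partial j (\<lambda>x::real^'n. flat_exp p (\<alpha> * x $ i + \<beta>)) =
      (\<lambda>x. (\<alpha> * axis j 1 $ i) *\<^sub>R flat_exp q (\<alpha> * x $ i + \<beta>))" for j
    by (rule ext) (simp add: partial_eqI[OF d] mult_ac)
  then show ?case
    using C_k_scaleR_const[OF Suc.IH[of q]] d by (auto simp: differentiable_def)
qed

text \<open>
  Since \<open>exp(-1/(k t))\<close> tends to one for every fixed \<open>t > 0\<close>, the scale \<open>k\<close> makes the bump approach
  the indicator function of the box without changing the set where it is positive.
\<close>

definition box_bump :: "real^'n::finite \<Rightarrow> real^'n \<Rightarrow> nat \<Rightarrow> real^'n \<Rightarrow> real" where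
  "box_bump a b k x = (\<Prod>i\<in>UNIV. flat_exp 1 (real (Suc k) * (x $ i - a $ i)) * flat_exp 1 (real (Suc k) * (b $ i - x $ i)))"

lemma smooth_box_bump:
  fixes a b :: "real^'n::finite"
  shows "smooth (box_bump a b k)"
proof -
  have 1: "smooth (\<lambda>x::real^'n. flat_exp 1 (real (Suc k) * (x $ i - a $ i)))" for i and a :: "real^'n"
    using C_k_flat_exp[of _ 1 "real (Suc k)" i "- real (Suc k) * a $ i"]
    by (simp add: smooth_def algebra_simps)
  have 2: "smooth (\<lambda>x::real^'n. flat_exp 1 (real (Suc k) * (b $ i - x $ i)))" for i
    using C_k_flat_exp[of _ 1 "- real (Suc k)" i "real (Suc k) * b $ i"]
    by (simp add: smooth_def algebra_simps)
  show ?thesis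
    unfolding box_bump_def using smooth_scaleR[OF 1 2] by (intro smooth_prod) simp
qed

lemma box_bump_bounds: "0 \<le> box_bump a b k x" "box_bump a b k x \<le> 1"
proof -
  have "0 \<le> flat_exp 1 t \<and> flat_exp 1 t \<le> 1" for t by (simp add: flat_exp_def)
  then show "0 \<le> box_bump a b k x" "box_bump a b k x \<le> 1"
    unfolding box_bump_def by (auto intro!: prod_nonneg prod_le_1 mult_le_one)
qed

lemma box_bump_nonzero_iff: "box_bump a b k x \<noteq> 0 \<longleftrightarrow> x \<in> box a b"
  by (auto simp: box_bump_def flat_exp_def mem_box_cart zero_less_mult_iff)

lemma box_bump_tendsto_indicator: "(\<lambda>k. box_bump a b k x) \<longlonglongrightarrow> indicator (box a b) x"
proof (cases "x \<in> box a b")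
  case True
  have "(\<lambda>k. flat_exp 1 (real (Suc k) * d)) \<longlonglongrightarrow> 1" if "d > 0" for d
  proof -
    have "(\<lambda>k. exp (- (1 / real (Suc k)) * (1 / d))) \<longlonglongrightarrow> exp (- 0 * (1 / d))"
      by (intro tendsto_intros LIMSEQ_Suc[OF lim_1_over_n])
    then show ?thesis using that by (simp add: flat_exp_def)
  qed
  with True have "(\<lambda>k. box_bump a b k x) \<longlonglongrightarrow> (\<Prod>i\<in>(UNIV::'a set). 1 * 1)"
    unfolding box_bump_def by (intro tendsto_prod tendsto_mult) (auto simp: mem_box_cart)
  with True show ?thesis by simp
next
  case False
  then have "box_bump a b k x = 0" for k using box_bump_nonzero_iff by blast
  with False show ?thesis by simp
qed

text \<open>
  The support is the closed box, so it is the closed box that has to fit into the domain.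
\<close>

lemma test_function_box_bump:
  assumes "cbox a b \<subseteq> \<Omega>"
  shows "test_function \<Omega> (box_bump a b k)"
proof -
  have "closure {x. box_bump a b k x \<noteq> 0} \<subseteq> cbox a b"
    by (rule closure_minimal) (auto simp: box_bump_nonzero_iff box_subset_cbox[THEN subsetD])
  then show ?thesis
    unfolding test_function_def compact_eq_bounded_closed using assms smooth_box_bump
    by (auto intro: bounded_subset[OF bounded_cbox])
qed


section \<open>Test functions\<close>

lemma test_function_vanishes_off_compact:
  assumes "test_function \<Omega> \<phi>"
  shows "\<exists>K. compact K \<and> K \<subseteq> \<Omega> \<and> (\<forall>x. x \<notin> K \<longrightarrow> \<phi> x = 0)"
proof (intro exI conjI allI impI)
  show "compact (closure {x. \<phi> x \<noteq> 0})" "closure {x. \<phi> x \<noteq> 0} \<subseteq> \<Omega>"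
    using assms by (auto simp: test_function_def)
  show "\<phi> x = 0" if "x \<notin> closure {x. \<phi> x \<noteq> 0}" for x
    using that closure_subset[of "{x. \<phi> x \<noteq> 0}"] by blast
qed

lemma partial_eq_0_outside_closed:
  assumes "closed K" "\<And>x. x \<notin> K \<Longrightarrow> f x = 0" "x \<notin> K"
  shows "partial i f x = 0"
proof -
  have "((\<lambda>_. 0) has_derivative (\<lambda>_. 0)) (at x)" by simp
  then have d: "(f has_derivative (\<lambda>_. 0)) (at x)"
    by (rule has_derivative_transform_within_open[of _ _ _ _ "- K"])
      (simp_all add: assms open_Compl)
  show ?thesis using partial_eqI[OF d] .
qed

lemma test_function_partial:
  assumes "test_function \<Omega> \<phi>"
  shows "test_function \<Omega> (partial i \<phi>)"
proof -
  let ?K = "closure {x. \<phi> x \<noteq> 0}"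
  have "{x. partial i \<phi> x \<noteq> 0} \<subseteq> ?K"
  proof (rule subsetI, rule ccontr)
    fix x assume x: "x \<in> {x. partial i \<phi> x \<noteq> 0}" "x \<notin> ?K"
    have "\<phi> y = 0" if "y \<notin> ?K" for y
      using that closure_subset[of "{x. \<phi> x \<noteq> 0}"] by blast
    from partial_eq_0_outside_closed[OF closed_closure this x(2)] have "partial i \<phi> x = 0" .
    with x show False by simp
  qed
  then have sub: "closure {x. partial i \<phi> x \<noteq> 0} \<subseteq> ?K"
    by (rule closure_minimal) simp
  moreover have "compact ?K" using assms by (simp add: test_function_def)
  ultimately have "compact (closure {x. partial i \<phi> x \<noteq> 0})"
    unfolding compact_eq_bounded_closed using bounded_subset by blast
  with sub assms show ?thesis
    unfolding test_function_def using smooth_partial by blast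
qed

lemma test_function_partials: "test_function \<Omega> \<phi> \<Longrightarrow> test_function \<Omega> (partials \<alpha> \<phi>)"
  by (induction \<alpha>) (auto simp: test_function_partial)

lemma test_function_bounded:
  assumes "test_function \<Omega> \<phi>"
  shows "\<exists>M\<ge>0. \<forall>x. \<bar>\<phi> x\<bar> \<le> M"
proof -
  obtain K where K: "compact K" "K \<subseteq> \<Omega>" "\<forall>x. x \<notin> K \<longrightarrow> \<phi> x = 0"
    using test_function_vanishes_off_compact[OF assms] by blast
  have "compact (\<phi> ` K)"
    using assms K by (intro compact_continuous_image smooth_continuous_on) (auto simp: test_function_def)
  then obtain M where M: "\<And>x. x \<in> K \<Longrightarrow> norm (\<phi> x) \<le> M"
    using compact_imp_bounded[of "\<phi> ` K"] unfolding bounded_iff by blast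
  have "\<bar>\<phi> x\<bar> \<le> max 0 M" for x
    using M[of x] K(3)[rule_format, of x] by (cases "x \<in> K") (auto simp: max_def)
  then show ?thesis by (intro exI[of _ "max 0 M"]) auto
qed

lemma test_function_measurable:
  assumes "test_function \<Omega> \<phi>"
  shows "\<phi> \<in> borel_measurable lebesgue"
proof -
  have "\<phi> \<in> borel_measurable borel"
    using assms unfolding test_function_def
    by (intro borel_measurable_continuous_onI smooth_continuous_on) blast
  then show ?thesis by (intro measurable_completion) simp
qed

text \<open>
  A test function cuts off to a compact set, where local integrability applies, and is bounded
  there.
\<close>

lemma set_integrable_test_function_mult:
  assumes \<phi>: "test_function \<Omega> \<phi>" and u: "locally_integrable \<Omega> u"
  shows "set_integrable lebesgue \<Omega> (\<lambda>x. \<phi> x *\<^sub>R u x)"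
proof -
  obtain K where K: "compact K" "K \<subseteq> \<Omega>" "\<forall>x. x \<notin> K \<longrightarrow> \<phi> x = 0"
    using test_function_vanishes_off_compact[OF \<phi>] by blast
  obtain M where M: "\<And>x. \<bar>\<phi> x\<bar> \<le> M"
    using test_function_bounded[OF \<phi>] by blast
  define v where "v x = indicator K x *\<^sub>R u x" for x
  have v: "integrable lebesgue v"
    using u K unfolding v_def locally_integrable_def set_integrable_def by blast
  have "integrable lebesgue (\<lambda>x. \<phi> x *\<^sub>R v x)"
  proof (rule Bochner_Integration.integrable_bound)
    show "integrable lebesgue (\<lambda>x. M *\<^sub>R v x)" using v by (rule integrable_scaleR_right)
    show "(\<lambda>x. \<phi> x *\<^sub>R v x) \<in> borel_measurable lebesgue"
      by (rule borel_measurable_scaleR[OF test_function_measurable[OF \<phi>] borel_measurable_integrable[OF v]])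
    show "AE x in lebesgue. norm (\<phi> x *\<^sub>R v x) \<le> norm (M *\<^sub>R v x)"
      using order_trans[OF M abs_ge_self] by (intro AE_I2) (simp add: mult_right_mono)
  qed
  also have "(\<lambda>x. \<phi> x *\<^sub>R v x) = (\<lambda>x. indicator \<Omega> x *\<^sub>R (\<phi> x *\<^sub>R u x))"
    using K by (auto simp: indicator_def fun_eq_iff v_def)
  finally show ?thesis by (simp add: set_integrable_def)
qed


section \<open>Integration by parts against test functions\<close>

text \<open>
  Translation invariance makes the integral of every difference quotient vanish, and the difference
  quotients converge to the derivative boundedly with supports in one ball.
\<close>

lemma integral_partial_eq_0:
  fixes f :: "real^'n::finite \<Rightarrow> complex"
  assumes diff: "\<And>x. f differentiable (at x)" and cont: "continuous_on UNIV (partial i f)"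
    and K: "compact K" "\<And>x. x \<notin> K \<Longrightarrow> f x = 0"
  shows "integral\<^sup>L lebesgue (partial i f) = 0"
proof -
  define e where "e = (axis i 1 :: real^'n)"
  have ne: "norm e = 1" by (simp add: e_def norm_axis_1)
  have fcont: "continuous_on S f" for S
    using diff by (meson continuous_at_imp_continuous_on differentiable_imp_continuous_within)
  have fint: "integrable lborel f"
  proof -
    have "integrable lborel (\<lambda>x. indicator K x *\<^sub>R f x)"
      by (intro borel_integrable_compact K fcont)
    also have "(\<lambda>x. indicator K x *\<^sub>R f x) = f" using K by (auto simp: indicator_def fun_eq_iff)
    finally show ?thesis .
  qed
  have fm: "f \<in> borel_measurable borel" by (intro borel_measurable_continuous_onI fcont)
  have pm: "partial i f \<in> borel_measurable borel" by (intro borel_measurable_continuous_onI cont)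
  obtain M where M: "\<And>x. norm (partial i f x) \<le> M"
  proof -
    have "compact (partial i f ` K)"
      by (intro compact_continuous_image K continuous_on_subset[OF cont]) auto
    then obtain M where M: "\<And>x. x \<in> K \<Longrightarrow> norm (partial i f x) \<le> M"
      using compact_imp_bounded[of "partial i f ` K"] unfolding bounded_iff by blast
    have 0: "partial i f x = 0" if "x \<notin> K" for x
      using partial_eq_0_outside_closed[OF compact_imp_closed[OF K(1)] K(2) that] .
    have "norm (partial i f x) \<le> max 0 M" for x
      using M[of x] 0[of x] by (cases "x \<in> K") auto
    then show thesis using that by blast
  qed
  obtain r where r: "\<And>x. x \<in> K \<Longrightarrow> norm x \<le> r"
    using compact_imp_bounded[OF K(1)] bounded_iff by blast
  define h where "h n = 1 / real (Suc n)" for n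
  have hpos: "0 < h n" "h n \<le> 1" for n by (simp_all add: h_def)
  have hlim: "h \<longlonglongrightarrow> 0" unfolding h_def by (rule LIMSEQ_Suc[OF lim_1_over_n])
  define D where "D n x = (f (h n *\<^sub>R e + x) - f x) /\<^sub>R h n" for n x
  have line: "((\<lambda>s. f (x + s *\<^sub>R e)) has_vector_derivative partial i f (x + s *\<^sub>R e)) (at s)" for x s
    unfolding e_def by (rule has_vector_derivative_along_axis[OF diff])
  have lim: "(\<lambda>n. D n x) \<longlonglongrightarrow> partial i f x" for x
  proof -
    have lim0: "((\<lambda>s. norm (f (x + s *\<^sub>R e) - f x - s *\<^sub>R partial i f x) / norm s) \<longlongrightarrow> 0) (at 0)"
      using line[of x 0] by (simp add: has_vector_derivative_def has_derivative_at)
    have quot: "norm (f (x + s *\<^sub>R e) - f x - s *\<^sub>R partial i f x) / norm s =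
        norm ((f (x + s *\<^sub>R e) - f x) /\<^sub>R s - partial i f x)" if "s \<noteq> 0" for s
    proof -
      have "(f (x + s *\<^sub>R e) - f x) /\<^sub>R s - partial i f x = (f (x + s *\<^sub>R e) - f x - s *\<^sub>R partial i f x) /\<^sub>R s"
        using that by (simp add: scaleR_diff_right)
      then show ?thesis by (simp add: divide_inverse mult.commute)
    qed
    have "((\<lambda>s. norm ((f (x + s *\<^sub>R e) - f x) /\<^sub>R s - partial i f x)) \<longlongrightarrow> 0) (at 0)"
      by (rule Lim_transform_eventually[OF lim0]) (use quot in \<open>simp add: eventually_at_filter\<close>)
    then have "((\<lambda>s. (f (x + s *\<^sub>R e) - f x) /\<^sub>R s) \<longlongrightarrow> partial i f x) (at 0)"
      by (simp add: tendsto_norm_zero_iff Lim_null[symmetric])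
    moreover have "filterlim h (at 0) sequentially"
      using hlim hpos by (simp add: filterlim_at eventually_sequentially less_imp_neq) (metis less_irrefl)
    ultimately have "(\<lambda>n. (f (x + h n *\<^sub>R e) - f x) /\<^sub>R h n) \<longlonglongrightarrow> partial i f x"
      by (rule filterlim_compose)
    then show ?thesis by (simp add: D_def add.commute)
  qed
  have bound: "norm (D n x) \<le> indicator (cball 0 (r + 1)) x *\<^sub>R M" for n x
  proof (cases "x \<in> cball 0 (r + 1)")
    case True
    have "\<exists>s\<in>{0<..<h n}. norm (f (x + h n *\<^sub>R e) - f (x + 0 *\<^sub>R e)) \<le> norm ((h n - 0) *\<^sub>R partial i f (x + s *\<^sub>R e))"
      by (rule mvt_general[OF hpos(1)])
        (auto intro!: continuous_at_imp_continuous_on has_vector_derivative_continuous[OF line]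
          line[unfolded has_vector_derivative_def])
    then obtain s where "norm (f (x + h n *\<^sub>R e) - f x) \<le> h n * norm (partial i f (x + s *\<^sub>R e))"
      using hpos[of n] by auto
    also have "\<dots> \<le> h n * M" using M hpos[of n] by (intro mult_left_mono) auto
    finally have "norm (f (x + h n *\<^sub>R e) - f x) / h n \<le> M"
      using hpos[of n] by (simp add: pos_divide_le_eq mult.commute)
    moreover have "norm (D n x) = norm (f (x + h n *\<^sub>R e) - f x) / h n"
      using hpos[of n] by (simp add: D_def divide_inverse add.commute mult.commute)
    ultimately show ?thesis using True by simp
  next
    case False
    then have "norm x > r + 1" by simp
    moreover have "norm x \<le> norm (h n *\<^sub>R e + x) + norm (h n *\<^sub>R e)"
      using norm_triangle_ineq4[of "h n *\<^sub>R e + x" "h n *\<^sub>R e"] by simp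
    moreover have "norm (h n *\<^sub>R e) \<le> 1" using hpos[of n] ne by simp
    ultimately have "norm (h n *\<^sub>R e + x) > r" "norm x > r" by linarith+
    then have "h n *\<^sub>R e + x \<notin> K" "x \<notin> K" using r by force+
    then show ?thesis using False K by (simp add: D_def)
  qed
  have trans: "integrable lborel (\<lambda>x. f (c + x)) \<and> integral\<^sup>L lborel (\<lambda>x. f (c + x)) = integral\<^sup>L lborel f" for c
  proof -
    have 1: "distr lborel borel ((+) c) = (lborel :: (real^'n) measure)" by (rule lborel_distr_plus)
    have "integral\<^sup>L (distr lborel borel ((+) c)) f = integral\<^sup>L lborel (\<lambda>x. f (c + x))"
      using fm by (intro integral_distr) auto
    moreover have "integrable (distr lborel borel ((+) c)) f \<longleftrightarrow> integrable lborel (\<lambda>x. f (c + x))"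
      using fm by (intro integrable_distr_eq) auto
    ultimately show ?thesis using fint by (simp add: 1)
  qed
  have "integral\<^sup>L lborel (D n) = 0" for n
    unfolding D_def using trans[of "h n *\<^sub>R e"] fint by simp
  moreover have "(\<lambda>n. integral\<^sup>L lborel (D n)) \<longlonglongrightarrow> integral\<^sup>L lborel (partial i f)"
  proof (rule integral_dominated_convergence[where w="\<lambda>x. indicator (cball 0 (r + 1)) x *\<^sub>R M"])
    show "integrable lborel (\<lambda>x::real^'n. indicator (cball 0 (r + 1)) x *\<^sub>R M)"
      by (intro borel_integrable_compact) auto
    show "D n \<in> borel_measurable lborel" for n
      unfolding D_def using fint trans[of "h n *\<^sub>R e"] by auto
  qed (use pm lim bound in auto)
  ultimately have "integral\<^sup>L lborel (partial i f) = 0"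
    by (simp add: LIMSEQ_const_iff)
  then show ?thesis using pm by (simp add: integral_completion)
qed

lemma continuous_locally_integrable:
  fixes w :: "real^'n::finite \<Rightarrow> complex"
  assumes "continuous_on UNIV w"
  shows "locally_integrable \<Omega> w"
  unfolding locally_integrable_def set_integrable_def
proof (intro allI impI)
  fix K assume "compact K \<and> K \<subseteq> \<Omega>"
  then have "integrable lborel (\<lambda>x. indicator K x *\<^sub>R w x)"
    using assms by (intro borel_integrable_compact) (auto intro: continuous_on_subset)
  then show "integrable lebesgue (\<lambda>x. indicator K x *\<^sub>R w x)"
    by (subst integrable_completion) auto
qed

lemma integral_test_function_eq_whole:
  assumes "test_function \<Omega> \<phi>"
  shows "(LINT x:\<Omega>|lebesgue. \<phi> x *\<^sub>R u x) = integral\<^sup>L lebesgue (\<lambda>x. \<phi> x *\<^sub>R u x)"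
proof -
  have "\<phi> x = 0" if "x \<notin> \<Omega>" for x
    using test_function_vanishes_off_compact[OF assms] that by blast
  then have "(\<lambda>x. indicator \<Omega> x *\<^sub>R (\<phi> x *\<^sub>R u x)) = (\<lambda>x. \<phi> x *\<^sub>R u x)"
    by (auto simp: indicator_def fun_eq_iff)
  then show ?thesis by (simp add: set_lebesgue_integral_def)
qed

text \<open>
  The classical product rule, integrated with \<open>integral_partial_eq_0\<close>.
\<close>

lemma has_weak_deriv_partial:
  fixes w :: "real^'n::finite \<Rightarrow> complex"
  assumes w: "smooth w"
  shows "has_weak_deriv \<Omega> [i] w (partial i w)"
  unfolding has_weak_deriv_def
proof (intro conjI allI impI)
  show li: "locally_integrable \<Omega> w" "locally_integrable \<Omega> (partial i w)"
    using w by (auto intro!: continuous_locally_integrable smooth_continuous_on smooth_partial)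
  fix \<phi> :: "real^'n \<Rightarrow> real"
  assume \<phi>: "test_function \<Omega> \<phi>"
  then have s\<phi>: "smooth \<phi>" by (simp add: test_function_def)
  have sf: "smooth (\<lambda>x. \<phi> x *\<^sub>R w x)" by (rule smooth_scaleR[OF s\<phi> w])
  obtain K where K: "compact K" "K \<subseteq> \<Omega>" "\<forall>x. x \<notin> K \<longrightarrow> \<phi> x = 0"
    using test_function_vanishes_off_compact[OF \<phi>] by blast
  have "integral\<^sup>L lebesgue (partial i (\<lambda>x. \<phi> x *\<^sub>R w x)) = 0"
    by (rule integral_partial_eq_0[OF smooth_differentiable[OF sf] smooth_continuous_on[OF smooth_partial[OF sf]] K(1)])
      (simp add: K(3))
  also have "partial i (\<lambda>x. \<phi> x *\<^sub>R w x) = (\<lambda>x. \<phi> x *\<^sub>R partial i w x + partial i \<phi> x *\<^sub>R w x)"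
    by (intro ext partial_scaleR smooth_differentiable s\<phi> w)
  finally have 1: "integral\<^sup>L lebesgue (\<lambda>x. \<phi> x *\<^sub>R partial i w x + partial i \<phi> x *\<^sub>R w x) = 0" .
  have int: "integrable lebesgue (\<lambda>x. \<psi> x *\<^sub>R v x)" if \<psi>: "test_function UNIV \<psi>" and v: "locally_integrable UNIV v"
    for \<psi> :: "real^'n \<Rightarrow> real" and v :: "real^'n \<Rightarrow> complex"
    using set_integrable_test_function_mult[OF \<psi> v] by (simp add: set_integrable_def)
  have \<phi>U: "test_function UNIV \<phi>" using \<phi> by (simp add: test_function_def)
  have "integral\<^sup>L lebesgue (\<lambda>x. \<phi> x *\<^sub>R partial i w x + partial i \<phi> x *\<^sub>R w x) =
      integral\<^sup>L lebesgue (\<lambda>x. \<phi> x *\<^sub>R partial i w x) + integral\<^sup>L lebesgue (\<lambda>x. partial i \<phi> x *\<^sub>R w x)"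
    using w by (intro Bochner_Integration.integral_add int \<phi>U test_function_partial continuous_locally_integrable)
      (auto intro: smooth_continuous_on smooth_partial)
  with 1 show "(LINT x:\<Omega>|lebesgue. partials [i] \<phi> x *\<^sub>R w x) =
      (-1) ^ length [i] * (LINT x:\<Omega>|lebesgue. \<phi> x *\<^sub>R partial i w x)"
    using integral_test_function_eq_whole[OF \<phi>, of "partial i w"]
      integral_test_function_eq_whole[OF test_function_partial[OF \<phi>], of i w]
    by (simp add: add_eq_0_iff)
qed


section \<open>Uniqueness of weak derivatives\<close>

text \<open>
  The bumps on the box are test functions that converge to its indicator function; dominated
  convergence moves the hypothesis to the limit.
\<close>

lemma integral_box_eq_0_if_test_integrals_0:
  fixes v :: "real^'n::finite \<Rightarrow> complex"
  assumes v: "locally_integrable \<Omega> v" and ab: "cbox a b \<subseteq> \<Omega>"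
    and test: "\<And>\<phi>. test_function \<Omega> \<phi> \<Longrightarrow> (LINT x:\<Omega>|lebesgue. \<phi> x *\<^sub>R v x) = 0"
  shows "(LINT x:box a b|lebesgue. v x) = 0"
proof -
  define u where "u x = indicator (cbox a b) x *\<^sub>R v x" for x
  have u: "integrable lebesgue u"
    using v ab unfolding locally_integrable_def set_integrable_def u_def by auto
  have tf: "test_function \<Omega> (box_bump a b k)" for k
    by (rule test_function_box_bump[OF ab])
  have bump_u: "box_bump a b k x *\<^sub>R u x = box_bump a b k x *\<^sub>R v x" for k x
    using box_bump_nonzero_iff[of a b k x] box_subset_cbox[of a b] by (auto simp: u_def indicator_def)
  have "integral\<^sup>L lebesgue (\<lambda>x. box_bump a b k x *\<^sub>R u x) = 0" for k
    unfolding bump_u using test[OF tf, of k] integral_test_function_eq_whole[OF tf, of k v] by simp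
  moreover have "(\<lambda>k. integral\<^sup>L lebesgue (\<lambda>x. box_bump a b k x *\<^sub>R u x))
      \<longlonglongrightarrow> integral\<^sup>L lebesgue (\<lambda>x. indicator (box a b) x *\<^sub>R u x)"
  proof (rule integral_dominated_convergence[where w="\<lambda>x. norm (u x)"])
    show "(\<lambda>x. indicator (box a b) x *\<^sub>R u x) \<in> borel_measurable lebesgue"
      using borel_measurable_integrable[OF u] by (intro borel_measurable_scaleR) (simp_all add: borel_measurable_indicator)
    show "(\<lambda>x. box_bump a b k x *\<^sub>R u x) \<in> borel_measurable lebesgue" for k
      by (rule borel_measurable_scaleR[OF test_function_measurable[OF tf] borel_measurable_integrable[OF u]])
    show "integrable lebesgue (\<lambda>x. norm (u x))" using u by simp
    show "AE x in lebesgue. (\<lambda>k. box_bump a b k x *\<^sub>R u x) \<longlonglongrightarrow> indicator (box a b) x *\<^sub>R u x"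
      by (intro AE_I2 tendsto_scaleR box_bump_tendsto_indicator tendsto_const)
    show "AE x in lebesgue. norm (box_bump a b k x *\<^sub>R u x) \<le> norm (u x)" for k
      using box_bump_bounds[of a b k] by (intro AE_I2) (simp add: mult_left_le_one_le)
  qed
  ultimately have "integral\<^sup>L lebesgue (\<lambda>x. indicator (box a b) x *\<^sub>R u x) = 0"
    by (simp add: LIMSEQ_const_iff)
  also have "(\<lambda>x. indicator (box a b) x *\<^sub>R u x) = (\<lambda>x. indicator (box a b) x *\<^sub>R v x)"
    using box_subset_cbox[of a b] by (auto simp: u_def indicator_def fun_eq_iff)
  finally show ?thesis by (simp add: set_lebesgue_integral_def)
qed

text \<open>
  Boxes are closed under intersection and generate the Borel sets, so vanishing spreads from boxes
  to all Borel sets, and from there to all Lebesgue sets, which differ from Borel sets by null sets.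
\<close>

lemma AE_eq_0_if_box_integrals_0:
  fixes f :: "real^'n::finite \<Rightarrow> complex"
  assumes f: "integrable lebesgue f" and vanish: "\<And>x. x \<notin> box a b \<Longrightarrow> f x = 0"
    and boxes: "\<And>c d. box c d \<subseteq> box a b \<Longrightarrow> (LINT x:box c d|lebesgue. f x) = 0"
  shows "AE x in lebesgue. f x = 0"
proof -
  interpret sigma_finite_measure "lebesgue :: (real^'n) measure"
    using lborel.sigma_finite_countable by unfold_locales fastforce
  have restrict: "(LINT x:A|lebesgue. f x) = (LINT x:A \<inter> box a b|lebesgue. f x)" for A
    unfolding set_lebesgue_integral_def
    by (intro Bochner_Integration.integral_cong) (use vanish in \<open>auto simp: indicator_def\<close>)
  have box0: "(LINT x:box c d|lebesgue. f x) = 0" for c d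
  proof -
    obtain c' d' where "box c d \<inter> box a b = box c' d'" using box_Int_box by blast
    then show ?thesis using restrict[of "box c d"] boxes[of c' d'] by auto
  qed
  have whole0: "integral\<^sup>L lebesgue f = 0"
    using box0[of a b] restrict[of UNIV] by (simp add: set_lebesgue_integral_def)
  have int: "set_integrable lebesgue A f" if "A \<in> sets lebesgue" for A
    unfolding set_integrable_def using f that by (rule integrable_mult_indicator[rotated])
  have borel0: "(LINT x:A|lebesgue. f x) = 0" if "A \<in> sets borel" for A
  proof -
    let ?B = "range (\<lambda>(a, b). box a b :: (real^'n) set)"
    have "Int_stable ?B" by (auto simp: Int_stable_def box_Int_box)
    moreover have "?B \<subseteq> Pow UNIV" by simp
    moreover have "A \<in> sigma_sets UNIV (range (\<lambda>(a, b). box a b :: (real^'n) set))"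
      using that unfolding borel_eq_box by simp
    ultimately show ?thesis
    proof (induction rule: sigma_sets_induct_disjoint)
      case (basic A)
      then show ?case using box0 by auto
    next
      case empty
      then show ?case by (simp add: set_lebesgue_integral_def)
    next
      case (compl A)
      then have A: "A \<in> sets lebesgue" by (simp add: borel_eq_box)
      have A': "UNIV - A \<in> sets lebesgue" using sets.compl_sets[OF A] by simp
      have "(LINT x:UNIV|lebesgue. f x) = (LINT x:A|lebesgue. f x) + (LINT x:UNIV - A|lebesgue. f x)"
        using set_integral_Un[of A "UNIV - A" lebesgue f] int[OF A] int[OF A'] by simp
      with compl whole0 show ?case by (simp add: set_lebesgue_integral_def)
    next
      case (union A)
      have "A i \<in> sets borel" for i unfolding borel_eq_box using union by auto
      then have A: "A i \<in> sets lebesgue" for i by simp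
      have "(LINT x:(\<Union>i. A i)|lebesgue. f x) = (\<Sum>i. (LINT x:A i|lebesgue. f x))"
        using A union by (intro lebesgue_integral_countable_add int) (auto simp: disjoint_family_on_def)
      with union show ?case by simp
    qed
  qed
  have "(LINT x:A|lebesgue. f x) = 0" if A: "A \<in> sets lebesgue" for A
  proof -
    obtain B N N' where B: "A = B \<union> N" "N \<subseteq> N'" "N' \<in> null_sets lborel" "B \<in> sets lborel"
      using A by (rule sets_completionE)
    have "N \<in> null_sets lebesgue"
      using B(2,3) by (rule null_sets_completion_subset[OF _ null_sets_completionI])
    moreover have "A - B \<union> (B - A) \<subseteq> N" using B by auto
    ultimately have "A - B \<union> (B - A) \<in> null_sets lebesgue"
      by (rule null_sets_completion_subset[rotated])
    then have "(LINT x:A|lebesgue. f x) = (LINT x:B|lebesgue. f x)"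
      using f A B by (intro set_integral_null_delta) auto
    then show ?thesis using borel0 B by simp
  qed
  then show ?thesis by (rule density_zero[OF f])
qed

text \<open>
  The fundamental lemma of the calculus of variations. The domain is a countable union of closed
  boxes, and the boundary of a box is a null set.
\<close>

lemma AE_eq_0_if_test_integrals_0:
  fixes v :: "real^'n::finite \<Rightarrow> complex"
  assumes \<Omega>: "open \<Omega>" and v: "locally_integrable \<Omega> v"
    and test: "\<And>\<phi>. test_function \<Omega> \<phi> \<Longrightarrow> (LINT x:\<Omega>|lebesgue. \<phi> x *\<^sub>R v x) = 0"
  shows "AE x in lebesgue_on \<Omega>. v x = 0"
proof -
  obtain \<D> where \<D>: "countable \<D>" "\<D> \<subseteq> Pow \<Omega>" "\<And>X. X \<in> \<D> \<Longrightarrow> \<exists>a b. X = cbox a b" "\<Union>\<D> = \<Omega>"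
    using open_countable_Union_open_cbox[OF \<Omega>] by blast
  have "AE x in lebesgue. x \<in> X \<longrightarrow> v x = 0" if X: "X \<in> \<D>" for X
  proof -
    obtain a b where ab: "X = cbox a b" "cbox a b \<subseteq> \<Omega>" using \<D> X by blast
    define f where "f x = indicator (box a b) x *\<^sub>R v x" for x
    have sub: "box a b \<subseteq> cbox a b" by (rule box_subset_cbox)
    have "set_integrable lebesgue (cbox a b) v"
      using v ab by (auto simp: locally_integrable_def)
    then have f: "integrable lebesgue f"
      using set_integrable_subset[of lebesgue "cbox a b" v "box a b"] sub
      by (simp add: f_def[abs_def] set_integrable_def)
    have "AE x in lebesgue. f x = 0"
    proof (rule AE_eq_0_if_box_integrals_0[OF f])
      show "f x = 0" if "x \<notin> box a b" for x using that by (simp add: f_def)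
      fix c d assume cd: "box c d \<subseteq> box a b"
      show "(LINT x:box c d|lebesgue. f x) = 0"
      proof (cases "box c d = {}")
        case False
        then have "cbox c d = closure (box c d)" by (simp add: closure_box)
        also have "\<dots> \<subseteq> cbox a b" using cd sub by (intro closure_minimal) auto
        finally have "(LINT x:box c d|lebesgue. v x) = 0"
          using ab by (intro integral_box_eq_0_if_test_integrals_0[OF v _ test]) auto
        moreover have "(LINT x:box c d|lebesgue. f x) = (LINT x:box c d|lebesgue. v x)"
          unfolding set_lebesgue_integral_def
          by (intro Bochner_Integration.integral_cong) (use cd in \<open>auto simp: indicator_def f_def\<close>)
        ultimately show ?thesis by simp
      qed (simp add: set_lebesgue_integral_def)
    qed
    moreover have "AE x in lebesgue. x \<notin> cbox a b - box a b"
      using negligible_frontier_interval[of a b] unfolding negligible_iff_null_sets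
      by (rule AE_not_in)
    ultimately show ?thesis
      by eventually_elim (auto simp: f_def ab indicator_def split: if_splits)
  qed
  then have "AE x in lebesgue. \<forall>X\<in>\<D>. x \<in> X \<longrightarrow> v x = 0"
    using \<D>(1) by (intro AE_ball_countable[THEN iffD2] ballI)
  then have "AE x in lebesgue. x \<in> \<Omega> \<longrightarrow> v x = 0"
    by eventually_elim (use \<D>(4) in blast)
  then show ?thesis
    using \<Omega> by (simp add: AE_restrict_space_iff)
qed

lemma locally_integrable_lincomb:
  assumes "locally_integrable \<Omega> u" "locally_integrable \<Omega> v"
  shows "locally_integrable \<Omega> (\<lambda>x. s *\<^sub>R u x + t *\<^sub>R v x)"
  using assms unfolding locally_integrable_def
  by (auto intro!: set_integral_add set_integrable_scaleR_right)

lemma has_weak_deriv_lincomb: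
  assumes u: "has_weak_deriv \<Omega> \<alpha> u u'" and v: "has_weak_deriv \<Omega> \<alpha> v v'"
  shows "has_weak_deriv \<Omega> \<alpha> (\<lambda>x. s *\<^sub>R u x + t *\<^sub>R v x) (\<lambda>x. s *\<^sub>R u' x + t *\<^sub>R v' x)"
  unfolding has_weak_deriv_def
proof (intro conjI allI impI)
  have li: "locally_integrable \<Omega> u" "locally_integrable \<Omega> u'" "locally_integrable \<Omega> v" "locally_integrable \<Omega> v'"
    using assms by (auto simp: has_weak_deriv_def)
  then show "locally_integrable \<Omega> (\<lambda>x. s *\<^sub>R u x + t *\<^sub>R v x)" "locally_integrable \<Omega> (\<lambda>x. s *\<^sub>R u' x + t *\<^sub>R v' x)"
    by (auto intro: locally_integrable_lincomb)
  fix \<phi> assume \<phi>: "test_function \<Omega> \<phi>"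
  have lin: "(LINT x:\<Omega>|lebesgue. \<psi> x *\<^sub>R (s *\<^sub>R p x + t *\<^sub>R q x)) =
      s *\<^sub>R (LINT x:\<Omega>|lebesgue. \<psi> x *\<^sub>R p x) + t *\<^sub>R (LINT x:\<Omega>|lebesgue. \<psi> x *\<^sub>R q x)"
    if \<psi>: "test_function \<Omega> \<psi>" and p: "locally_integrable \<Omega> p" and q: "locally_integrable \<Omega> q" for \<psi> p q
  proof -
    have "(LINT x:\<Omega>|lebesgue. \<psi> x *\<^sub>R (s *\<^sub>R p x + t *\<^sub>R q x)) =
        (LINT x:\<Omega>|lebesgue. s *\<^sub>R (\<psi> x *\<^sub>R p x) + t *\<^sub>R (\<psi> x *\<^sub>R q x))"
      by (simp add: scaleR_add_right mult.commute del: set_integral_add)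
    also have "\<dots> = (LINT x:\<Omega>|lebesgue. s *\<^sub>R (\<psi> x *\<^sub>R p x)) + (LINT x:\<Omega>|lebesgue. t *\<^sub>R (\<psi> x *\<^sub>R q x))"
      by (intro set_integral_add(2) set_integrable_scaleR_right set_integrable_test_function_mult \<psi> p q)
    also have "\<dots> = s *\<^sub>R (LINT x:\<Omega>|lebesgue. \<psi> x *\<^sub>R p x) + t *\<^sub>R (LINT x:\<Omega>|lebesgue. \<psi> x *\<^sub>R q x)"
      by (simp only: set_integral_scaleR_right)
    finally show ?thesis .
  qed
  have "(LINT x:\<Omega>|lebesgue. partials \<alpha> \<phi> x *\<^sub>R u x) = (-1) ^ length \<alpha> * (LINT x:\<Omega>|lebesgue. \<phi> x *\<^sub>R u' x)"
    "(LINT x:\<Omega>|lebesgue. partials \<alpha> \<phi> x *\<^sub>R v x) = (-1) ^ length \<alpha> * (LINT x:\<Omega>|lebesgue. \<phi> x *\<^sub>R v' x)"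
    using u v \<phi> by (auto simp: has_weak_deriv_def)
  then show "(LINT x:\<Omega>|lebesgue. partials \<alpha> \<phi> x *\<^sub>R (s *\<^sub>R u x + t *\<^sub>R v x)) =
      (-1) ^ length \<alpha> * (LINT x:\<Omega>|lebesgue. \<phi> x *\<^sub>R (s *\<^sub>R u' x + t *\<^sub>R v' x))"
    using lin[OF \<phi> li(2) li(4)] lin[OF test_function_partials[OF \<phi>] li(1) li(3)]
    by (simp add: distrib_left)
qed

lemma weak_deriv_unique:
  assumes \<Omega>: "open \<Omega>" and "has_weak_deriv \<Omega> \<alpha> u v" "has_weak_deriv \<Omega> \<alpha> u w"
  shows "AE x in lebesgue_on \<Omega>. v x = w x"
proof -
  from has_weak_deriv_lincomb[OF assms(2,3), of 1 "-1"]
  have d: "has_weak_deriv \<Omega> \<alpha> (\<lambda>x. 0) (\<lambda>x. v x - w x)" by simp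
  have "AE x in lebesgue_on \<Omega>. v x - w x = 0"
  proof (rule AE_eq_0_if_test_integrals_0[OF \<Omega>])
    show "locally_integrable \<Omega> (\<lambda>x. v x - w x)" using d by (simp add: has_weak_deriv_def)
    show "(LINT x:\<Omega>|lebesgue. \<phi> x *\<^sub>R (v x - w x)) = 0" if "test_function \<Omega> \<phi>" for \<phi>
      using d that unfolding has_weak_deriv_def by (auto simp: set_lebesgue_integral_def)
  qed
  then show ?thesis by simp
qed

lemma locally_integrable_cong_AE:
  fixes u v :: "real^'n::finite \<Rightarrow> complex"
  assumes \<Omega>: "open \<Omega>" and eq: "AE x in lebesgue_on \<Omega>. u x = v x"
  shows "locally_integrable \<Omega> u \<longleftrightarrow> locally_integrable \<Omega> v"
proof -
  have AE: "AE x in lebesgue. x \<in> \<Omega> \<longrightarrow> u x = v x"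
    using eq \<Omega> by (simp add: AE_restrict_space_iff)
  have imp: "set_integrable lebesgue K v"
    if "AE x in lebesgue. x \<in> \<Omega> \<longrightarrow> u x = v x" "K \<subseteq> \<Omega>" "set_integrable lebesgue K u" for K and u v :: "real^'n \<Rightarrow> complex"
  proof -
    have AE: "AE x in lebesgue. indicator K x *\<^sub>R u x = indicator K x *\<^sub>R v x"
      using that(1) by eventually_elim (use that(2) in \<open>auto simp: indicator_def\<close>)
    have int: "integrable lebesgue (\<lambda>x. indicator K x *\<^sub>R u x)"
      using that(3) by (simp add: set_integrable_def)
    show ?thesis
      unfolding set_integrable_def
      by (rule integrable_cong_AE_imp[OF int borel_measurable_AE[OF borel_measurable_integrable[OF int] AE] AE])
  qed
  show ?thesis
    unfolding locally_integrable_def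
    using imp[OF AE] imp[of v u] AE by (auto simp: eq_commute)
qed


section \<open>The space of square integrable functions\<close>

lemma L2_norm_sq: "(L2_norm M f)\<^sup>2 = (\<integral>x. (norm (f x))\<^sup>2 \<partial>M)"
  by (simp add: L2_norm_def)

lemma L2_norm_nonneg: "0 \<le> L2_norm M f"
  by (simp add: L2_norm_def)

lemma L2_norm_scaleR: "L2_norm M (\<lambda>x. s *\<^sub>R f x) = \<bar>s\<bar> * L2_norm M f"
  by (simp add: L2_norm_def power_mult_distrib real_sqrt_mult)

lemma L2_lincomb:
  assumes f: "L2 M f" and g: "L2 M g"
  shows "L2 M (\<lambda>x. s *\<^sub>R f x + t *\<^sub>R g x)"
  unfolding L2_def
proof
  have m: "f \<in> borel_measurable M" "g \<in> borel_measurable M" using f g by (auto simp: L2_def)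
  then show m': "(\<lambda>x. s *\<^sub>R f x + t *\<^sub>R g x) \<in> borel_measurable M" by simp
  show "integrable M (\<lambda>x. (norm (s *\<^sub>R f x + t *\<^sub>R g x))\<^sup>2)"
  proof (rule Bochner_Integration.integrable_bound)
    show "integrable M (\<lambda>x. 2 * s\<^sup>2 * (norm (f x))\<^sup>2 + 2 * t\<^sup>2 * (norm (g x))\<^sup>2)"
      using f g by (simp add: L2_def)
    show "(\<lambda>x. (norm (s *\<^sub>R f x + t *\<^sub>R g x))\<^sup>2) \<in> borel_measurable M" using m' by simp
    show "AE x in M. norm ((norm (s *\<^sub>R f x + t *\<^sub>R g x))\<^sup>2) \<le> norm (2 * s\<^sup>2 * (norm (f x))\<^sup>2 + 2 * t\<^sup>2 * (norm (g x))\<^sup>2)"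
    proof (rule AE_I2)
      fix x
      have "(norm (s *\<^sub>R f x + t *\<^sub>R g x))\<^sup>2 \<le> (\<bar>s\<bar> * norm (f x) + \<bar>t\<bar> * norm (g x))\<^sup>2"
        using norm_triangle_ineq[of "s *\<^sub>R f x" "t *\<^sub>R g x"] by (intro power_mono) auto
      also have "\<dots> \<le> 2 * (\<bar>s\<bar> * norm (f x))\<^sup>2 + 2 * (\<bar>t\<bar> * norm (g x))\<^sup>2"
        using sum_squares_bound[of "\<bar>s\<bar> * norm (f x)" "\<bar>t\<bar> * norm (g x)"] by (simp add: power2_sum)
      finally show "norm ((norm (s *\<^sub>R f x + t *\<^sub>R g x))\<^sup>2) \<le> norm (2 * s\<^sup>2 * (norm (f x))\<^sup>2 + 2 * t\<^sup>2 * (norm (g x))\<^sup>2)"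
        by (simp add: power_mult_distrib)
    qed
  qed
qed

lemma L2_add: "L2 M f \<Longrightarrow> L2 M g \<Longrightarrow> L2 M (\<lambda>x. f x + g x)"
  using L2_lincomb[of M f g 1 1] by simp

lemma L2_diff: "L2 M f \<Longrightarrow> L2 M g \<Longrightarrow> L2 M (\<lambda>x. f x - g x)"
  using L2_lincomb[of M f g 1 "-1"] by simp

lemma norm_parallelogram:
  fixes a b :: "'a::real_inner"
  shows "(norm (a + b))\<^sup>2 + (norm (a - b))\<^sup>2 = 2 * (norm a)\<^sup>2 + 2 * (norm b)\<^sup>2"
  by (simp add: power2_norm_eq_inner inner_add inner_diff inner_commute)

text \<open>
  Integrating the pointwise parallelogram identity needs square integrability of all four functions,
  because a divergent integral counts as zero.
\<close>

lemma L2_norm_parallelogram: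
  assumes f: "L2 M f" and g: "L2 M g"
  shows "(L2_norm M (\<lambda>x. f x + g x))\<^sup>2 + (L2_norm M (\<lambda>x. f x - g x))\<^sup>2 =
    2 * (L2_norm M f)\<^sup>2 + 2 * (L2_norm M g)\<^sup>2"
proof -
  have "(L2_norm M (\<lambda>x. f x + g x))\<^sup>2 + (L2_norm M (\<lambda>x. f x - g x))\<^sup>2 =
      (\<integral>x. (norm (f x + g x))\<^sup>2 + (norm (f x - g x))\<^sup>2 \<partial>M)"
    using L2_add[OF f g] L2_diff[OF f g] by (simp add: L2_norm_sq L2_def)
  also have "\<dots> = (\<integral>x. 2 * (norm (f x))\<^sup>2 + 2 * (norm (g x))\<^sup>2 \<partial>M)"
    by (simp add: norm_parallelogram)
  also have "\<dots> = 2 * (L2_norm M f)\<^sup>2 + 2 * (L2_norm M g)\<^sup>2"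
    using f g by (simp add: L2_norm_sq L2_def)
  finally show ?thesis .
qed

lemma L2_norm_add_sq_le:
  assumes "L2 M f" "L2 M g"
  shows "(L2_norm M (\<lambda>x. f x + g x))\<^sup>2 \<le> 2 * (L2_norm M f)\<^sup>2 + 2 * (L2_norm M g)\<^sup>2"
  using L2_norm_parallelogram[OF assms] zero_le_power2[of "L2_norm M (\<lambda>x. f x - g x)"] by linarith

text \<open>
  A crude form of the Cauchy-Schwarz inequality, which suffices for passing to limits: integrate \<open>a
  b \<le> d a\<^sup>2 + b\<^sup>2 / d\<close> and take \<open>d\<close> to be the norm of the second factor, or let \<open>d\<close> tend to zero if
  that norm vanishes.
\<close>

lemma integral_norm_mult_le_L2_norm:
  assumes f: "L2 M f" and g: "L2 M g"
  shows "integrable M (\<lambda>x. norm (f x) * norm (g x))"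
    and "(\<integral>x. norm (f x) * norm (g x) \<partial>M) \<le> ((L2_norm M f)\<^sup>2 + 1) * L2_norm M g"
proof -
  have bound: "norm (f x) * norm (g x) \<le> d * (norm (f x))\<^sup>2 + (norm (g x))\<^sup>2 / d" if "d > 0" for d x
  proof -
    have "2 * (sqrt d * norm (f x)) * (norm (g x) / sqrt d) \<le> (sqrt d * norm (f x))\<^sup>2 + (norm (g x) / sqrt d)\<^sup>2"
      by (rule sum_squares_bound)
    moreover have "2 * (sqrt d * norm (f x)) * (norm (g x) / sqrt d) = 2 * (norm (f x) * norm (g x))"
      using that by simp
    moreover have "0 \<le> norm (f x) * norm (g x)" by simp
    moreover have "(sqrt d * norm (f x))\<^sup>2 + (norm (g x) / sqrt d)\<^sup>2 = d * (norm (f x))\<^sup>2 + (norm (g x))\<^sup>2 / d"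
      using that by (simp add: power_mult_distrib power_divide)
    ultimately show ?thesis by linarith
  qed
  show int: "integrable M (\<lambda>x. norm (f x) * norm (g x))"
  proof (rule Bochner_Integration.integrable_bound)
    show "integrable M (\<lambda>x. 1 * (norm (f x))\<^sup>2 + (norm (g x))\<^sup>2 / 1)"
      using f g by (simp add: L2_def)
    show "(\<lambda>x. norm (f x) * norm (g x)) \<in> borel_measurable M"
      using f g by (auto simp: L2_def)
    show "AE x in M. norm (norm (f x) * norm (g x)) \<le> norm (1 * (norm (f x))\<^sup>2 + (norm (g x))\<^sup>2 / 1)"
      using bound[of 1] by (intro AE_I2) simp
  qed
  have le: "(\<integral>x. norm (f x) * norm (g x) \<partial>M) \<le> d * (L2_norm M f)\<^sup>2 + (L2_norm M g)\<^sup>2 / d" if "d > 0" for d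
  proof -
    have "(\<integral>x. norm (f x) * norm (g x) \<partial>M) \<le> (\<integral>x. d * (norm (f x))\<^sup>2 + (norm (g x))\<^sup>2 / d \<partial>M)"
      using f g by (intro integral_mono int bound that) (simp add: L2_def)
    also have "\<dots> = d * (L2_norm M f)\<^sup>2 + (L2_norm M g)\<^sup>2 / d"
      using f g by (simp add: L2_norm_sq L2_def)
    finally show ?thesis .
  qed
  show "(\<integral>x. norm (f x) * norm (g x) \<partial>M) \<le> ((L2_norm M f)\<^sup>2 + 1) * L2_norm M g"
  proof (cases "L2_norm M g = 0")
    case True
    have "((\<lambda>d. d * (L2_norm M f)\<^sup>2) \<longlongrightarrow> 0 * (L2_norm M f)\<^sup>2) (at_right 0)"
      by (intro tendsto_intros)
    moreover have "\<forall>\<^sub>F d in at_right 0. (\<integral>x. norm (f x) * norm (g x) \<partial>M) \<le> d * (L2_norm M f)\<^sup>2"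
      using le True by (auto simp: eventually_at_right_field intro!: exI[of _ 1])
    ultimately have "(\<integral>x. norm (f x) * norm (g x) \<partial>M) \<le> 0"
      using tendsto_lowerbound by fastforce
    with True show ?thesis by simp
  next
    case False
    then have "L2_norm M g > 0" using L2_norm_nonneg[of M g] by simp
    from le[OF this] this show ?thesis
      by (simp add: power2_eq_square algebra_simps)
  qed
qed

text \<open>
  The increments \<open>d\<^sub>k\<close> satisfy \<open>\<bar>d\<^sub>k\<bar> \<le> 2\<^sup>-\<^sup>k + 2\<^sup>k \<bar>d\<^sub>k\<bar>\<^sup>2\<close>, and the squares weighted by \<open>2\<^sup>k\<close> have
  a finite integral of their sum; hence the increments are summable almost everywhere.
\<close>

lemma L2_convergent_subsequence:
  assumes f: "\<And>n. L2 M (f n)" and r: "\<And>k. (L2_norm M (\<lambda>x. f (r (Suc k)) x - f (r k) x))\<^sup>2 \<le> (1/4) ^ k"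
  shows "AE x in M. convergent (\<lambda>k. f (r k) x)"
proof -
  define d where "d k x = f (r (Suc k)) x - f (r k) x" for k x
  have d: "L2 M (d k)" for k unfolding d_def by (intro L2_diff f)
  have dm: "d k \<in> borel_measurable M" for k using d by (simp add: L2_def)
  have "(\<integral>\<^sup>+x. (\<Sum>k. ennreal (2 ^ k * (norm (d k x))\<^sup>2)) \<partial>M) = (\<Sum>k. \<integral>\<^sup>+x. ennreal (2 ^ k * (norm (d k x))\<^sup>2) \<partial>M)"
    using dm by (intro nn_integral_suminf) simp
  also have "\<dots> \<le> (\<Sum>k. ennreal ((1/2) ^ k))"
  proof (intro suminf_le)
    fix k
    have "(\<integral>\<^sup>+x. ennreal (2 ^ k * (norm (d k x))\<^sup>2) \<partial>M) = ennreal (\<integral>x. 2 ^ k * (norm (d k x))\<^sup>2 \<partial>M)"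
      using d[of k] by (intro nn_integral_eq_integral) (auto simp: L2_def)
    also have "(\<integral>x. 2 ^ k * (norm (d k x))\<^sup>2 \<partial>M) = 2 ^ k * (L2_norm M (d k))\<^sup>2"
      by (simp add: L2_norm_sq)
    also have "ennreal \<dots> \<le> ennreal (2 ^ k * (1/4) ^ k)"
      using r[of k] by (intro ennreal_leI mult_left_mono) (auto simp: d_def[abs_def])
    also have "(2 :: real) ^ k * (1/4) ^ k = (1/2) ^ k"
      by (simp flip: power_mult_distrib)
    finally show "(\<integral>\<^sup>+x. ennreal (2 ^ k * (norm (d k x))\<^sup>2) \<partial>M) \<le> ennreal ((1/2) ^ k)" .
  qed auto
  also have "\<dots> = ennreal (\<Sum>k. (1/2) ^ k)"
    by (intro suminf_ennreal2 summable_geometric) auto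
  also have "\<dots> < \<infinity>" by simp
  finally have "AE x in M. (\<Sum>k. ennreal (2 ^ k * (norm (d k x))\<^sup>2)) \<noteq> \<infinity>"
    using dm by (intro nn_integral_PInf_AE) auto
  then show ?thesis
  proof eventually_elim
    case (elim x)
    then have "summable (\<lambda>k. 2 ^ k * (norm (d k x))\<^sup>2)"
      by (intro summable_suminf_not_top) (auto simp: top_ennreal_def)
    then have "summable (\<lambda>k. (1/2) ^ k + 2 ^ k * (norm (d k x))\<^sup>2)"
      by (intro summable_add summable_geometric) auto
    then have "summable (\<lambda>k. norm (d k x))"
    proof (rule summable_comparison_test')
      fix k :: nat assume "0 \<le> k"
      show "norm (norm (d k x)) \<le> (1/2) ^ k + 2 ^ k * (norm (d k x))\<^sup>2"
      proof (cases "norm (d k x) \<le> (1/2) ^ k")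
        case True
        then show ?thesis by (simp add: add_increasing2)
      next
        case False
        then have "1 \<le> 2 ^ k * norm (d k x)" by (simp add: power_one_over field_simps)
        then have "norm (d k x) * 1 \<le> norm (d k x) * (2 ^ k * norm (d k x))"
          by (intro mult_left_mono) auto
        then show ?thesis by (simp add: power2_eq_square algebra_simps add_increasing)
      qed
    qed
    then have "summable (\<lambda>k. f (r (Suc k)) x - f (r k) x)"
      unfolding d_def by (rule summable_norm_cancel)
    then show "convergent (\<lambda>k. f (r k) x)" 
      by (simp add: summable_iff_convergent sum_lessThan_telescope[of "\<lambda>k. f (r k) x"] convergent_diff_const_right_iff)
  qed
qed

text \<open>
  The Riesz-Fischer theorem: a rapidly Cauchy subsequence converges almost everywhere, and Fatou's
  lemma bounds the distance to its limit.
\<close>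

theorem L2_complete:
  assumes f: "\<And>n. L2 M (f n)"
    and cauchy: "\<And>e. e > 0 \<Longrightarrow> \<exists>N. \<forall>m\<ge>N. \<forall>n\<ge>N. (L2_norm M (\<lambda>x. f m x - f n x))\<^sup>2 < e"
  shows "\<exists>g. L2 M g \<and> (\<lambda>n. (L2_norm M (\<lambda>x. f n x - g x))\<^sup>2) \<longlonglongrightarrow> 0"
proof -
  have "\<exists>N. \<forall>m\<ge>N. \<forall>n\<ge>N. (L2_norm M (\<lambda>x. f m x - f n x))\<^sup>2 < (1/4) ^ k" for k
    by (rule cauchy) simp
  then obtain N where N: "\<And>k m n. N k \<le> m \<Longrightarrow> N k \<le> n \<Longrightarrow> (L2_norm M (\<lambda>x. f m x - f n x))\<^sup>2 < (1/4) ^ k"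
    by metis
  \<comment> \<open>The partial sums of \<open>N\<close> dominate \<open>N\<close>, and they make the subsequence monotone.\<close>
  define r where "r k = (\<Sum>i\<le>k. N i) + k" for k
  have rN: "N k \<le> r k" for k
    unfolding r_def using member_le_sum[of k "{..k}" N] by simp
  have rk: "k \<le> r k" for k by (simp add: r_def)
  have rSuc: "r k \<le> r (Suc k)" for k by (simp add: r_def)
  have conv: "AE x in M. convergent (\<lambda>k. f (r k) x)"
    by (intro L2_convergent_subsequence f less_imp_le[OF N] rN order_trans[OF rN rSuc])
  define g where "g x = lim (\<lambda>k. f (r k) x)" for x
  have fm: "f n \<in> borel_measurable M" for n using f by (simp add: L2_def)
  have gm: "g \<in> borel_measurable M"
    unfolding g_def by (intro borel_measurable_lim_metric fm)
  have fatou: "(\<integral>\<^sup>+x. ennreal ((norm (f n x - g x))\<^sup>2) \<partial>M) \<le> ennreal e"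
    if n: "\<And>m. m \<ge> K \<Longrightarrow> (L2_norm M (\<lambda>x. f n x - f m x))\<^sup>2 \<le> e" for n K e
  proof -
    \<comment> \<open>Fatou's lemma is applied along the subsequence, where the pointwise limit exists.\<close>
    have "(\<integral>\<^sup>+x. ennreal ((norm (f n x - g x))\<^sup>2) \<partial>M) =
        (\<integral>\<^sup>+x. liminf (\<lambda>k. ennreal ((norm (f n x - f (r k) x))\<^sup>2)) \<partial>M)"
    proof (rule nn_integral_cong_AE)
      show "AE x in M. ennreal ((norm (f n x - g x))\<^sup>2) = liminf (\<lambda>k. ennreal ((norm (f n x - f (r k) x))\<^sup>2))"
        using conv
      proof eventually_elim
        case (elim x)
        then have "(\<lambda>k. f (r k) x) \<longlonglongrightarrow> g x" by (simp add: g_def convergent_LIMSEQ_iff)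
        then have "(\<lambda>k. ennreal ((norm (f n x - f (r k) x))\<^sup>2)) \<longlonglongrightarrow> ennreal ((norm (f n x - g x))\<^sup>2)"
          by (intro tendsto_intros)
        then show ?case by (intro lim_imp_Liminf[symmetric]) auto
      qed
    qed
    also have "\<dots> \<le> liminf (\<lambda>k. \<integral>\<^sup>+x. ennreal ((norm (f n x - f (r k) x))\<^sup>2) \<partial>M)"
      using fm by (intro nn_integral_liminf) simp
    also have "\<dots> \<le> liminf (\<lambda>k::nat. ennreal e)"
    proof (intro Liminf_mono eventually_sequentiallyI[of K])
      fix k assume k: "K \<le> k"
      have "(\<integral>\<^sup>+x. ennreal ((norm (f n x - f (r k) x))\<^sup>2) \<partial>M) = ennreal ((L2_norm M (\<lambda>x. f n x - f (r k) x))\<^sup>2)"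
        using L2_diff[OF f f, of n "r k"] unfolding L2_norm_sq
        by (intro nn_integral_eq_integral) (auto simp: L2_def)
      also have "\<dots> \<le> ennreal e" using n[of "r k"] k rk[of k] by (intro ennreal_leI) simp
      finally show "(\<integral>\<^sup>+x. ennreal ((norm (f n x - f (r k) x))\<^sup>2) \<partial>M) \<le> ennreal e" .
    qed
    also have "\<dots> = ennreal e" by (simp add: Liminf_const)
    finally show ?thesis .
  qed
  have close: "L2 M (\<lambda>x. f n x - g x) \<and> (L2_norm M (\<lambda>x. f n x - g x))\<^sup>2 \<le> e"
    if n: "\<And>m. m \<ge> K \<Longrightarrow> (L2_norm M (\<lambda>x. f n x - f m x))\<^sup>2 \<le> e" and e: "e \<ge> 0" for n K e
  proof
    have le: "(\<integral>\<^sup>+x. ennreal ((norm (f n x - g x))\<^sup>2) \<partial>M) \<le> ennreal e" by (rule fatou[OF n])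
    also have "\<dots> < \<infinity>" by simp
    finally have int: "integrable M (\<lambda>x. (norm (f n x - g x))\<^sup>2)"
      using fm gm by (intro integrableI_nonneg) auto
    then show "L2 M (\<lambda>x. f n x - g x)" using fm gm by (simp add: L2_def)
    have "ennreal ((L2_norm M (\<lambda>x. f n x - g x))\<^sup>2) \<le> ennreal e"
      using le nn_integral_eq_integral[OF int] by (simp add: L2_norm_sq)
    then show "(L2_norm M (\<lambda>x. f n x - g x))\<^sup>2 \<le> e" using e by (simp add: ennreal_le_iff)
  qed
  show ?thesis
  proof (intro exI[of _ g] conjI)
    obtain K where K: "\<forall>m\<ge>K. \<forall>n\<ge>K. (L2_norm M (\<lambda>x. f m x - f n x))\<^sup>2 < 1" using cauchy[of 1] by auto
    have "L2 M (\<lambda>x. f K x - g x)" using close[of K K 1] K by (simp add: less_imp_le)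
    from L2_diff[OF f[of K] this] show "L2 M g" by simp
    show "(\<lambda>n. (L2_norm M (\<lambda>x. f n x - g x))\<^sup>2) \<longlonglongrightarrow> 0"
    proof (rule LIMSEQ_I)
      fix e :: real assume e: "e > 0"
      then obtain K where K: "\<forall>m\<ge>K. \<forall>n\<ge>K. (L2_norm M (\<lambda>x. f m x - f n x))\<^sup>2 < e / 2"
        using cauchy[of "e / 2"] by auto
      have "(L2_norm M (\<lambda>x. f n x - g x))\<^sup>2 \<le> e / 2" if "n \<ge> K" for n
        using close[of K n "e / 2"] K e that by (simp add: less_imp_le)
      with e show "\<exists>K. \<forall>n\<ge>K. norm ((L2_norm M (\<lambda>x. f n x - g x))\<^sup>2 - 0) < e"
        by (intro exI[of _ K]) force
    qed
  qed
qed


section \<open>Weak derivatives in the square integrable setting\<close>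

lemma set_integral_eq_integral_lebesgue_on:
  fixes f :: "real^'n::finite \<Rightarrow> 'b::{banach,second_countable_topology}"
  shows "\<Omega> \<in> sets lebesgue \<Longrightarrow> (LINT x:\<Omega>|lebesgue. f x) = integral\<^sup>L (lebesgue_on \<Omega>) f"
  by (simp add: integral_restrict_space set_lebesgue_integral_def)

lemma set_integrable_iff_integrable_lebesgue_on:
  fixes f :: "real^'n::finite \<Rightarrow> 'b::{banach,second_countable_topology}"
  shows "\<Omega> \<in> sets lebesgue \<Longrightarrow> set_integrable lebesgue \<Omega> f \<longleftrightarrow> integrable (lebesgue_on \<Omega>) f"
  by (simp add: integrable_restrict_space set_integrable_def)

text \<open>
  Lebesgue measure is complete, so a function that is only almost everywhere equal to a measurable
  one is itself measurable. This is what makes an arbitrarily chosen weak derivative measurable.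
\<close>

lemma borel_measurable_lebesgue_on_cong_AE:
  fixes u v :: "real^'n::finite \<Rightarrow> complex"
  assumes \<Omega>: "\<Omega> \<in> sets lebesgue" and u: "u \<in> borel_measurable (lebesgue_on \<Omega>)"
    and eq: "AE x in lebesgue_on \<Omega>. u x = v x"
  shows "v \<in> borel_measurable (lebesgue_on \<Omega>)"
proof -
  have "AE x in lebesgue. x \<in> \<Omega> \<longrightarrow> u x = v x"
    using eq \<Omega> by (simp add: AE_restrict_space_iff)
  then have "AE x in lebesgue. indicator \<Omega> x *\<^sub>R u x = indicator \<Omega> x *\<^sub>R v x"
    by eventually_elim (auto simp: indicator_def)
  moreover have "(\<lambda>x. indicator \<Omega> x *\<^sub>R u x) \<in> borel_measurable lebesgue"
    using u \<Omega> by (simp add: borel_measurable_restrict_space_iff)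
  ultimately have "(\<lambda>x. indicator \<Omega> x *\<^sub>R v x) \<in> borel_measurable lebesgue"
    by (rule borel_measurable_AE[rotated])
  then show ?thesis using \<Omega> by (simp add: borel_measurable_restrict_space_iff)
qed

lemma L2_cong_AE:
  fixes u v :: "real^'n::finite \<Rightarrow> complex"
  assumes \<Omega>: "\<Omega> \<in> sets lebesgue" and u: "L2 (lebesgue_on \<Omega>) u"
    and eq: "AE x in lebesgue_on \<Omega>. u x = v x"
  shows "L2 (lebesgue_on \<Omega>) v"
proof -
  have v: "v \<in> borel_measurable (lebesgue_on \<Omega>)"
    using borel_measurable_lebesgue_on_cong_AE[OF \<Omega> _ eq] u by (simp add: L2_def)
  have "AE x in lebesgue_on \<Omega>. (norm (u x))\<^sup>2 = (norm (v x))\<^sup>2"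
    using eq by eventually_elim simp
  moreover have "integrable (lebesgue_on \<Omega>) (\<lambda>x. (norm (u x))\<^sup>2)" using u by (simp add: L2_def)
  moreover have "(\<lambda>x. (norm (v x))\<^sup>2) \<in> borel_measurable (lebesgue_on \<Omega>)" using v by simp
  ultimately have "integrable (lebesgue_on \<Omega>) (\<lambda>x. (norm (v x))\<^sup>2)"
    by (rule integrable_cong_AE_imp[rotated 2])
  with v show ?thesis by (simp add: L2_def)
qed

lemma L2_norm_cong_AE:
  assumes "L2 M u" "L2 M v" "AE x in M. u x = v x"
  shows "L2_norm M u = L2_norm M v"
proof -
  have "AE x in M. (norm (u x))\<^sup>2 = (norm (v x))\<^sup>2"
    using assms(3) by eventually_elim simp
  moreover have "(\<lambda>x. (norm (u x))\<^sup>2) \<in> borel_measurable M" "(\<lambda>x. (norm (v x))\<^sup>2) \<in> borel_measurable M"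
    using assms(1,2) by (simp_all add: L2_def borel_measurable_integrable)
  ultimately have "(\<integral>x. (norm (u x))\<^sup>2 \<partial>M) = (\<integral>x. (norm (v x))\<^sup>2 \<partial>M)"
    by (intro integral_cong_AE)
  then show ?thesis by (simp add: L2_norm_def)
qed

lemma bounded_continuous_imp_L2:
  fixes w :: "real^'n::finite \<Rightarrow> complex"
  assumes \<Omega>: "\<Omega> \<in> lmeasurable" "bounded \<Omega>" and w: "continuous_on UNIV w"
  shows "L2 (lebesgue_on \<Omega>) w"
proof -
  interpret finite_measure "lebesgue_on \<Omega>" by (rule finite_measure_lebesgue_on[OF \<Omega>(1)])
  have m: "w \<in> borel_measurable (lebesgue_on \<Omega>)"
    using w by (intro measurable_restrict_space1 measurable_completion) (simp add: borel_measurable_continuous_onI)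
  have "compact (w ` closure \<Omega>)"
    using \<Omega> by (intro compact_continuous_image continuous_on_subset[OF w]) (auto simp: compact_closure)
  then obtain B where B: "\<And>x. x \<in> closure \<Omega> \<Longrightarrow> norm (w x) \<le> B"
    using compact_imp_bounded[of "w ` closure \<Omega>"] unfolding bounded_iff by blast
  have "integrable (lebesgue_on \<Omega>) (\<lambda>x. (norm (w x))\<^sup>2)"
  proof (rule integrable_const_bound[of _ "B\<^sup>2"])
    show "AE x in lebesgue_on \<Omega>. norm ((norm (w x))\<^sup>2) \<le> B\<^sup>2"
      using B closure_subset[of \<Omega>] by (intro AE_I2) (auto intro!: power_mono)
  qed (use m in simp)
  with m show ?thesis by (simp add: L2_def)
qed

lemma L2_imp_locally_integrable:
  fixes u :: "real^'n::finite \<Rightarrow> complex"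
  assumes \<Omega>: "\<Omega> \<in> sets lebesgue" and u: "L2 (lebesgue_on \<Omega>) u"
  shows "locally_integrable \<Omega> u"
  unfolding locally_integrable_def
proof (intro allI impI)
  fix K assume K: "compact K \<and> K \<subseteq> \<Omega>"
  then have Ks: "K \<in> sets lebesgue" and Kf: "K \<in> lmeasurable"
    by (auto intro: lmeasurable_compact fmeasurableD)
  have m: "(\<lambda>x. indicator K x :: complex) \<in> borel_measurable (lebesgue_on \<Omega>)"
    using Ks by (intro measurable_restrict_space1) (rule borel_measurable_indicator)
  have "integrable lebesgue (\<lambda>x. indicator \<Omega> x *\<^sub>R (norm (indicator K x :: complex))\<^sup>2)"
  proof -
    have "integrable lebesgue (indicator K :: _ \<Rightarrow> real)"
      using Kf unfolding fmeasurable_def by (intro integrable_real_indicator) (blast, simp only: mem_Collect_eq infinity_ennreal_def)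
    moreover have "(\<lambda>x. indicator \<Omega> x *\<^sub>R (norm (indicator K x :: complex))\<^sup>2) = (indicator K :: _ \<Rightarrow> real)"
      using K by (auto simp: indicator_def fun_eq_iff)
    ultimately show ?thesis by simp
  qed
  then have "L2 (lebesgue_on \<Omega>) (indicator K)"
    using m \<Omega> by (simp add: L2_def integrable_restrict_space)
  from integral_norm_mult_le_L2_norm(1)[OF this u]
  have "integrable (lebesgue_on \<Omega>) (\<lambda>x. norm (indicator K x * u x))"
    by (simp add: norm_mult)
  moreover have "(\<lambda>x. indicator K x * u x) \<in> borel_measurable (lebesgue_on \<Omega>)"
    using m u by (intro borel_measurable_times) (auto simp: L2_def)
  ultimately have "integrable (lebesgue_on \<Omega>) (\<lambda>x. indicator K x * u x)"
    by (simp add: integrable_norm_iff)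
  then have "integrable lebesgue (\<lambda>x. indicator \<Omega> x *\<^sub>R (indicator K x * u x))"
    using \<Omega> by (simp add: integrable_restrict_space)
  also have "(\<lambda>x. indicator \<Omega> x *\<^sub>R (indicator K x * u x)) = (\<lambda>x. indicator K x *\<^sub>R u x)"
    using K by (auto simp: indicator_def fun_eq_iff)
  finally show "set_integrable lebesgue K u" by (simp add: set_integrable_def)
qed

lemma test_function_L2:
  fixes \<phi> :: "real^'n::finite \<Rightarrow> real"
  assumes \<phi>: "test_function \<Omega> \<phi>" and \<Omega>: "\<Omega> \<in> sets lebesgue"
  shows "L2 (lebesgue_on \<Omega>) (\<lambda>x. complex_of_real (\<phi> x))"
proof -
  have c: "continuous_on UNIV (\<lambda>x. complex_of_real (\<phi> x))"
    using \<phi> by (intro continuous_intros smooth_continuous_on) (simp add: test_function_def)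
  have "integrable (lebesgue_on \<Omega>) (\<lambda>x. \<phi> x *\<^sub>R complex_of_real (\<phi> x))"
    using set_integrable_test_function_mult[OF \<phi> continuous_locally_integrable[OF c]] \<Omega>
    by (simp add: set_integrable_iff_integrable_lebesgue_on)
  then have "integrable (lebesgue_on \<Omega>) (\<lambda>x. norm (\<phi> x *\<^sub>R complex_of_real (\<phi> x)))"
    by (rule integrable_norm)
  then have "integrable (lebesgue_on \<Omega>) (\<lambda>x. (norm (complex_of_real (\<phi> x)))\<^sup>2)"
    by (simp add: power2_eq_square)
  moreover have "(\<lambda>x. complex_of_real (\<phi> x)) \<in> borel_measurable (lebesgue_on \<Omega>)"
    using c by (intro measurable_restrict_space1 measurable_completion) (simp add: borel_measurable_continuous_onI)
  ultimately show ?thesis by (simp add: L2_def)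
qed

text \<open>
  Test functions are themselves square integrable, so \<open>integral_norm_mult_le_L2_norm\<close> controls the
  difference of the integrals.
\<close>

lemma test_integral_tendsto:
  fixes u :: "real^'n::finite \<Rightarrow> complex"
  assumes \<phi>: "test_function \<Omega> \<phi>" and \<Omega>: "\<Omega> \<in> sets lebesgue"
    and U: "\<And>j. L2 (lebesgue_on \<Omega>) (U j)" and u: "L2 (lebesgue_on \<Omega>) u"
    and lim: "(\<lambda>j. (L2_norm (lebesgue_on \<Omega>) (\<lambda>x. U j x - u x))\<^sup>2) \<longlonglongrightarrow> 0"
  shows "(\<lambda>j. LINT x:\<Omega>|lebesgue. \<phi> x *\<^sub>R U j x) \<longlonglongrightarrow> (LINT x:\<Omega>|lebesgue. \<phi> x *\<^sub>R u x)"
proof -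
  let ?M = "lebesgue_on \<Omega>"
  let ?C = "(L2_norm ?M (\<lambda>x. complex_of_real (\<phi> x)))\<^sup>2 + 1"
  have int: "integrable ?M (\<lambda>x. \<phi> x *\<^sub>R v x)" if "L2 ?M v" for v
    using set_integrable_test_function_mult[OF \<phi> L2_imp_locally_integrable[OF \<Omega> that]] \<Omega>
    by (simp add: set_integrable_iff_integrable_lebesgue_on)
  have bound: "norm ((LINT x:\<Omega>|lebesgue. \<phi> x *\<^sub>R U j x) - (LINT x:\<Omega>|lebesgue. \<phi> x *\<^sub>R u x))
      \<le> ?C * L2_norm ?M (\<lambda>x. U j x - u x)" for j
  proof -
    have "(LINT x:\<Omega>|lebesgue. \<phi> x *\<^sub>R U j x) - (LINT x:\<Omega>|lebesgue. \<phi> x *\<^sub>R u x) =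
        integral\<^sup>L ?M (\<lambda>x. \<phi> x *\<^sub>R (U j x - u x))"
      using int[OF U[of j]] int[OF u] by (simp add: set_integral_eq_integral_lebesgue_on[OF \<Omega>] scaleR_diff_right)
    also have "norm \<dots> \<le> (\<integral>x. norm (\<phi> x *\<^sub>R (U j x - u x)) \<partial>?M)"
      by (rule integral_norm_bound)
    also have "\<dots> = (\<integral>x. norm (complex_of_real (\<phi> x)) * norm (U j x - u x) \<partial>?M)" by simp
    also have "\<dots> \<le> ?C * L2_norm ?M (\<lambda>x. U j x - u x)"
      by (rule integral_norm_mult_le_L2_norm(2)[OF test_function_L2[OF \<phi> \<Omega>] L2_diff[OF U u]])
    finally show ?thesis .
  qed
  have "(\<lambda>j. ?C * L2_norm ?M (\<lambda>x. U j x - u x)) \<longlonglongrightarrow> 0"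
    using tendsto_mult_right_zero[OF tendsto_real_sqrt[OF lim, simplified], of ?C]
    by (simp add: L2_norm_nonneg)
  from Lim_null_comparison[OF always_eventually[OF allI[OF bound]] this]
  show ?thesis by (rule Lim_null[THEN iffD2])
qed

text \<open>
  Both sides of the defining identity are integrals against fixed test functions, hence continuous
  in the mean.
\<close>

lemma has_weak_deriv_limit:
  fixes u v :: "real^'n::finite \<Rightarrow> complex"
  assumes \<Omega>: "\<Omega> \<in> sets lebesgue"
    and d: "\<And>j. has_weak_deriv \<Omega> \<alpha> (U j) (V j)"
    and U: "\<And>j. L2 (lebesgue_on \<Omega>) (U j)" "L2 (lebesgue_on \<Omega>) u"
      "(\<lambda>j. (L2_norm (lebesgue_on \<Omega>) (\<lambda>x. U j x - u x))\<^sup>2) \<longlonglongrightarrow> 0"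
    and V: "\<And>j. L2 (lebesgue_on \<Omega>) (V j)" "L2 (lebesgue_on \<Omega>) v"
      "(\<lambda>j. (L2_norm (lebesgue_on \<Omega>) (\<lambda>x. V j x - v x))\<^sup>2) \<longlonglongrightarrow> 0"
  shows "has_weak_deriv \<Omega> \<alpha> u v"
  unfolding has_weak_deriv_def
proof (intro conjI allI impI)
  show "locally_integrable \<Omega> u" "locally_integrable \<Omega> v"
    using L2_imp_locally_integrable[OF \<Omega>] U V by auto
  fix \<phi> assume \<phi>: "test_function \<Omega> \<phi>"
  have eq: "(LINT x:\<Omega>|lebesgue. partials \<alpha> \<phi> x *\<^sub>R U j x) = (-1) ^ length \<alpha> * (LINT x:\<Omega>|lebesgue. \<phi> x *\<^sub>R V j x)" for j
    using d[of j] \<phi> by (simp add: has_weak_deriv_def)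
  have 1: "(\<lambda>j. LINT x:\<Omega>|lebesgue. partials \<alpha> \<phi> x *\<^sub>R U j x) \<longlonglongrightarrow> (LINT x:\<Omega>|lebesgue. partials \<alpha> \<phi> x *\<^sub>R u x)"
    by (intro test_integral_tendsto test_function_partials \<phi> \<Omega> U)
  have 2: "(\<lambda>j. (-1) ^ length \<alpha> * (LINT x:\<Omega>|lebesgue. \<phi> x *\<^sub>R V j x)) \<longlonglongrightarrow> (-1) ^ length \<alpha> * (LINT x:\<Omega>|lebesgue. \<phi> x *\<^sub>R v x)"
    by (intro tendsto_mult_left test_integral_tendsto \<phi> \<Omega> V)
  show "(LINT x:\<Omega>|lebesgue. partials \<alpha> \<phi> x *\<^sub>R u x) = (-1) ^ length \<alpha> * (LINT x:\<Omega>|lebesgue. \<phi> x *\<^sub>R v x)"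
    using LIMSEQ_unique[OF 1[unfolded eq] 2] .
qed

lemma has_weak_deriv_cong_AE:
  fixes u v :: "real^'n::finite \<Rightarrow> complex"
  assumes \<Omega>: "open \<Omega>" and d: "has_weak_deriv \<Omega> \<alpha> u v"
    and u: "AE x in lebesgue_on \<Omega>. u x = u' x" and v: "AE x in lebesgue_on \<Omega>. v x = v' x"
  shows "has_weak_deriv \<Omega> \<alpha> u' v'"
proof -
  have li: "locally_integrable \<Omega> u" "locally_integrable \<Omega> v" using d by (auto simp: has_weak_deriv_def)
  then have li': "locally_integrable \<Omega> u'" "locally_integrable \<Omega> v'"
    using locally_integrable_cong_AE[OF \<Omega> u] locally_integrable_cong_AE[OF \<Omega> v] by auto
  have eq: "(LINT x:\<Omega>|lebesgue. \<phi> x *\<^sub>R p x) = (LINT x:\<Omega>|lebesgue. \<phi> x *\<^sub>R q x)"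
    if \<phi>: "test_function \<Omega> \<phi>" and p: "locally_integrable \<Omega> p" and q: "locally_integrable \<Omega> q"
      and pq: "AE x in lebesgue_on \<Omega>. p x = q x" for \<phi> and p q :: "real^'n \<Rightarrow> complex"
  proof -
    have \<Omega>': "\<Omega> \<in> sets lebesgue" using \<Omega> by simp
    have "integrable (lebesgue_on \<Omega>) (\<lambda>x. \<phi> x *\<^sub>R p x)" "integrable (lebesgue_on \<Omega>) (\<lambda>x. \<phi> x *\<^sub>R q x)"
      using set_integrable_test_function_mult[OF \<phi>] p q set_integrable_iff_integrable_lebesgue_on[OF \<Omega>'] by blast+
    moreover have "AE x in lebesgue_on \<Omega>. \<phi> x *\<^sub>R p x = \<phi> x *\<^sub>R q x"
      using pq by eventually_elim simp
    ultimately show ?thesis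
      unfolding set_integral_eq_integral_lebesgue_on[OF \<Omega>']
      by (intro integral_cong_AE borel_measurable_integrable)
  qed
  show ?thesis
    using d li li' eq[OF _ li(2) li'(2) v] eq[OF test_function_partials li(1) li'(1) u]
    unfolding has_weak_deriv_def by metis
qed

text \<open>
  Both sides choose from the same set of weak derivatives, so they are equal everywhere and not
  merely almost everywhere.
\<close>

lemma weak_deriv_cong_AE:
  fixes u u' :: "real^'n::finite \<Rightarrow> complex"
  assumes \<Omega>: "open \<Omega>" and u: "AE x in lebesgue_on \<Omega>. u x = u' x"
  shows "weak_deriv \<Omega> \<alpha> u = weak_deriv \<Omega> \<alpha> u'"
proof -
  have u': "AE x in lebesgue_on \<Omega>. u' x = u x" using u by eventually_elim simp
  have "has_weak_deriv \<Omega> \<alpha> u = has_weak_deriv \<Omega> \<alpha> u'"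
    using has_weak_deriv_cong_AE[OF \<Omega> _ u] has_weak_deriv_cong_AE[OF \<Omega> _ u'] by blast
  then show ?thesis by (simp add: weak_deriv_def)
qed

lemma has_weak_deriv_weak_deriv: "has_weak_deriv \<Omega> \<alpha> u v \<Longrightarrow> has_weak_deriv \<Omega> \<alpha> u (weak_deriv \<Omega> \<alpha> u)"
  unfolding weak_deriv_def by (rule someI[where P = "has_weak_deriv \<Omega> \<alpha> u"])

lemma weak_deriv_AE_eq:
  assumes "open \<Omega>" "has_weak_deriv \<Omega> \<alpha> u v"
  shows "AE x in lebesgue_on \<Omega>. weak_deriv \<Omega> \<alpha> u x = v x"
  using weak_deriv_unique[OF assms(1) has_weak_deriv_weak_deriv[OF assms(2)] assms(2)] .

lemma has_weak_deriv_Nil: "locally_integrable \<Omega> u \<Longrightarrow> has_weak_deriv \<Omega> [] u u"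
  by (simp add: has_weak_deriv_def)

text \<open>
  The operator of the functional uses all pairs of indices but the Sobolev norm only the sorted
  ones.
\<close>

lemma weak_deriv_swap: "weak_deriv \<Omega> [i, j] u = weak_deriv \<Omega> [j, i] u"
proof -
  have "partials [i, j] \<phi> = partials [j, i] \<phi>" if "test_function \<Omega> \<phi>" for \<phi>
    using that smooth_partial_commute[of \<phi> i j] by (simp add: test_function_def)
  then have "has_weak_deriv \<Omega> [i, j] u = has_weak_deriv \<Omega> [j, i] u"
    unfolding has_weak_deriv_def by (auto simp: fun_eq_iff simp del: partials.simps)
  then show ?thesis by (simp add: weak_deriv_def)
qed

lemma partials_partial_commute:
  fixes f :: "real^'n::finite \<Rightarrow> real"
  shows "smooth f \<Longrightarrow> partials \<beta> (partial i f) = partial i (partials \<beta> f)"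
  by (induction \<beta>) (simp_all add: smooth_partial_commute smooth_partials)

text \<open>
  Testing the first derivative with \<open>\<partial>\<^sup>\<beta> \<phi>\<close>, which is again a test function, and exchanging the
  order of differentiation of \<open>\<phi>\<close>.
\<close>

lemma has_weak_deriv_iterate:
  assumes u: "has_weak_deriv \<Omega> [i] u v" and w: "has_weak_deriv \<Omega> (\<beta> @ [i]) u w"
  shows "has_weak_deriv \<Omega> \<beta> v w"
  unfolding has_weak_deriv_def
proof (intro conjI allI impI)
  show "locally_integrable \<Omega> v" "locally_integrable \<Omega> w"
    using u w by (auto simp: has_weak_deriv_def)
  fix \<phi> assume \<phi>: "test_function \<Omega> \<phi>"
  then have s: "smooth \<phi>" by (simp add: test_function_def)
  have "(LINT x:\<Omega>|lebesgue. partial i (partials \<beta> \<phi>) x *\<^sub>R u x) = - (LINT x:\<Omega>|lebesgue. partials \<beta> \<phi> x *\<^sub>R v x)"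
    using u test_function_partials[OF \<phi>, of \<beta>] by (simp add: has_weak_deriv_def)
  moreover have "(LINT x:\<Omega>|lebesgue. partials (\<beta> @ [i]) \<phi> x *\<^sub>R u x) = (-1) ^ length (\<beta> @ [i]) * (LINT x:\<Omega>|lebesgue. \<phi> x *\<^sub>R w x)"
    using w \<phi> by (simp add: has_weak_deriv_def)
  ultimately show "(LINT x:\<Omega>|lebesgue. partials \<beta> \<phi> x *\<^sub>R v x) = (-1) ^ length \<beta> * (LINT x:\<Omega>|lebesgue. \<phi> x *\<^sub>R w x)"
    using partials_partial_commute[OF s, of \<beta> i] by (simp add: partials_append)
qed


section \<open>Sobolev spaces as Hilbert spaces\<close>

lemma finite_multi_indices: "finite (multi_indices k :: 'n::{finite,linorder} list set)"
  unfolding multi_indices_def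
  using finite_lists_length_le[of "UNIV :: 'n set" k] by (rule finite_subset[rotated]) auto

lemma Nil_in_multi_indices: "[] \<in> multi_indices k"
  by (simp add: multi_indices_def)

lemma Hk_norm_sq:
  "(Hk_norm k \<Omega> u)\<^sup>2 = (\<Sum>\<alpha>\<in>multi_indices k. (L2_norm (lebesgue_on \<Omega>) (weak_deriv \<Omega> \<alpha> u))\<^sup>2)"
  by (simp add: Hk_norm_def sum_nonneg)

lemma Hk_norm_nonneg: "0 \<le> Hk_norm k \<Omega> u"
  by (simp add: Hk_norm_def sum_nonneg)

lemma L2_norm_weak_deriv_le_Hk_norm:
  "\<alpha> \<in> multi_indices k \<Longrightarrow> (L2_norm (lebesgue_on \<Omega>) (weak_deriv \<Omega> \<alpha> u))\<^sup>2 \<le> (Hk_norm k \<Omega> u)\<^sup>2"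
  unfolding Hk_norm_sq by (rule member_le_sum) (auto simp: finite_multi_indices)

lemma Hk_L2: "Hk k \<Omega> u \<Longrightarrow> L2 (lebesgue_on \<Omega>) u"
  by (simp add: Hk_def)

lemma Hk_weak_deriv:
  assumes \<Omega>: "open \<Omega>" and u: "Hk k \<Omega> u" and \<alpha>: "\<alpha> \<in> multi_indices k"
  shows "has_weak_deriv \<Omega> \<alpha> u (weak_deriv \<Omega> \<alpha> u)"
    and "L2 (lebesgue_on \<Omega>) (weak_deriv \<Omega> \<alpha> u)"
proof -
  obtain v where v: "L2 (lebesgue_on \<Omega>) v" "has_weak_deriv \<Omega> \<alpha> u v"
    using u \<alpha> by (auto simp: Hk_def)
  show "has_weak_deriv \<Omega> \<alpha> u (weak_deriv \<Omega> \<alpha> u)"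
    by (rule has_weak_deriv_weak_deriv[OF v(2)])
  have "AE x in lebesgue_on \<Omega>. v x = weak_deriv \<Omega> \<alpha> u x"
    using weak_deriv_AE_eq[OF \<Omega> v(2)] by eventually_elim simp
  then show "L2 (lebesgue_on \<Omega>) (weak_deriv \<Omega> \<alpha> u)"
    using \<Omega> by (intro L2_cong_AE[OF _ v(1)]) simp_all
qed

lemma weak_deriv_Nil_AE:
  assumes "open \<Omega>" "L2 (lebesgue_on \<Omega>) u"
  shows "AE x in lebesgue_on \<Omega>. weak_deriv \<Omega> [] u x = u x"
  using assms by (intro weak_deriv_AE_eq has_weak_deriv_Nil L2_imp_locally_integrable) simp_all

lemma Hk_cong_AE:
  assumes \<Omega>: "open \<Omega>" and u: "Hk k \<Omega> u" and eq: "AE x in lebesgue_on \<Omega>. u x = v x"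
  shows "Hk k \<Omega> v"
  unfolding Hk_def
proof (intro conjI ballI)
  show "L2 (lebesgue_on \<Omega>) v" using \<Omega> by (intro L2_cong_AE[OF _ Hk_L2[OF u] eq]) simp
  fix \<alpha> :: "'a list" assume \<alpha>: "\<alpha> \<in> multi_indices k"
  show "\<exists>w. L2 (lebesgue_on \<Omega>) w \<and> has_weak_deriv \<Omega> \<alpha> v w"
    using Hk_weak_deriv[OF \<Omega> u \<alpha>] has_weak_deriv_cong_AE[OF \<Omega> _ eq] by blast
qed

lemma Hk_norm_cong_AE:
  assumes "open \<Omega>" "AE x in lebesgue_on \<Omega>. u x = v x"
  shows "Hk_norm k \<Omega> u = Hk_norm k \<Omega> v"
  using weak_deriv_cong_AE[OF assms] by (simp add: Hk_norm_def)

lemma Hk_lincomb: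
  assumes \<Omega>: "open \<Omega>" and u: "Hk k \<Omega> u" and v: "Hk k \<Omega> v"
  shows "Hk k \<Omega> (\<lambda>x. s *\<^sub>R u x + t *\<^sub>R v x)"
  unfolding Hk_def
proof (intro conjI ballI exI)
  show "L2 (lebesgue_on \<Omega>) (\<lambda>x. s *\<^sub>R u x + t *\<^sub>R v x)"
    by (rule L2_lincomb[OF Hk_L2[OF u] Hk_L2[OF v]])
  fix \<alpha> :: "'a list" assume \<alpha>: "\<alpha> \<in> multi_indices k"
  show "L2 (lebesgue_on \<Omega>) (\<lambda>x. s *\<^sub>R weak_deriv \<Omega> \<alpha> u x + t *\<^sub>R weak_deriv \<Omega> \<alpha> v x)"
    by (rule L2_lincomb[OF Hk_weak_deriv(2)[OF \<Omega> u \<alpha>] Hk_weak_deriv(2)[OF \<Omega> v \<alpha>]])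
  show "has_weak_deriv \<Omega> \<alpha> (\<lambda>x. s *\<^sub>R u x + t *\<^sub>R v x)
      (\<lambda>x. s *\<^sub>R weak_deriv \<Omega> \<alpha> u x + t *\<^sub>R weak_deriv \<Omega> \<alpha> v x)"
    by (rule has_weak_deriv_lincomb[OF Hk_weak_deriv(1)[OF \<Omega> u \<alpha>] Hk_weak_deriv(1)[OF \<Omega> v \<alpha>]])
qed

lemma Hk_diff: "open \<Omega> \<Longrightarrow> Hk k \<Omega> u \<Longrightarrow> Hk k \<Omega> v \<Longrightarrow> Hk k \<Omega> (\<lambda>x. u x - v x)"
  using Hk_lincomb[of \<Omega> k u v 1 "-1"] by simp

lemma weak_deriv_lincomb_AE:
  assumes \<Omega>: "open \<Omega>" and u: "Hk k \<Omega> u" and v: "Hk k \<Omega> v" and \<alpha>: "\<alpha> \<in> multi_indices k"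
  shows "AE x in lebesgue_on \<Omega>. weak_deriv \<Omega> \<alpha> (\<lambda>x. s *\<^sub>R u x + t *\<^sub>R v x) x =
    s *\<^sub>R weak_deriv \<Omega> \<alpha> u x + t *\<^sub>R weak_deriv \<Omega> \<alpha> v x"
  by (rule weak_deriv_AE_eq[OF \<Omega> has_weak_deriv_lincomb[OF Hk_weak_deriv(1)[OF \<Omega> u \<alpha>] Hk_weak_deriv(1)[OF \<Omega> v \<alpha>]]])

lemma L2_norm_weak_deriv_lincomb:
  assumes \<Omega>: "open \<Omega>" and u: "Hk k \<Omega> u" and v: "Hk k \<Omega> v" and \<alpha>: "\<alpha> \<in> multi_indices k"
  shows "L2_norm (lebesgue_on \<Omega>) (weak_deriv \<Omega> \<alpha> (\<lambda>x. s *\<^sub>R u x + t *\<^sub>R v x)) =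
    L2_norm (lebesgue_on \<Omega>) (\<lambda>x. s *\<^sub>R weak_deriv \<Omega> \<alpha> u x + t *\<^sub>R weak_deriv \<Omega> \<alpha> v x)"
  by (intro L2_norm_cong_AE L2_lincomb weak_deriv_lincomb_AE[OF assms]
      Hk_weak_deriv(2)[OF \<Omega> _ \<alpha>] Hk_lincomb \<Omega> u v)

text \<open>
  Almost everywhere linearity of the weak derivatives reduces this to square integrable functions.
\<close>

lemma Hk_norm_parallelogram:
  assumes \<Omega>: "open \<Omega>" and u: "Hk k \<Omega> u" and v: "Hk k \<Omega> v"
  shows "(Hk_norm k \<Omega> (\<lambda>x. u x + v x))\<^sup>2 + (Hk_norm k \<Omega> (\<lambda>x. u x - v x))\<^sup>2 =
    2 * (Hk_norm k \<Omega> u)\<^sup>2 + 2 * (Hk_norm k \<Omega> v)\<^sup>2"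
proof -
  have "(L2_norm (lebesgue_on \<Omega>) (weak_deriv \<Omega> \<alpha> (\<lambda>x. u x + v x)))\<^sup>2 +
      (L2_norm (lebesgue_on \<Omega>) (weak_deriv \<Omega> \<alpha> (\<lambda>x. u x - v x)))\<^sup>2 =
      2 * (L2_norm (lebesgue_on \<Omega>) (weak_deriv \<Omega> \<alpha> u))\<^sup>2 + 2 * (L2_norm (lebesgue_on \<Omega>) (weak_deriv \<Omega> \<alpha> v))\<^sup>2"
    if \<alpha>: "\<alpha> \<in> multi_indices k" for \<alpha>
    using L2_norm_weak_deriv_lincomb[OF \<Omega> u v \<alpha>, of 1 1] L2_norm_weak_deriv_lincomb[OF \<Omega> u v \<alpha>, of 1 "-1"]
      L2_norm_parallelogram[OF Hk_weak_deriv(2)[OF \<Omega> u \<alpha>] Hk_weak_deriv(2)[OF \<Omega> v \<alpha>]] by simp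
  then show ?thesis
    by (simp add: Hk_norm_sq sum_distrib_left flip: sum.distrib)
qed

lemma Hk_norm_add_sq_le:
  assumes "open \<Omega>" "Hk k \<Omega> u" "Hk k \<Omega> v"
  shows "(Hk_norm k \<Omega> (\<lambda>x. u x + v x))\<^sup>2 \<le> 2 * (Hk_norm k \<Omega> u)\<^sup>2 + 2 * (Hk_norm k \<Omega> v)\<^sup>2"
  using Hk_norm_parallelogram[OF assms] zero_le_power2[of "Hk_norm k \<Omega> (\<lambda>x. u x - v x)"] by linarith

lemma Hk_norm_scaleR_sq:
  assumes \<Omega>: "open \<Omega>" and u: "Hk k \<Omega> u"
  shows "(Hk_norm k \<Omega> (\<lambda>x. s *\<^sub>R u x))\<^sup>2 = s\<^sup>2 * (Hk_norm k \<Omega> u)\<^sup>2"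
  unfolding Hk_norm_sq sum_distrib_left
  using L2_norm_weak_deriv_lincomb[OF \<Omega> u u, of _ s 0]
  by (intro sum.cong refl) (simp add: L2_norm_scaleR power_mult_distrib)

text \<open>
  Every derivative of a Cauchy sequence converges in the mean. The limit belonging to the empty
  multi-index is the limit function, and by \<open>has_weak_deriv_limit\<close> the other limits are its
  derivatives.
\<close>

theorem Hk_complete:
  fixes U :: "nat \<Rightarrow> real^'n::{finite,linorder} \<Rightarrow> complex"
  assumes \<Omega>: "open \<Omega>" and U: "\<And>j. Hk k \<Omega> (U j)"
    and cauchy: "\<And>e. e > 0 \<Longrightarrow> \<exists>N. \<forall>i\<ge>N. \<forall>j\<ge>N. (Hk_norm k \<Omega> (\<lambda>x. U i x - U j x))\<^sup>2 < e"
  shows "\<exists>u. Hk k \<Omega> u \<and> (\<lambda>j. (Hk_norm k \<Omega> (\<lambda>x. U j x - u x))\<^sup>2) \<longlonglongrightarrow> 0"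
proof -
  let ?M = "lebesgue_on \<Omega>" and ?D = "weak_deriv \<Omega>"
  have \<Omega>': "\<Omega> \<in> sets lebesgue" using \<Omega> by simp
  have "\<exists>g. L2 ?M g \<and> (\<lambda>j. (L2_norm ?M (\<lambda>x. ?D \<alpha> (U j) x - g x))\<^sup>2) \<longlonglongrightarrow> 0" if \<alpha>: "\<alpha> \<in> multi_indices k" for \<alpha>
  proof (rule L2_complete)
    show "L2 ?M (?D \<alpha> (U j))" for j by (rule Hk_weak_deriv(2)[OF \<Omega> U \<alpha>])
    fix e :: real assume "e > 0"
    then obtain N where N: "\<forall>i\<ge>N. \<forall>j\<ge>N. (Hk_norm k \<Omega> (\<lambda>x. U i x - U j x))\<^sup>2 < e"
      using cauchy by blast
    have "(L2_norm ?M (\<lambda>x. ?D \<alpha> (U i) x - ?D \<alpha> (U j) x))\<^sup>2 \<le> (Hk_norm k \<Omega> (\<lambda>x. U i x - U j x))\<^sup>2" for i j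
      using L2_norm_weak_deriv_lincomb[OF \<Omega> U[of i] U[of j] \<alpha>, of 1 "-1"]
        L2_norm_weak_deriv_le_Hk_norm[OF \<alpha>, of \<Omega> "\<lambda>x. U i x - U j x"] by simp
    with N show "\<exists>N. \<forall>i\<ge>N. \<forall>j\<ge>N. (L2_norm ?M (\<lambda>x. ?D \<alpha> (U i) x - ?D \<alpha> (U j) x))\<^sup>2 < e"
      by (meson le_less_trans)
  qed
  then have "\<forall>\<alpha>\<in>multi_indices k. \<exists>g. L2 ?M g \<and> (\<lambda>j. (L2_norm ?M (\<lambda>x. ?D \<alpha> (U j) x - g x))\<^sup>2) \<longlonglongrightarrow> 0"
    by (rule ballI)
  from bchoice[OF this] obtain g where g0: "\<forall>\<alpha>\<in>multi_indices k. L2 ?M (g \<alpha>) \<and>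
      (\<lambda>j. (L2_norm ?M (\<lambda>x. ?D \<alpha> (U j) x - g \<alpha> x))\<^sup>2) \<longlonglongrightarrow> 0" ..
  have g: "\<And>\<alpha>. \<alpha> \<in> multi_indices k \<Longrightarrow> L2 ?M (g \<alpha>)"
    "\<And>\<alpha>. \<alpha> \<in> multi_indices k \<Longrightarrow> (\<lambda>j. (L2_norm ?M (\<lambda>x. ?D \<alpha> (U j) x - g \<alpha> x))\<^sup>2) \<longlonglongrightarrow> 0"
    using g0 by simp_all
  define u where "u = g []"
  have u: "L2 ?M u" unfolding u_def by (rule g(1)[OF Nil_in_multi_indices])
  have "L2_norm ?M (\<lambda>x. ?D [] (U j) x - u x) = L2_norm ?M (\<lambda>x. U j x - u x)" for j
  proof (rule L2_norm_cong_AE)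
    show "AE x in ?M. ?D [] (U j) x - u x = U j x - u x"
      using weak_deriv_Nil_AE[OF \<Omega> Hk_L2[OF U[of j]]] by eventually_elim simp
  qed (intro L2_diff u Hk_L2[OF U] Hk_weak_deriv(2)[OF \<Omega> U] Nil_in_multi_indices)+
  then have lim_u: "(\<lambda>j. (L2_norm ?M (\<lambda>x. U j x - u x))\<^sup>2) \<longlonglongrightarrow> 0"
    using g(2)[OF Nil_in_multi_indices] by (simp add: u_def)
  have d: "has_weak_deriv \<Omega> \<alpha> u (g \<alpha>)" if \<alpha>: "\<alpha> \<in> multi_indices k" for \<alpha>
    by (rule has_weak_deriv_limit[OF \<Omega>' Hk_weak_deriv(1)[OF \<Omega> U \<alpha>] Hk_L2[OF U] u lim_u
        Hk_weak_deriv(2)[OF \<Omega> U \<alpha>] g(1)[OF \<alpha>] g(2)[OF \<alpha>]])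
  then have Hu: "Hk k \<Omega> u" unfolding Hk_def using u g(1) by blast
  have "L2_norm ?M (?D \<alpha> (\<lambda>x. U j x - u x)) = L2_norm ?M (\<lambda>x. ?D \<alpha> (U j) x - g \<alpha> x)"
    if \<alpha>: "\<alpha> \<in> multi_indices k" for j \<alpha>
  proof (rule L2_norm_cong_AE)
    show "L2 ?M (?D \<alpha> (\<lambda>x. U j x - u x))"
      by (intro Hk_weak_deriv(2)[OF \<Omega> _ \<alpha>] Hk_diff \<Omega> U Hu)
    show "L2 ?M (\<lambda>x. ?D \<alpha> (U j) x - g \<alpha> x)"
      by (intro L2_diff g(1) \<alpha> Hk_weak_deriv(2)[OF \<Omega> U])
    show "AE x in ?M. ?D \<alpha> (\<lambda>x. U j x - u x) x = ?D \<alpha> (U j) x - g \<alpha> x"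
      using weak_deriv_AE_eq[OF \<Omega> has_weak_deriv_lincomb[OF Hk_weak_deriv(1)[OF \<Omega> U[of j] \<alpha>] d[OF \<alpha>], of 1 "-1"]] by simp
  qed
  then have "(\<lambda>j. (Hk_norm k \<Omega> (\<lambda>x. U j x - u x))\<^sup>2) =
      (\<lambda>j. \<Sum>\<alpha>\<in>multi_indices k. (L2_norm ?M (\<lambda>x. ?D \<alpha> (U j) x - g \<alpha> x))\<^sup>2)"
    by (simp add: Hk_norm_sq)
  also have "\<dots> \<longlonglongrightarrow> (\<Sum>\<alpha>\<in>(multi_indices k :: 'n list set). 0)"
    by (intro tendsto_sum g(2))
  finally show ?thesis using Hu by auto
qed


section \<open>Smooth functions and derivatives as Sobolev functions\<close>

lemma multi_indices_one_cases:
  assumes "\<alpha> \<in> multi_indices 1"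
  obtains "\<alpha> = []" | i where "\<alpha> = [i]"
  using assms by (cases \<alpha>) (auto simp: multi_indices_def)

text \<open>
  Boundedness of the domain makes continuous functions square integrable; integration by parts
  identifies the weak derivatives with the classical ones.
\<close>

lemma smooth_imp_H1:
  assumes \<Omega>: "open \<Omega>" "bounded \<Omega>" and w: "smooth w"
  shows "Hk 1 \<Omega> w"
  unfolding Hk_def
proof (intro conjI ballI)
  have m: "\<Omega> \<in> lmeasurable" using \<Omega> by (simp add: lmeasurable_open)
  have L2: "L2 (lebesgue_on \<Omega>) f" if "smooth f" for f :: "real^'a::{finite,linorder} \<Rightarrow> complex"
    using that by (intro bounded_continuous_imp_L2 m \<Omega> smooth_continuous_on)
  show "L2 (lebesgue_on \<Omega>) w" by (rule L2[OF w])
  fix \<alpha> :: "'a list" assume "\<alpha> \<in> multi_indices 1"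
  then show "\<exists>v. L2 (lebesgue_on \<Omega>) v \<and> has_weak_deriv \<Omega> \<alpha> w v"
  proof (cases rule: multi_indices_one_cases)
    case 1
    then show ?thesis
      using L2[OF w] has_weak_deriv_Nil[OF continuous_locally_integrable[OF smooth_continuous_on[OF w]]] by blast
  next
    case (2 i)
    then show ?thesis
      using L2[OF smooth_partial[OF w]] has_weak_deriv_partial[OF w] by blast
  qed
qed

text \<open>
  The \<open>z\<close>-direction is the largest index, so appending it keeps a multi-index sorted.
\<close>

lemma append_z_index_in_multi_indices:
  "\<beta> \<in> multi_indices k \<Longrightarrow> \<beta> @ [z_index] \<in> multi_indices (Suc k)"
  by (simp add: multi_indices_def sorted_append z_index_def)

text \<open>
  The derivatives of \<open>\<partial>\<^sub>z u\<close> up to order \<open>k\<close> are among the derivatives of \<open>u\<close> up to order \<open>k + 1\<close>,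
  each occurring once.
\<close>

lemma Hk_Suc_weak_deriv_z:
  fixes u :: "real^'n::{finite,linorder} \<Rightarrow> complex"
  assumes \<Omega>: "open \<Omega>" and u: "Hk (Suc k) \<Omega> u"
  shows "Hk k \<Omega> (weak_deriv \<Omega> [z_index] u)"
    and "(Hk_norm k \<Omega> (weak_deriv \<Omega> [z_index] u))\<^sup>2 \<le> (Hk_norm (Suc k) \<Omega> u)\<^sup>2"
proof -
  let ?M = "lebesgue_on \<Omega>" and ?D = "weak_deriv \<Omega>"
  have z: "[z_index :: 'n] \<in> multi_indices (Suc k)" by (simp add: multi_indices_def)
  have d: "has_weak_deriv \<Omega> \<beta> (?D [z_index] u) (?D (\<beta> @ [z_index]) u)"
    and L2: "L2 ?M (?D (\<beta> @ [z_index]) u)" if "\<beta> \<in> multi_indices k" for \<beta> :: "'n list"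
    using append_z_index_in_multi_indices[OF that]
    by (auto intro!: has_weak_deriv_iterate[of \<Omega> z_index u] Hk_weak_deriv[OF \<Omega> u] z)
  show H: "Hk k \<Omega> (?D [z_index] u)"
    unfolding Hk_def using Hk_weak_deriv(2)[OF \<Omega> u z] d L2 by blast
  have "(L2_norm ?M (?D \<beta> (?D [z_index] u)))\<^sup>2 = (L2_norm ?M (?D (\<beta> @ [z_index]) u))\<^sup>2"
    if \<beta>: "\<beta> \<in> multi_indices k" for \<beta> :: "'n list"
    using L2_norm_cong_AE[OF Hk_weak_deriv(2)[OF \<Omega> H \<beta>] L2[OF \<beta>] weak_deriv_AE_eq[OF \<Omega> d[OF \<beta>]]] by simp
  then have "(Hk_norm k \<Omega> (?D [z_index] u))\<^sup>2 = (\<Sum>\<beta>\<in>(multi_indices k :: 'n list set). (L2_norm ?M (?D (\<beta> @ [z_index]) u))\<^sup>2)"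
    by (simp add: Hk_norm_sq)
  also have "\<dots> = (\<Sum>\<alpha>\<in>(\<lambda>\<beta>. \<beta> @ [z_index]) ` multi_indices k. (L2_norm ?M (?D \<alpha> u))\<^sup>2)"
    by (subst sum.reindex) (auto simp: inj_on_def)
  also have "\<dots> \<le> (Hk_norm (Suc k) \<Omega> u)\<^sup>2"
    unfolding Hk_norm_sq
    by (intro sum_mono2 finite_multi_indices) (auto intro: append_z_index_in_multi_indices)
  finally show "(Hk_norm k \<Omega> (?D [z_index] u))\<^sup>2 \<le> (Hk_norm (Suc k) \<Omega> u)\<^sup>2" .
qed

lemma Hk_mono: "Hk l \<Omega> u \<Longrightarrow> k \<le> l \<Longrightarrow> Hk k \<Omega> u"
  by (auto simp: Hk_def multi_indices_def)

lemma Hk_norm_mono_sq: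
  assumes "k \<le> l"
  shows "(Hk_norm k \<Omega> u)\<^sup>2 \<le> (Hk_norm l \<Omega> u)\<^sup>2"
  unfolding Hk_norm_sq
  using assms by (intro sum_mono2 finite_multi_indices) (auto simp: multi_indices_def)


section \<open>Closedness of traces\<close>

lemma cube_eq_box: "cube R = box (\<chi> i. - R) (\<chi> i. R)"
  by (auto simp: cube_def mem_box_cart)

lemma open_cube: "open (cube R)"
  unfolding cube_eq_box by (rule open_box)

lemma bounded_cube: "bounded (cube R)"
  unfolding cube_eq_box by (rule bounded_box)

lemma frontier_cube_subset: "frontier (cube R) \<subseteq> cbox (\<chi> i. - R) (\<chi> i. R)"
proof -
  have "frontier (cube R) \<subseteq> closure (cube R)" by (simp add: frontier_def)
  also have "\<dots> \<subseteq> cbox (\<chi> i. - R) (\<chi> i. R)"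
    unfolding cube_eq_box by (intro closure_minimal box_subset_cbox closed_cbox)
  finally show ?thesis .
qed

lemma compact_frontier_cube: "compact (frontier (cube R))"
  using bounded_cube by (rule compact_frontier_bounded)

lemma compact_Gamma_plus: "compact (Gamma_plus R)"
proof -
  have "Gamma_plus R = frontier (cube R) \<inter> {x. x $ z_index = R}"
    by (auto simp: Gamma_plus_def)
  moreover have "closed {x::real^'n::{finite,linorder}. x $ z_index = R}"
    by (intro closed_Collect_eq continuous_intros)
  ultimately show ?thesis
    using compact_frontier_cube compact_Int_closed by metis
qed

text \<open>
  Pulled back to the remaining coordinates, the frontier of the cube lies in a box with sides \<open>[-R,
  R]\<close>.
\<close>

lemma emeasure_hyperplane_measure_frontier_finite:
  "emeasure (hyperplane_measure i s) (A \<inter> frontier (cube R :: (real^'n::finite) set)) < \<infinity>"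
proof -
  let ?P = "\<Pi>\<^sub>M j\<in>UNIV - {i}. (lborel :: real measure)"
  let ?f = "\<lambda>y::'n \<Rightarrow> real. (\<chi> j. if j = i then s else y j) :: real^'n"
  let ?B = "\<Pi>\<^sub>E j\<in>UNIV - {i}. {-R..R}"
  interpret product_sigma_finite "\<lambda>_::'n. lborel :: real measure" ..
  \<comment> \<open>Whether or not the defining set function is a measure, the emeasure is at most its value.\<close>
  have "emeasure (hyperplane_measure i s) (A \<inter> frontier (cube R)) \<le>
      emeasure ?P (?f -` (A \<inter> frontier (cube R)) \<inter> space ?P)"
    unfolding hyperplane_measure_def distr_def by (simp add: emeasure_measure_of_conv)
  also have "\<dots> \<le> emeasure ?P ?B"
  proof (rule emeasure_mono)
    show "?f -` (A \<inter> frontier (cube R)) \<inter> space ?P \<subseteq> ?B"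
    proof
      fix y assume y: "y \<in> ?f -` (A \<inter> frontier (cube R)) \<inter> space ?P"
      then have "?f y \<in> cbox (\<chi> i. - R) (\<chi> i. R)" using frontier_cube_subset by blast
      then have b: "- R \<le> ?f y $ j \<and> ?f y $ j \<le> R" for j by (simp add: mem_box_cart)
      have "- R \<le> y j \<and> y j \<le> R" if "j \<noteq> i" for j
        using b[of j] that by simp
      with y show "y \<in> ?B" by (auto simp: space_PiM PiE_iff)
    qed
    show "?B \<in> sets ?P" by (intro sets_PiM_I_finite) auto
  qed
  also have "\<dots> = (\<Prod>j\<in>UNIV - {i}. emeasure lborel {-R..R})"
    by (rule emeasure_PiM) auto
  also have "\<dots> < \<infinity>"
    by (simp add: power_less_top_ennreal emeasure_lborel_Icc_eq)
  finally show ?thesis .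
qed

lemma finite_cube_surface_measure: "finite_measure (cube_surface_measure R :: (real^'n::finite) measure)"
proof
  define \<mu> where "\<mu> A = (\<Sum>i\<in>UNIV. \<Sum>s\<in>{-R, R}. emeasure (hyperplane_measure i s) (A \<inter> frontier (cube R :: (real^'n) set)))" for A
  define N where "N = measure_of UNIV (sets borel) \<mu>"
  have c: "(cube_surface_measure R :: (real^'n) measure) = completion N"
    by (simp add: cube_surface_measure_def N_def \<mu>_def[abs_def])
  have "emeasure (hyperplane_measure i s) (UNIV \<inter> frontier (cube R :: (real^'n) set)) < \<infinity>" for i s
    by (rule emeasure_hyperplane_measure_frontier_finite)
  then have "\<mu> UNIV < \<infinity>" by (simp add: less_top \<mu>_def)
  moreover have "emeasure N UNIV \<le> \<mu> UNIV" by (simp add: N_def emeasure_measure_of_conv)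
  moreover have "UNIV \<in> sets N" by (simp add: N_def sets_measure_of_conv sets.sigma_sets_eq)
  moreover have "space (completion N) = UNIV" by (simp add: N_def space_measure_of_conv)
  ultimately show "emeasure (cube_surface_measure R :: (real^'n) measure) (space (cube_surface_measure R)) \<noteq> \<infinity>"
    unfolding c by (simp add: emeasure_completion)
qed

lemma borel_measurable_cube_surface_measure:
  "f \<in> borel_measurable borel \<Longrightarrow> f \<in> borel_measurable (cube_surface_measure R)"
  unfolding cube_surface_measure_def
  by (intro measurable_completion) (simp add: measurable_def space_measure_of_conv sets_measure_of_conv sets.sigma_sets_eq)

text \<open>
  Finiteness of the surface measure matters because the norm of a function that is not square
  integrable is zero by convention: without this lemma the boundary norm would not obey the triangle
  inequality.
\<close>

lemma continuous_imp_L2_surface: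
  fixes w :: "real^'n::finite \<Rightarrow> complex"
  assumes w: "continuous_on UNIV w" and \<Gamma>: "compact \<Gamma>"
  shows "L2 (restrict_space (cube_surface_measure R) \<Gamma>) w"
proof -
  let ?M = "restrict_space (cube_surface_measure R) \<Gamma>"
  have sp: "space (cube_surface_measure R) = (UNIV :: (real^'n) set)"
    by (simp add: cube_surface_measure_def space_measure_of_conv)
  have "\<Gamma> \<in> sets borel" using \<Gamma> by (simp add: borel_closed compact_imp_closed)
  then have "\<Gamma> \<inter> space (cube_surface_measure R) \<in> sets (cube_surface_measure R)"
    unfolding cube_surface_measure_def
    by (simp add: space_measure_of_conv sets_measure_of_conv sets.sigma_sets_eq)
  then interpret finite_measure ?M
    by (intro finite_measure_restrict_space finite_cube_surface_measure) (simp add: sp)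
  have m: "w \<in> borel_measurable ?M"
    using w by (intro measurable_restrict_space1 borel_measurable_cube_surface_measure borel_measurable_continuous_onI)
  have "compact (w ` \<Gamma>)"
    using \<Gamma> by (intro compact_continuous_image continuous_on_subset[OF w]) auto
  then obtain B where B: "\<And>x. x \<in> \<Gamma> \<Longrightarrow> norm (w x) \<le> B"
    using compact_imp_bounded[of "w ` \<Gamma>"] unfolding bounded_iff by blast
  have "integrable ?M (\<lambda>x. (norm (w x))\<^sup>2)"
  proof (rule integrable_const_bound[of _ "B\<^sup>2"])
    show "AE x in ?M. norm ((norm (w x))\<^sup>2) \<le> B\<^sup>2"
      using B by (intro AE_I2) (auto simp: space_restrict_space intro!: power_mono)
  qed (use m in simp)
  with m show ?thesis by (simp add: L2_def)
qed

lemma tendsto_0_if_le: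
  fixes f g :: "nat \<Rightarrow> real"
  assumes "g \<longlonglongrightarrow> 0" "\<And>j. 0 \<le> f j" "\<And>j. f j \<le> g j"
  shows "f \<longlonglongrightarrow> 0"
  by (rule tendsto_sandwich[OF _ _ tendsto_const assms(1)]) (simp_all add: assms)

lemma tendsto_0_iff_sq_tendsto_0:
  fixes f :: "nat \<Rightarrow> real"
  shows "f \<longlonglongrightarrow> 0 \<longleftrightarrow> (\<lambda>j. (f j)\<^sup>2) \<longlonglongrightarrow> 0"
  using power_tendsto_0_iff[of 2 f sequentially] by simp

lemma Hk_norm_lincomb_sq_le:
  assumes \<Omega>: "open \<Omega>" and u: "Hk k \<Omega> u" and v: "Hk k \<Omega> v"
  shows "(Hk_norm k \<Omega> (\<lambda>x. s *\<^sub>R u x + t *\<^sub>R v x))\<^sup>2 \<le> 2 * (s\<^sup>2 * (Hk_norm k \<Omega> u)\<^sup>2) + 2 * (t\<^sup>2 * (Hk_norm k \<Omega> v)\<^sup>2)"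
  using Hk_norm_add_sq_le[OF \<Omega>, of k "\<lambda>x. s *\<^sub>R u x" "\<lambda>x. t *\<^sub>R v x"] Hk_lincomb[OF \<Omega> u u, of s 0]
    Hk_lincomb[OF \<Omega> v v, of t 0] Hk_norm_scaleR_sq[OF \<Omega> u, of s] Hk_norm_scaleR_sq[OF \<Omega> v, of t] by simp

lemma L2_norm_lincomb_sq_le:
  assumes f: "L2 M f" and g: "L2 M g"
  shows "(L2_norm M (\<lambda>x. s *\<^sub>R f x + t *\<^sub>R g x))\<^sup>2 \<le> 2 * (s\<^sup>2 * (L2_norm M f)\<^sup>2) + 2 * (t\<^sup>2 * (L2_norm M g)\<^sup>2)"
  using L2_norm_add_sq_le[of M "\<lambda>x. s *\<^sub>R f x" "\<lambda>x. t *\<^sub>R g x"] L2_lincomb[OF f f, of s 0] L2_lincomb[OF g g, of t 0]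
  by (simp add: L2_norm_scaleR power_mult_distrib)

lemma has_trace_cong_AE:
  assumes eq: "AE x in lebesgue_on (cube R). u x = v x" and u: "has_trace R \<Gamma> u h"
  shows "has_trace R \<Gamma> v h"
proof -
  have "AE x in lebesgue_on (cube R). w x - u x = w x - v x" for w
    using eq by eventually_elim simp
  then have "Hk_norm 1 (cube R) (\<lambda>x. w x - u x) = Hk_norm 1 (cube R) (\<lambda>x. w x - v x)" for w
    by (rule Hk_norm_cong_AE[OF open_cube])
  moreover have "Hk 1 (cube R) v"
    using u by (intro Hk_cong_AE[OF open_cube _ eq]) (simp add: has_trace_def)
  ultimately show ?thesis using u by (simp add: has_trace_def)
qed

lemma has_trace_lincomb:
  fixes u v :: "real^'n::{finite,linorder} \<Rightarrow> complex"
  assumes \<Gamma>: "compact \<Gamma>" and u: "has_trace R \<Gamma> u h" and v: "has_trace R \<Gamma> v g"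
  shows "has_trace R \<Gamma> (\<lambda>x. s *\<^sub>R u x + t *\<^sub>R v x) (\<lambda>x. s *\<^sub>R h x + t *\<^sub>R g x)"
proof -
  let ?H = "Hk_norm 1 (cube R)" and ?M = "restrict_space (cube_surface_measure R) \<Gamma>"
  have uH: "Hk 1 (cube R) u" "L2 ?M h" and vH: "Hk 1 (cube R) v" "L2 ?M g"
    using u v by (auto simp: has_trace_def)
  obtain p where p: "\<And>j. smooth (p j)" "(\<lambda>j. ?H (\<lambda>x. p j x - u x)) \<longlonglongrightarrow> 0"
    "(\<lambda>j. L2_norm ?M (\<lambda>x. p j x - h x)) \<longlonglongrightarrow> 0"
    using u unfolding has_trace_def by auto
  obtain q where q: "\<And>j. smooth (q j)" "(\<lambda>j. ?H (\<lambda>x. q j x - v x)) \<longlonglongrightarrow> 0"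
    "(\<lambda>j. L2_norm ?M (\<lambda>x. q j x - g x)) \<longlonglongrightarrow> 0"
    using v unfolding has_trace_def by auto
  define w where "w j x = s *\<^sub>R p j x + t *\<^sub>R q j x" for j x
  have w: "smooth (w j)" for j unfolding w_def by (intro smooth_lincomb p q)
  have wH: "(\<lambda>x. w j x - (s *\<^sub>R u x + t *\<^sub>R v x)) = (\<lambda>x. s *\<^sub>R (p j x - u x) + t *\<^sub>R (q j x - v x))"
    and wL: "(\<lambda>x. w j x - (s *\<^sub>R h x + t *\<^sub>R g x)) = (\<lambda>x. s *\<^sub>R (p j x - h x) + t *\<^sub>R (q j x - g x))" for j
    by (auto simp: w_def algebra_simps)
  have pH: "Hk 1 (cube R) (\<lambda>x. p j x - u x)" and qH: "Hk 1 (cube R) (\<lambda>x. q j x - v x)" for j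
    by (intro Hk_diff open_cube smooth_imp_H1 bounded_cube p q uH vH)+
  have pL: "L2 ?M (\<lambda>x. p j x - h x)" and qL: "L2 ?M (\<lambda>x. q j x - g x)" for j
    by (intro L2_diff continuous_imp_L2_surface smooth_continuous_on p q \<Gamma> uH vH)+
  have null: "(\<lambda>j. 2 * (s\<^sup>2 * (f j)\<^sup>2) + 2 * (t\<^sup>2 * (f' j)\<^sup>2)) \<longlonglongrightarrow> 0"
    if "f \<longlonglongrightarrow> 0" "f' \<longlonglongrightarrow> 0" for f f' :: "nat \<Rightarrow> real"
    using that by (auto intro!: tendsto_eq_intros)
  have lH: "(\<lambda>j. (?H (\<lambda>x. w j x - (s *\<^sub>R u x + t *\<^sub>R v x)))\<^sup>2) \<longlonglongrightarrow> 0"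
    unfolding wH
    by (rule tendsto_0_if_le[OF null[OF p(2) q(2)] zero_le_power2 Hk_norm_lincomb_sq_le[OF open_cube pH qH]])
  have lL: "(\<lambda>j. (L2_norm ?M (\<lambda>x. w j x - (s *\<^sub>R h x + t *\<^sub>R g x)))\<^sup>2) \<longlonglongrightarrow> 0"
    unfolding wL
    by (rule tendsto_0_if_le[OF null[OF p(3) q(3)] zero_le_power2 L2_norm_lincomb_sq_le[OF pL qL]])
  have "Hk 1 (cube R) (\<lambda>x. s *\<^sub>R u x + t *\<^sub>R v x)" by (intro Hk_lincomb open_cube uH vH)
  moreover have "L2 ?M (\<lambda>x. s *\<^sub>R h x + t *\<^sub>R g x)" by (intro L2_lincomb uH vH)
  ultimately show ?thesis
    unfolding has_trace_def
    by (intro conjI exI[of _ w] allI w iffD2[OF tendsto_0_iff_sq_tendsto_0 lH]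
        iffD2[OF tendsto_0_iff_sq_tendsto_0 lL])
qed

text \<open>
  A diagonal argument: choose a smooth function \<open>w\<^sub>j\<close> within \<open>1/(j+1)\<close> of \<open>U\<^sub>j\<close> in the interior and
  of \<open>h\<close> on the boundary. Since all \<open>U\<^sub>j\<close> share the boundary function \<open>h\<close>, the same \<open>w\<^sub>j\<close> serve as
  smooth approximations of the limit.
\<close>

lemma has_trace_closed:
  fixes u :: "real^'n::{finite,linorder} \<Rightarrow> complex"
  assumes U: "\<And>j. has_trace R \<Gamma> (U j) h" and u: "Hk 1 (cube R) u"
    and lim: "(\<lambda>j. (Hk_norm 1 (cube R) (\<lambda>x. U j x - u x))\<^sup>2) \<longlonglongrightarrow> 0"
  shows "has_trace R \<Gamma> u h"
proof -
  let ?H = "Hk_norm 1 (cube R)" and ?M = "restrict_space (cube_surface_measure R) \<Gamma>"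
  have UH: "Hk 1 (cube R) (U j)" and h: "L2 ?M h" for j
    using U by (auto simp: has_trace_def)
  have "\<exists>w. smooth w \<and> ?H (\<lambda>x. w x - U j x) < 1 / real (Suc j) \<and> L2_norm ?M (\<lambda>x. w x - h x) < 1 / real (Suc j)" for j
  proof -
    obtain p where p: "\<And>i. smooth (p i)" "(\<lambda>i. ?H (\<lambda>x. p i x - U j x)) \<longlonglongrightarrow> 0"
      "(\<lambda>i. L2_norm ?M (\<lambda>x. p i x - h x)) \<longlonglongrightarrow> 0"
      using U[of j] unfolding has_trace_def by auto
    have "\<forall>\<^sub>F i in sequentially. ?H (\<lambda>x. p i x - U j x) < 1 / real (Suc j) \<and> L2_norm ?M (\<lambda>x. p i x - h x) < 1 / real (Suc j)"
      using order_tendstoD(2)[OF p(2), of "1 / real (Suc j)"] order_tendstoD(2)[OF p(3), of "1 / real (Suc j)"]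
      by (simp add: eventually_conj)
    then show ?thesis using p(1) eventually_happens'[OF sequentially_bot] by blast
  qed
  then obtain w where w: "\<And>j. smooth (w j)" "\<And>j. ?H (\<lambda>x. w j x - U j x) < 1 / real (Suc j)"
    "\<And>j. L2_norm ?M (\<lambda>x. w j x - h x) < 1 / real (Suc j)"
    by metis
  have inv0: "(\<lambda>j. 1 / real (Suc j)) \<longlonglongrightarrow> 0" by (rule LIMSEQ_Suc[OF lim_1_over_n])
  have L: "(\<lambda>j. L2_norm ?M (\<lambda>x. w j x - h x)) \<longlonglongrightarrow> 0"
    by (rule tendsto_0_if_le[OF inv0 L2_norm_nonneg less_imp_le[OF w(3)]])
  have "(\<lambda>j. ?H (\<lambda>x. w j x - U j x)) \<longlonglongrightarrow> 0"
    by (rule tendsto_0_if_le[OF inv0 Hk_norm_nonneg less_imp_le[OF w(2)]])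
  then have "(\<lambda>j. 2 * (?H (\<lambda>x. w j x - U j x))\<^sup>2 + 2 * (?H (\<lambda>x. U j x - u x))\<^sup>2) \<longlonglongrightarrow> 2 * 0\<^sup>2 + 2 * 0"
    by (intro tendsto_intros lim)
  then have null: "(\<lambda>j. 2 * (?H (\<lambda>x. w j x - U j x))\<^sup>2 + 2 * (?H (\<lambda>x. U j x - u x))\<^sup>2) \<longlonglongrightarrow> 0" by simp
  have le: "(?H (\<lambda>x. w j x - u x))\<^sup>2 \<le> 2 * (?H (\<lambda>x. w j x - U j x))\<^sup>2 + 2 * (?H (\<lambda>x. U j x - u x))\<^sup>2" for j
    using Hk_norm_add_sq_le[OF open_cube Hk_diff[OF open_cube smooth_imp_H1[OF open_cube bounded_cube w(1)[of j]] UH[of j]]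
        Hk_diff[OF open_cube UH[of j] u]] by simp
  have "(\<lambda>j. (?H (\<lambda>x. w j x - u x))\<^sup>2) \<longlonglongrightarrow> 0"
    by (rule tendsto_0_if_le[OF null zero_le_power2 le])
  then have "(\<lambda>j. ?H (\<lambda>x. w j x - u x)) \<longlonglongrightarrow> 0" by (rule iffD2[OF tendsto_0_iff_sq_tendsto_0])
  then show ?thesis
    unfolding has_trace_def by (intro conjI exI[of _ w] allI w(1) L u h)
qed


section \<open>The admissible set\<close>

lemma z_in_multi_indices_2: "[z_index] \<in> multi_indices 2"
  by (simp add: multi_indices_def)

text \<open>
  The chosen normal derivative of a combination agrees with the combination of the normal
  derivatives only almost everywhere, hence the appeal to \<open>has_trace_cong_AE\<close>.
\<close>

lemma admissible_affine:
  fixes V W :: "real^'n::{finite,linorder} \<Rightarrow> complex^'m::finite"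
  assumes V: "admissible R Ft Gt V" and W: "admissible R Ft Gt W" and st: "s + t = 1"
  shows "admissible R Ft Gt (\<lambda>x. s *\<^sub>R V x + t *\<^sub>R W x)"
  unfolding admissible_def
proof (intro conjI allI)
  have H: "Hk 2 (cube R) (\<lambda>x. V x $ m)" "Hk 2 (cube R) (\<lambda>x. W x $ m)" for m
    using V W by (auto simp: admissible_def Hk_vec_def)
  have nth: "(\<lambda>x. (s *\<^sub>R V x + t *\<^sub>R W x) $ m) = (\<lambda>x. s *\<^sub>R (V x $ m) + t *\<^sub>R (W x $ m))" for m
    by simp
  show "Hk_vec 2 (cube R) (\<lambda>x. s *\<^sub>R V x + t *\<^sub>R W x)"
    unfolding Hk_vec_def nth by (intro allI Hk_lincomb open_cube H)
  fix m
  have tr: "has_trace R (frontier (cube R)) (\<lambda>x. V x $ m) (\<lambda>x. Ft x $ m)"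
    "has_trace R (frontier (cube R)) (\<lambda>x. W x $ m) (\<lambda>x. Ft x $ m)"
    "has_trace R (Gamma_plus R) (weak_deriv (cube R) [z_index] (\<lambda>x. V x $ m)) (\<lambda>x. Gt x $ m)"
    "has_trace R (Gamma_plus R) (weak_deriv (cube R) [z_index] (\<lambda>x. W x $ m)) (\<lambda>x. Gt x $ m)"
    using V W by (simp_all add: admissible_def)
  have const: "(\<lambda>x. s *\<^sub>R h x + t *\<^sub>R h x) = h" for h :: "real^'n::_ \<Rightarrow> complex"
    using st by (simp flip: scaleR_add_left)
  show "has_trace R (frontier (cube R)) (\<lambda>x. (s *\<^sub>R V x + t *\<^sub>R W x) $ m) (\<lambda>x. Ft x $ m)"
    unfolding nth
    using has_trace_lincomb[OF compact_frontier_cube tr(1,2), of s t] unfolding const .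
  have "has_trace R (Gamma_plus R) (\<lambda>x. s *\<^sub>R weak_deriv (cube R) [z_index] (\<lambda>x. V x $ m) x +
      t *\<^sub>R weak_deriv (cube R) [z_index] (\<lambda>x. W x $ m) x) (\<lambda>x. Gt x $ m)"
    using has_trace_lincomb[OF compact_Gamma_plus tr(3,4), of s t] unfolding const .
  moreover have "AE x in lebesgue_on (cube R). s *\<^sub>R weak_deriv (cube R) [z_index] (\<lambda>x. V x $ m) x +
      t *\<^sub>R weak_deriv (cube R) [z_index] (\<lambda>x. W x $ m) x =
      weak_deriv (cube R) [z_index] (\<lambda>x. s *\<^sub>R (V x $ m) + t *\<^sub>R (W x $ m)) x"
    using weak_deriv_lincomb_AE[OF open_cube H[of m] z_in_multi_indices_2, of s t] by eventually_elim simp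
  ultimately show "has_trace R (Gamma_plus R) (weak_deriv (cube R) [z_index] (\<lambda>x. (s *\<^sub>R V x + t *\<^sub>R W x) $ m)) (\<lambda>x. Gt x $ m)"
    unfolding nth by (rule has_trace_cong_AE[rotated])
qed

lemma admissible_closed:
  fixes V :: "real^'n::{finite,linorder} \<Rightarrow> complex^'m::finite"
  assumes U: "\<And>j. admissible R Ft Gt (U j)" and V: "Hk_vec 2 (cube R) V"
    and lim: "\<And>m. (\<lambda>j. (Hk_norm 2 (cube R) (\<lambda>x. U j x $ m - V x $ m))\<^sup>2) \<longlonglongrightarrow> 0"
  shows "admissible R Ft Gt V"
  unfolding admissible_def
proof (intro conjI allI)
  show "Hk_vec 2 (cube R) V" by (rule V)
  fix m
  have HU: "Hk 2 (cube R) (\<lambda>x. U j x $ m)" for j using U by (simp add: admissible_def Hk_vec_def)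
  have HV: "Hk 2 (cube R) (\<lambda>x. V x $ m)" using V by (simp add: Hk_vec_def)
  show "has_trace R (frontier (cube R)) (\<lambda>x. V x $ m) (\<lambda>x. Ft x $ m)"
  proof (rule has_trace_closed)
    show "has_trace R (frontier (cube R)) (\<lambda>x. U j x $ m) (\<lambda>x. Ft x $ m)" for j
      using U by (simp add: admissible_def)
    show "Hk 1 (cube R) (\<lambda>x. V x $ m)" by (rule Hk_mono[OF HV]) simp
    show "(\<lambda>j. (Hk_norm 1 (cube R) (\<lambda>x. U j x $ m - V x $ m))\<^sup>2) \<longlonglongrightarrow> 0"
      by (rule tendsto_0_if_le[OF lim zero_le_power2 Hk_norm_mono_sq]) simp
  qed
  let ?D = "weak_deriv (cube R) [z_index]"
  show "has_trace R (Gamma_plus R) (?D (\<lambda>x. V x $ m)) (\<lambda>x. Gt x $ m)"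
  proof (rule has_trace_closed)
    show "has_trace R (Gamma_plus R) (?D (\<lambda>x. U j x $ m)) (\<lambda>x. Gt x $ m)" for j
      using U by (simp add: admissible_def)
    show "Hk 1 (cube R) (?D (\<lambda>x. V x $ m))"
      using Hk_Suc_weak_deriv_z(1)[OF open_cube, of 1] HV by (simp add: numeral_2_eq_2)
    have le: "(Hk_norm 1 (cube R) (\<lambda>x. ?D (\<lambda>x. U j x $ m) x - ?D (\<lambda>x. V x $ m) x))\<^sup>2
        \<le> (Hk_norm 2 (cube R) (\<lambda>x. U j x $ m - V x $ m))\<^sup>2" for j
    proof -
      have "AE x in lebesgue_on (cube R). ?D (\<lambda>x. U j x $ m) x - ?D (\<lambda>x. V x $ m) x = ?D (\<lambda>x. U j x $ m - V x $ m) x"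
        using weak_deriv_lincomb_AE[OF open_cube HU[of j] HV z_in_multi_indices_2, of 1 "-1"]
        by eventually_elim simp
      then have "Hk_norm 1 (cube R) (\<lambda>x. ?D (\<lambda>x. U j x $ m) x - ?D (\<lambda>x. V x $ m) x) = Hk_norm 1 (cube R) (?D (\<lambda>x. U j x $ m - V x $ m))"
        by (rule Hk_norm_cong_AE[OF open_cube])
      then show ?thesis
        using Hk_Suc_weak_deriv_z(2)[OF open_cube, of 1] Hk_diff[OF open_cube HU[of j] HV] by (simp add: numeral_2_eq_2)
    qed
    show "(\<lambda>j. (Hk_norm 1 (cube R) (\<lambda>x. ?D (\<lambda>x. U j x $ m) x - ?D (\<lambda>x. V x $ m) x))\<^sup>2) \<longlonglongrightarrow> 0"
      by (rule tendsto_0_if_le[OF lim zero_le_power2 le])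
  qed
qed


section \<open>Minimizers of quadratic functionals\<close>

text \<open>
  Completeness and the distance between minimizers are measured by \<open>Q\<close> itself. The midpoint of two
  admissible functions has a value of at least the infimum, so the parallelogram identity bounds the
  value of their half difference \<open>D\<close>; applied to \<open>D\<close> twice, it gives \<open>4 Q D = Q (D + D) + Q 0\<close>,
  which turns this into a bound for the difference.
\<close>

theorem quadratic_minimizer_exists_unique:
  fixes Q :: "('a \<Rightarrow> 'b::real_vector) \<Rightarrow> real"
  assumes nonneg: "\<And>V. 0 \<le> Q V"
    and H_lincomb: "\<And>V W s t. H V \<Longrightarrow> H W \<Longrightarrow> H (\<lambda>x. s *\<^sub>R V x + t *\<^sub>R W x)"
    and parallelogram: "\<And>V W. H V \<Longrightarrow> H W \<Longrightarrow>
      Q (\<lambda>x. V x + W x) + Q (\<lambda>x. V x - W x) = 2 * Q V + 2 * Q W"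
    and A_sub: "\<And>V. A V \<Longrightarrow> H V" and A_nonempty: "\<exists>V. A V"
    and A_affine: "\<And>V W s t. A V \<Longrightarrow> A W \<Longrightarrow> s + t = 1 \<Longrightarrow> A (\<lambda>x. s *\<^sub>R V x + t *\<^sub>R W x)"
    and A_complete: "\<And>U :: nat \<Rightarrow> 'a \<Rightarrow> 'b. (\<And>j. A (U j)) \<Longrightarrow>
      (\<And>e. e > 0 \<Longrightarrow> \<exists>N. \<forall>i\<ge>N. \<forall>j\<ge>N. Q (\<lambda>x. U i x - U j x) < e) \<Longrightarrow>
      \<exists>V. A V \<and> (\<lambda>j. Q (\<lambda>x. U j x - V x)) \<longlonglongrightarrow> 0"
  shows "\<exists>V. is_arg_min Q A V \<and> (\<forall>W. is_arg_min Q A W \<longrightarrow> Q (\<lambda>x. W x - V x) = 0)"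
proof -
  define I where "I = Inf (Q ` Collect A)"
  have bdd: "bdd_below (Q ` Collect A)" using nonneg by (intro bdd_belowI[of _ 0]) auto
  have I_le: "I \<le> Q V" if "A V" for V unfolding I_def using bdd that by (intro cInf_lower) auto
  have H_diff: "H (\<lambda>x. V x - W x)" if "H V" "H W" for V W
    using H_lincomb[OF that, of 1 "-1"] by simp
  have diff_le: "Q (\<lambda>x. V x - W x) \<le> 2 * Q V + 2 * Q W - 4 * I" if V: "A V" and W: "A W" for V W
  proof -
    define P where "P x = (1/2) *\<^sub>R V x + (1/2) *\<^sub>R W x" for x
    define D where "D x = (1/2) *\<^sub>R V x + (-1/2) *\<^sub>R W x" for x
    have HP: "H P" and HD: "H D" unfolding P_def D_def by (intro H_lincomb A_sub V W)+
    have AP: "A P" unfolding P_def by (intro A_affine V W) simp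
    have half: "(1/2) *\<^sub>R v + (1/2) *\<^sub>R v = v" for v :: 'b by (simp flip: scaleR_add_left)
    have "(\<lambda>x. P x + D x) = V" "(\<lambda>x. P x - D x) = W"
      using half by (auto simp: P_def D_def fun_eq_iff algebra_simps)
    then have 1: "Q V + Q W = 2 * Q P + 2 * Q D" using parallelogram[OF HP HD] by simp
    have "(\<lambda>x. D x + D x) = (\<lambda>x. V x - W x)"
    proof
      fix x show "D x + D x = V x - W x"
        using half[of "V x"] half[of "W x"] by (simp add: D_def algebra_simps)
    qed
    then have 2: "Q (\<lambda>x. V x - W x) + Q (\<lambda>x. 0) = 4 * Q D" using parallelogram[OF HD HD] by simp
    show ?thesis using 1 2 I_le[OF AP] nonneg[of "\<lambda>x. 0"] by linarith
  qed
  have "\<exists>V. A V \<and> Q V < I + 1 / real (Suc j)" for j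
  proof -
    have "Inf (Q ` Collect A) < I + 1 / real (Suc j)" by (simp add: I_def)
    then obtain q where "q \<in> Q ` Collect A" "q < I + 1 / real (Suc j)"
      using A_nonempty bdd by (subst (asm) cInf_less_iff) auto
    then show ?thesis by auto
  qed
  then have "\<exists>U. \<forall>j. A (U j) \<and> Q (U j) < I + 1 / real (Suc j)" by (rule choice[OF allI])
  then obtain U where U: "\<And>j. A (U j)" "\<And>j. Q (U j) < I + 1 / real (Suc j)" by blast
  have "\<exists>N. \<forall>i\<ge>N. \<forall>j\<ge>N. Q (\<lambda>x. U i x - U j x) < e" if "e > 0" for e
  proof -
    obtain N where N: "4 / e < real N" using reals_Archimedean2 by blast
    have "Q (\<lambda>x. U i x - U j x) < e" if i: "N \<le> i" and j: "N \<le> j" for i j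
    proof -
      have small: "1 / real (Suc k) < e / 4" if "N \<le> k" for k
      proof -
        have "4 / e < real (Suc k)" using N that by linarith
        then show ?thesis using \<open>e > 0\<close> by (simp add: field_simps)
      qed
      show ?thesis
        using diff_le[OF U(1)[of i] U(1)[of j]] U(2)[of i] U(2)[of j] small[OF i] small[OF j] by linarith
    qed
    then show ?thesis by blast
  qed
  from A_complete[OF U(1) this]
  obtain V where V: "A V" and lim: "(\<lambda>j. Q (\<lambda>x. U j x - V x)) \<longlonglongrightarrow> 0"
    by blast
  \<comment> \<open>The reflection \<open>2 U\<^sub>j - V\<close> of \<open>V\<close> in \<open>U\<^sub>j\<close> is admissible, so its value is at least \<open>I\<close>. With the
    parallelogram identity this bounds \<open>Q V\<close> from above, in place of lower semicontinuity.\<close>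
  have "Q V \<le> I + 2 * (1 / real (Suc j)) + 2 * Q (\<lambda>x. U j x - V x)" for j
  proof -
    have UV: "(\<lambda>x. U j x - (U j x - V x)) = V" by simp
    have refl: "(\<lambda>x. 2 *\<^sub>R U j x + (-1) *\<^sub>R V x) = (\<lambda>x. U j x + (U j x - V x))"
      by (simp add: fun_eq_iff scaleR_2)
    have "A (\<lambda>x. U j x + (U j x - V x))"
      using A_affine[OF U(1)[of j] V, of 2 "-1"] unfolding refl by simp
    from I_le[OF this] show ?thesis
      using parallelogram[OF A_sub[OF U(1)[of j]] H_diff[OF A_sub[OF U(1)[of j]] A_sub[OF V]]] U(2)[of j]
      unfolding UV by linarith
  qed
  moreover have "(\<lambda>j. I + 2 * (1 / real (Suc j)) + 2 * Q (\<lambda>x. U j x - V x)) \<longlonglongrightarrow> I + 2 * 0 + 2 * 0"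
    by (intro tendsto_intros lim LIMSEQ_Suc[OF lim_1_over_n])
  ultimately have "Q V \<le> I"
    by (intro LIMSEQ_le_const[of _ I]) auto
  with I_le have min: "Q V \<le> Q W" if "A W" for W using that by force
  then have "is_arg_min Q A V" using V by (auto simp: is_arg_min_def not_less)
  moreover have "Q (\<lambda>x. W x - V x) = 0" if W: "is_arg_min Q A W" for W
  proof -
    have AW: "A W" using W by (simp add: is_arg_min_def)
    have "Q W \<le> Q V" using W V by (auto simp: is_arg_min_def not_less)
    with \<open>Q V \<le> I\<close> diff_le[OF AW V] nonneg[of "\<lambda>x. W x - V x"] show ?thesis by linarith
  qed
  ultimately show ?thesis by blast
qed


section \<open>Bounded operators from second order Sobolev functions to square integrable functions\<close>

text \<open>
  The operators that may occur under the integral of the functional. They take a vector valued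
  function to a scalar one; linearity holds only almost everywhere, since weak derivatives are
  chosen representatives.
\<close>

definition H2_operator ::
  "(real^'n::{finite,linorder}) set \<Rightarrow> ((real^'n::_ \<Rightarrow> complex^'m::finite) \<Rightarrow> real^'n::_ \<Rightarrow> complex) \<Rightarrow> bool" where
  "H2_operator \<Omega> T \<longleftrightarrow>
     (\<forall>V. Hk_vec 2 \<Omega> V \<longrightarrow> L2 (lebesgue_on \<Omega>) (T V)) \<and>
     (\<forall>V W s t. Hk_vec 2 \<Omega> V \<longrightarrow> Hk_vec 2 \<Omega> W \<longrightarrow>
        (AE x in lebesgue_on \<Omega>. T (\<lambda>x. s *\<^sub>R V x + t *\<^sub>R W x) x = s *\<^sub>R T V x + t *\<^sub>R T W x)) \<and>
     (\<exists>C. \<forall>V. Hk_vec 2 \<Omega> V \<longrightarrow> (L2_norm (lebesgue_on \<Omega>) (T V))\<^sup>2 \<le> C * (Hk_norm_vec 2 \<Omega> V)\<^sup>2)"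

lemma H2_operator_L2: "H2_operator \<Omega> T \<Longrightarrow> Hk_vec 2 \<Omega> V \<Longrightarrow> L2 (lebesgue_on \<Omega>) (T V)"
  by (simp add: H2_operator_def)

lemma H2_operator_lincomb:
  "H2_operator \<Omega> T \<Longrightarrow> Hk_vec 2 \<Omega> V \<Longrightarrow> Hk_vec 2 \<Omega> W \<Longrightarrow>
    AE x in lebesgue_on \<Omega>. T (\<lambda>x. s *\<^sub>R V x + t *\<^sub>R W x) x = s *\<^sub>R T V x + t *\<^sub>R T W x"
  by (simp add: H2_operator_def)

lemma H2_operator_bounded:
  "H2_operator \<Omega> T \<Longrightarrow>
    \<exists>C. \<forall>V. Hk_vec 2 \<Omega> V \<longrightarrow> (L2_norm (lebesgue_on \<Omega>) (T V))\<^sup>2 \<le> C * (Hk_norm_vec 2 \<Omega> V)\<^sup>2"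
  unfolding H2_operator_def by (elim conjE)

lemma Hk_norm_vec_sq: "(Hk_norm_vec k \<Omega> V)\<^sup>2 = (\<Sum>m\<in>UNIV. (Hk_norm k \<Omega> (\<lambda>x. V x $ m))\<^sup>2)"
  by (simp add: Hk_norm_vec_def sum_nonneg)

lemma Hk_norm_component_le: "(Hk_norm k \<Omega> (\<lambda>x. V x $ m))\<^sup>2 \<le> (Hk_norm_vec k \<Omega> V)\<^sup>2"
  unfolding Hk_norm_vec_sq by (rule member_le_sum[of m UNIV "\<lambda>m. (Hk_norm k \<Omega> (\<lambda>x. V x $ m))\<^sup>2"]) auto

lemma Hk_vec_component: "Hk_vec k \<Omega> V \<Longrightarrow> Hk k \<Omega> (\<lambda>x. V x $ m)"
  by (simp add: Hk_vec_def)

lemma Hk_vec_lincomb: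
  "open \<Omega> \<Longrightarrow> Hk_vec k \<Omega> V \<Longrightarrow> Hk_vec k \<Omega> W \<Longrightarrow> Hk_vec k \<Omega> (\<lambda>x. s *\<^sub>R V x + t *\<^sub>R W x)"
  unfolding Hk_vec_def vector_add_component vector_scaleR_component
  by (intro allI Hk_lincomb) auto

lemma Hk_norm_vec_parallelogram:
  assumes \<Omega>: "open \<Omega>" and V: "Hk_vec k \<Omega> V" and W: "Hk_vec k \<Omega> W"
  shows "(Hk_norm_vec k \<Omega> (\<lambda>x. V x + W x))\<^sup>2 + (Hk_norm_vec k \<Omega> (\<lambda>x. V x - W x))\<^sup>2 =
    2 * (Hk_norm_vec k \<Omega> V)\<^sup>2 + 2 * (Hk_norm_vec k \<Omega> W)\<^sup>2"
  using Hk_norm_parallelogram[OF \<Omega> Hk_vec_component[OF V] Hk_vec_component[OF W]]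
  by (simp add: Hk_norm_vec_sq sum_distrib_left flip: sum.distrib)

lemma weak_deriv_order_le_2_sorted:
  fixes \<alpha> :: "'n::{finite,linorder} list"
  assumes "length \<alpha> \<le> 2"
  shows "\<exists>\<beta>\<in>multi_indices 2. \<forall>u. weak_deriv \<Omega> \<alpha> u = weak_deriv \<Omega> \<beta> u"
proof (cases "sorted \<alpha>")
  case True
  then show ?thesis using assms by (auto simp: multi_indices_def)
next
  case False
  with assms obtain i j where \<alpha>: "\<alpha> = [i, j]" and "\<not> i \<le> j"
    by (cases \<alpha> rule: remdups_adj.cases) auto
  then have "[j, i] \<in> multi_indices 2" by (simp add: multi_indices_def)
  then show ?thesis unfolding \<alpha> using weak_deriv_swap by blast
qed

lemma H2_operator_weak_deriv:
  assumes \<Omega>: "open \<Omega>" and "length \<alpha> \<le> 2"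
  shows "H2_operator \<Omega> (\<lambda>V. weak_deriv \<Omega> \<alpha> (\<lambda>x. V x $ m))"
proof -
  obtain \<beta> where \<beta>: "\<beta> \<in> multi_indices 2" "\<And>u. weak_deriv \<Omega> \<alpha> u = weak_deriv \<Omega> \<beta> u"
    using weak_deriv_order_le_2_sorted[OF assms(2)] by blast
  show ?thesis
    unfolding H2_operator_def \<beta>(2)
  proof (intro conjI allI impI exI[of _ 1])
    show "L2 (lebesgue_on \<Omega>) (weak_deriv \<Omega> \<beta> (\<lambda>x. V x $ m))" if "Hk_vec 2 \<Omega> V" for V
      by (rule Hk_weak_deriv(2)[OF \<Omega> Hk_vec_component[OF that] \<beta>(1)])
    show "AE x in lebesgue_on \<Omega>. weak_deriv \<Omega> \<beta> (\<lambda>x. (s *\<^sub>R V x + t *\<^sub>R W x) $ m) x =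
        s *\<^sub>R weak_deriv \<Omega> \<beta> (\<lambda>x. V x $ m) x + t *\<^sub>R weak_deriv \<Omega> \<beta> (\<lambda>x. W x $ m) x"
      if "Hk_vec 2 \<Omega> V" "Hk_vec 2 \<Omega> W" for V W s t
      using weak_deriv_lincomb_AE[OF \<Omega> Hk_vec_component[OF that(1)] Hk_vec_component[OF that(2)] \<beta>(1)] by simp
    show "(L2_norm (lebesgue_on \<Omega>) (weak_deriv \<Omega> \<beta> (\<lambda>x. V x $ m)))\<^sup>2 \<le> 1 * (Hk_norm_vec 2 \<Omega> V)\<^sup>2" for V
      using order_trans[OF L2_norm_weak_deriv_le_Hk_norm[OF \<beta>(1)] Hk_norm_component_le] by simp
  qed
qed

lemma H2_operator_component:
  assumes \<Omega>: "open \<Omega>"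
  shows "H2_operator \<Omega> (\<lambda>V x. V x $ m)"
  unfolding H2_operator_def
proof (intro conjI allI impI exI[of _ 1])
  show L2: "L2 (lebesgue_on \<Omega>) (\<lambda>x. V x $ m)" if "Hk_vec 2 \<Omega> V" for V
    by (rule Hk_L2[OF Hk_vec_component[OF that]])
  show "(L2_norm (lebesgue_on \<Omega>) (\<lambda>x. V x $ m))\<^sup>2 \<le> 1 * (Hk_norm_vec 2 \<Omega> V)\<^sup>2" if V: "Hk_vec 2 \<Omega> V" for V
  proof -
    have "L2_norm (lebesgue_on \<Omega>) (weak_deriv \<Omega> [] (\<lambda>x. V x $ m)) = L2_norm (lebesgue_on \<Omega>) (\<lambda>x. V x $ m)"
      by (intro L2_norm_cong_AE weak_deriv_Nil_AE L2 V \<Omega> Hk_weak_deriv(2)[OF \<Omega> Hk_vec_component[OF V]] Nil_in_multi_indices)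
    then show ?thesis
      using order_trans[OF L2_norm_weak_deriv_le_Hk_norm[OF Nil_in_multi_indices] Hk_norm_component_le, of \<Omega> V m 2] by simp
  qed
qed simp

lemma H2_operator_add:
  fixes S T :: "(real^'n::{finite,linorder} \<Rightarrow> complex^'m::finite) \<Rightarrow> real^'n::_ \<Rightarrow> complex"
  assumes S: "H2_operator \<Omega> S" and T: "H2_operator \<Omega> T"
  shows "H2_operator \<Omega> (\<lambda>V x. S V x + T V x)"
proof -
  obtain C where C: "\<forall>V. Hk_vec 2 \<Omega> V \<longrightarrow> (L2_norm (lebesgue_on \<Omega>) (S V))\<^sup>2 \<le> C * (Hk_norm_vec 2 \<Omega> V)\<^sup>2"
    using H2_operator_bounded[OF S] ..
  obtain D where D: "\<forall>V. Hk_vec 2 \<Omega> V \<longrightarrow> (L2_norm (lebesgue_on \<Omega>) (T V))\<^sup>2 \<le> D * (Hk_norm_vec 2 \<Omega> V)\<^sup>2"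
    using H2_operator_bounded[OF T] ..
  note L2 = H2_operator_L2[OF S] H2_operator_L2[OF T]
  show ?thesis
    unfolding H2_operator_def
  proof (intro conjI allI impI exI[of _ "2 * C + 2 * D"])
    fix V :: "real^'n::_ \<Rightarrow> complex^'m" assume V: "Hk_vec 2 \<Omega> V"
    show "L2 (lebesgue_on \<Omega>) (\<lambda>x. S V x + T V x)" by (intro L2_add L2 V)
    show "(L2_norm (lebesgue_on \<Omega>) (\<lambda>x. S V x + T V x))\<^sup>2 \<le> (2 * C + 2 * D) * (Hk_norm_vec 2 \<Omega> V)\<^sup>2"
      using L2_norm_add_sq_le[OF L2[OF V]] C[rule_format, OF V] D[rule_format, OF V]
      by (simp add: distrib_right)
    fix W :: "real^'n::_ \<Rightarrow> complex^'m" and s t assume W: "Hk_vec 2 \<Omega> W"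
    show "AE x in lebesgue_on \<Omega>. S (\<lambda>x. s *\<^sub>R V x + t *\<^sub>R W x) x + T (\<lambda>x. s *\<^sub>R V x + t *\<^sub>R W x) x =
        s *\<^sub>R (S V x + T V x) + t *\<^sub>R (S W x + T W x)"
      using H2_operator_lincomb[OF S V W, of s t] H2_operator_lincomb[OF T V W, of s t]
      by eventually_elim (simp add: algebra_simps)
  qed
qed

lemma H2_operator_zero: "H2_operator \<Omega> (\<lambda>V x. 0)"
  by (auto simp: H2_operator_def L2_def L2_norm_def intro: exI[of _ 0])

lemma H2_operator_sum:
  "finite I \<Longrightarrow> (\<And>i. i \<in> I \<Longrightarrow> H2_operator \<Omega> (T i)) \<Longrightarrow> H2_operator \<Omega> (\<lambda>V x. \<Sum>i\<in>I. T i V x)"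
  by (induction I rule: finite_induct) (auto intro: H2_operator_zero H2_operator_add)

text \<open>
  A continuous coefficient is bounded on the compact closure of the domain.
\<close>

lemma H2_operator_mult:
  fixes T :: "(real^'n::{finite,linorder} \<Rightarrow> complex^'m::finite) \<Rightarrow> real^'n::_ \<Rightarrow> complex"
    and q :: "real^'n::_ \<Rightarrow> real"
  assumes \<Omega>: "bounded \<Omega>" and q: "continuous_on UNIV q" and T: "H2_operator \<Omega> T"
  shows "H2_operator \<Omega> (\<lambda>V x. complex_of_real (q x) * T V x)"
proof -
  let ?M = "lebesgue_on \<Omega>"
  have "compact (q ` closure \<Omega>)"
    using \<Omega> by (intro compact_continuous_image continuous_on_subset[OF q]) (auto simp: compact_closure)
  then obtain B where "\<And>x. x \<in> closure \<Omega> \<Longrightarrow> norm (q x) \<le> B"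
    using compact_imp_bounded[of "q ` closure \<Omega>"] unfolding bounded_iff by blast
  then have B: "\<bar>q x\<bar> \<le> B" if "x \<in> \<Omega>" for x using that closure_subset[of \<Omega>] by auto
  have qm: "(\<lambda>x. complex_of_real (q x)) \<in> borel_measurable ?M"
    using q by (intro measurable_restrict_space1 measurable_completion)
      (simp add: borel_measurable_continuous_onI continuous_on_of_real)
  obtain C where C: "\<forall>V. Hk_vec 2 \<Omega> V \<longrightarrow> (L2_norm ?M (T V))\<^sup>2 \<le> C * (Hk_norm_vec 2 \<Omega> V)\<^sup>2"
    using H2_operator_bounded[OF T] ..
  have le: "(norm (complex_of_real (q x) * z))\<^sup>2 \<le> B\<^sup>2 * (norm z)\<^sup>2" if "x \<in> \<Omega>" for x z
    using B[OF that] by (auto simp: norm_mult power_mult_distrib intro!: mult_right_mono abs_le_square_iff[THEN iffD1])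
  have L2: "L2 ?M (\<lambda>x. complex_of_real (q x) * T V x)" if V: "Hk_vec 2 \<Omega> V" for V :: "real^'n::_ \<Rightarrow> complex^'m"
  proof -
    have TV: "L2 ?M (T V)" by (rule H2_operator_L2[OF T V])
    have m: "(\<lambda>x. complex_of_real (q x) * T V x) \<in> borel_measurable ?M"
      using TV by (intro borel_measurable_times qm) (simp add: L2_def)
    have "integrable ?M (\<lambda>x. (norm (complex_of_real (q x) * T V x))\<^sup>2)"
    proof (rule Bochner_Integration.integrable_bound)
      show "integrable ?M (\<lambda>x. B\<^sup>2 * (norm (T V x))\<^sup>2)" using TV by (simp add: L2_def)
      show "(\<lambda>x. (norm (complex_of_real (q x) * T V x))\<^sup>2) \<in> borel_measurable ?M"
        by (intro borel_measurable_power borel_measurable_norm[THEN measurable_compose[OF m]])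
      show "AE x in ?M. norm ((norm (complex_of_real (q x) * T V x))\<^sup>2) \<le> norm (B\<^sup>2 * (norm (T V x))\<^sup>2)"
        using le by (intro AE_I2) simp
    qed
    with m show ?thesis by (simp add: L2_def)
  qed
  show ?thesis
    unfolding H2_operator_def
  proof (intro conjI allI impI exI[of _ "B\<^sup>2 * C"])
    fix V :: "real^'n::_ \<Rightarrow> complex^'m" assume V: "Hk_vec 2 \<Omega> V"
    show "L2 ?M (\<lambda>x. complex_of_real (q x) * T V x)" by (rule L2[OF V])
    have "(L2_norm ?M (\<lambda>x. complex_of_real (q x) * T V x))\<^sup>2 \<le> (\<integral>x. B\<^sup>2 * (norm (T V x))\<^sup>2 \<partial>?M)"
      unfolding L2_norm_sq using L2[OF V] H2_operator_L2[OF T V] le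
      by (intro integral_mono) (simp_all add: L2_def)
    also have "\<dots> = B\<^sup>2 * (L2_norm ?M (T V))\<^sup>2" by (simp add: L2_norm_sq)
    also have "\<dots> \<le> B\<^sup>2 * (C * (Hk_norm_vec 2 \<Omega> V)\<^sup>2)" by (intro mult_left_mono C[rule_format] V) simp
    finally show "(L2_norm ?M (\<lambda>x. complex_of_real (q x) * T V x))\<^sup>2 \<le> B\<^sup>2 * C * (Hk_norm_vec 2 \<Omega> V)\<^sup>2"
      by (simp add: mult.assoc)
    fix W :: "real^'n::_ \<Rightarrow> complex^'m" and s t assume W: "Hk_vec 2 \<Omega> W"
    show "AE x in ?M. complex_of_real (q x) * T (\<lambda>x. s *\<^sub>R V x + t *\<^sub>R W x) x =
        s *\<^sub>R (complex_of_real (q x) * T V x) + t *\<^sub>R (complex_of_real (q x) * T W x)"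
      using H2_operator_lincomb[OF T V W, of s t] by eventually_elim (simp add: algebra_simps)
  qed
qed

lemma H2_operator_parallelogram:
  assumes \<Omega>: "open \<Omega>" and T: "H2_operator \<Omega> T" and V: "Hk_vec 2 \<Omega> V" and W: "Hk_vec 2 \<Omega> W"
  shows "(L2_norm (lebesgue_on \<Omega>) (T (\<lambda>x. V x + W x)))\<^sup>2 + (L2_norm (lebesgue_on \<Omega>) (T (\<lambda>x. V x - W x)))\<^sup>2 =
    2 * (L2_norm (lebesgue_on \<Omega>) (T V))\<^sup>2 + 2 * (L2_norm (lebesgue_on \<Omega>) (T W))\<^sup>2"
proof -
  have L2: "L2 (lebesgue_on \<Omega>) (T U)" if "Hk_vec 2 \<Omega> U" for U
    using T that by (simp add: H2_operator_def)
  have eq: "L2_norm (lebesgue_on \<Omega>) (T (\<lambda>x. s *\<^sub>R V x + t *\<^sub>R W x)) =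
      L2_norm (lebesgue_on \<Omega>) (\<lambda>x. s *\<^sub>R T V x + t *\<^sub>R T W x)" for s t
  proof (rule L2_norm_cong_AE)
    show "L2 (lebesgue_on \<Omega>) (T (\<lambda>x. s *\<^sub>R V x + t *\<^sub>R W x))" by (intro L2 Hk_vec_lincomb \<Omega> V W)
    show "L2 (lebesgue_on \<Omega>) (\<lambda>x. s *\<^sub>R T V x + t *\<^sub>R T W x)" by (intro L2_lincomb L2 V W)
    show "AE x in lebesgue_on \<Omega>. T (\<lambda>x. s *\<^sub>R V x + t *\<^sub>R W x) x = s *\<^sub>R T V x + t *\<^sub>R T W x"
      using T V W by (simp add: H2_operator_def)
  qed
  show ?thesis
    using eq[of 1 1] eq[of 1 "-1"] L2_norm_parallelogram[OF L2[OF V] L2[OF W]] by simp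
qed


section \<open>Existence and uniqueness of the minimizer\<close>

text \<open>
  The integrand of the functional before squaring, with an arbitrary real matrix \<open>B\<close> in place of
  \<open>D\<^sup>-\<^sup>1 S\<close>.
\<close>

definition residual ::
  "real \<Rightarrow> real^'m::finite^'m \<Rightarrow> ('n::{finite,linorder} \<Rightarrow> 'n \<Rightarrow> real^'n::_ \<Rightarrow> real) \<Rightarrow>
     ('n \<Rightarrow> real^'n::_ \<Rightarrow> real) \<Rightarrow> (real^'n::_ \<Rightarrow> real) \<Rightarrow> (real^'n::_ \<Rightarrow> real) \<Rightarrow>
     (real^'n::_ \<Rightarrow> complex^'m) \<Rightarrow> real^'n::_ \<Rightarrow> complex^'m" where
  "residual R B a b c n V x =
     L_op_vec R a b c V x + map_matrix complex_of_real B *v ((n x)\<^sup>2 *\<^sub>R V x)"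

lemma residual_component:
  "residual R B a b c n V x $ k =
     L_op R a b c (\<lambda>y. V y $ k) x + (\<Sum>l\<in>UNIV. complex_of_real (B $ k $ l * (n x)\<^sup>2) * V x $ l)"
  by (simp add: residual_def L_op_vec_def matrix_vector_mult_def map_matrix_def)
    (simp add: scaleR_conv_of_real mult_ac)

lemma H2_operator_residual_component:
  fixes a :: "'n::{finite,linorder} \<Rightarrow> 'n \<Rightarrow> real^'n::_ \<Rightarrow> real" and B :: "real^'m::finite^'m"
  assumes "\<And>i j. continuous_on UNIV (a i j)" "\<And>i. continuous_on UNIV (b i)"
    "continuous_on UNIV c" "continuous_on UNIV n"
  shows "H2_operator (cube R) (\<lambda>V x. residual R B a b c n V x $ k)"
  unfolding residual_component L_op_def
  by (intro H2_operator_add H2_operator_sum finite_UNIV H2_operator_mult bounded_cube H2_operator_weak_deriv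
      H2_operator_component open_cube assms continuous_intros) simp_all

lemma norm_vec_sq: "(norm v)\<^sup>2 = (\<Sum>k\<in>UNIV. (norm (v $ k))\<^sup>2)"
  by (simp add: norm_vec_def L2_set_def sum_nonneg)

text \<open>
  Splitting the squared norm of the vector into its components is legitimate since each component is
  square integrable.
\<close>

lemma J_eq_sum_L2_norms:
  fixes a :: "'n::{finite,linorder} \<Rightarrow> 'n \<Rightarrow> real^'n::_ \<Rightarrow> real"
    and V :: "real^'n::_ \<Rightarrow> complex^'m::{finite,linorder}"
  assumes T: "\<And>k. H2_operator (cube R) (\<lambda>V x. residual R (matrix_inv (D_matrix kl ku) ** S_matrix kl ku :: real^'m::_^'m::_) a b c n V x $ k)"
    and V: "Hk_vec 2 (cube R) V"
  shows "J R kl ku a b c n \<epsilon> V =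
    (\<Sum>k\<in>UNIV. (L2_norm (lebesgue_on (cube R)) (\<lambda>x. residual R (matrix_inv (D_matrix kl ku) ** S_matrix kl ku) a b c n V x $ k))\<^sup>2) +
    \<epsilon> * (Hk_norm_vec 2 (cube R) V)\<^sup>2"
proof -
  let ?r = "residual R (matrix_inv (D_matrix kl ku) ** S_matrix kl ku) a b c n V"
  have "(LINT x:cube R|lebesgue. (norm (?r x))\<^sup>2) = integral\<^sup>L (lebesgue_on (cube R)) (\<lambda>x. (norm (?r x))\<^sup>2)"
    by (simp add: set_integral_eq_integral_lebesgue_on open_cube)
  also have "\<dots> = (\<Sum>k\<in>UNIV. integral\<^sup>L (lebesgue_on (cube R)) (\<lambda>x. (norm (?r x $ k))\<^sup>2))"
    unfolding norm_vec_sq using H2_operator_L2[OF T V]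
    by (intro Bochner_Integration.integral_sum) (simp add: L2_def)
  finally show ?thesis
    by (simp add: J_def residual_def L2_norm_sq)
qed

text \<open>
  The Sobolev norm contains the norm of the function itself, as the term of the empty multi-index.
\<close>

lemma AE_eq_0_if_Hk_norm_vec_0:
  assumes \<Omega>: "open \<Omega>" and V: "Hk_vec 2 \<Omega> V" and 0: "(Hk_norm_vec 2 \<Omega> V)\<^sup>2 = 0"
  shows "AE x in lebesgue_on \<Omega>. V x = 0"
proof -
  have "AE x in lebesgue_on \<Omega>. V x $ m = 0" for m
  proof -
    have L2: "L2 (lebesgue_on \<Omega>) (\<lambda>x. V x $ m)" by (rule H2_operator_L2[OF H2_operator_component[OF \<Omega>] V])
    have W: "L2 (lebesgue_on \<Omega>) (weak_deriv \<Omega> [] (\<lambda>x. V x $ m))"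
      by (rule Hk_weak_deriv(2)[OF \<Omega> Hk_vec_component[OF V] Nil_in_multi_indices])
    have "(L2_norm (lebesgue_on \<Omega>) (weak_deriv \<Omega> [] (\<lambda>x. V x $ m)))\<^sup>2 \<le> 0"
      using order_trans[OF L2_norm_weak_deriv_le_Hk_norm[OF Nil_in_multi_indices] Hk_norm_component_le, of \<Omega> V m 2] 0 by simp
    then have "(\<integral>x. (norm (weak_deriv \<Omega> [] (\<lambda>x. V x $ m) x))\<^sup>2 \<partial>lebesgue_on \<Omega>) = 0"
      unfolding L2_norm_sq[symmetric] by simp
    then have "AE x in lebesgue_on \<Omega>. (norm (weak_deriv \<Omega> [] (\<lambda>x. V x $ m) x))\<^sup>2 = 0"
      using W by (subst (asm) integral_nonneg_eq_0_iff_AE) (auto simp: L2_def)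
    with weak_deriv_Nil_AE[OF \<Omega> L2] show ?thesis by eventually_elim simp
  qed
  then have "AE x in lebesgue_on \<Omega>. \<forall>m\<in>UNIV. V x $ m = 0"
    by (intro AE_finite_allI) simp_all
  then show ?thesis by eventually_elim (simp add: vec_eq_iff)
qed

lemma Hk_vec_complete:
  fixes U :: "nat \<Rightarrow> real^'n::{finite,linorder} \<Rightarrow> complex^'m::finite"
  assumes \<Omega>: "open \<Omega>" and U: "\<And>j. Hk_vec k \<Omega> (U j)"
    and cauchy: "\<And>e. e > 0 \<Longrightarrow> \<exists>N. \<forall>i\<ge>N. \<forall>j\<ge>N. (Hk_norm_vec k \<Omega> (\<lambda>x. U i x - U j x))\<^sup>2 < e"
  shows "\<exists>V. Hk_vec k \<Omega> V \<and> (\<forall>m. (\<lambda>j. (Hk_norm k \<Omega> (\<lambda>x. U j x $ m - V x $ m))\<^sup>2) \<longlonglongrightarrow> 0)"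
proof -
  have "\<exists>v. Hk k \<Omega> v \<and> (\<lambda>j. (Hk_norm k \<Omega> (\<lambda>x. U j x $ m - v x))\<^sup>2) \<longlonglongrightarrow> 0" for m
  proof (rule Hk_complete[OF \<Omega> Hk_vec_component[OF U]])
    fix e :: real assume "e > 0"
    then obtain N where N: "\<forall>i\<ge>N. \<forall>j\<ge>N. (Hk_norm_vec k \<Omega> (\<lambda>x. U i x - U j x))\<^sup>2 < e"
      using cauchy by blast
    have "(Hk_norm k \<Omega> (\<lambda>x. U i x $ m - U j x $ m))\<^sup>2 \<le> (Hk_norm_vec k \<Omega> (\<lambda>x. U i x - U j x))\<^sup>2" for i j
      using Hk_norm_component_le[of k \<Omega> "\<lambda>x. U i x - U j x" m] by simp
    with N show "\<exists>N. \<forall>i\<ge>N. \<forall>j\<ge>N. (Hk_norm k \<Omega> (\<lambda>x. U i x $ m - U j x $ m))\<^sup>2 < e"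
      by (meson le_less_trans)
  qed
  then have "\<exists>v. \<forall>m. Hk k \<Omega> (v m) \<and> (\<lambda>j. (Hk_norm k \<Omega> (\<lambda>x. U j x $ m - v m x))\<^sup>2) \<longlonglongrightarrow> 0"
    by (rule choice[OF allI])
  then obtain v where v: "\<forall>m. Hk k \<Omega> (v m) \<and> (\<lambda>j. (Hk_norm k \<Omega> (\<lambda>x. U j x $ m - v m x))\<^sup>2) \<longlonglongrightarrow> 0" ..
  show ?thesis
    by (rule exI[of _ "\<lambda>x. \<chi> m. v m x"]) (use v in \<open>simp add: Hk_vec_def\<close>)
qed

theorem theorem3p1:
  fixes R kl ku \<mu>1 \<mu>2 :: real
    and a :: "'n::{finite,linorder} \<Rightarrow> 'n \<Rightarrow> real^'n::_ \<Rightarrow> real"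
    and b :: "'n \<Rightarrow> real^'n::_ \<Rightarrow> real"
    and c n :: "real^'n::_ \<Rightarrow> real"
    and g :: "real \<Rightarrow> complex"
    and g' :: "real \<Rightarrow> complex"
    and F G :: "real^'n::_ \<Rightarrow> real \<Rightarrow> complex"
    and Ft Gt :: "real^'n::_ \<Rightarrow> complex^'m::{finite,linorder}"
  assumes "R \<ge> 1"
    and "\<And>i j. C_k 1 (a i j)"
    and "\<And>j. continuous_on UNIV (b j)"
    and "continuous_on UNIV c"
    and "\<And>i j x. a i j x = a j i x"
    and "0 < \<mu>1" and "\<mu>1 \<le> \<mu>2"
    and "\<And>x \<xi>. \<mu>1 * (norm \<xi>)\<^sup>2 \<le> (\<Sum>i\<in>UNIV. \<Sum>j\<in>UNIV. a i j x * \<xi> $ i * \<xi> $ j)"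
    and "\<And>x \<xi>. (\<Sum>i\<in>UNIV. \<Sum>j\<in>UNIV. a i j x * \<xi> $ i * \<xi> $ j) \<le> \<mu>2 * (norm \<xi>)\<^sup>2"
    and "\<And>i j x. x \<notin> cube R \<Longrightarrow> a i j x = (if i = j then 1 else 0)"
    and "\<And>j x. x \<notin> cube R \<Longrightarrow> b j x = 0"
    and "\<And>x. x \<notin> cube R \<Longrightarrow> c x = 0"
    and "C_k 1 n"
    and "\<And>x. x \<notin> cube R \<Longrightarrow> n x = 1"
    and "0 < kl" and "kl < ku"
    and "\<And>k. k \<ge> 0 \<Longrightarrow> (g has_vector_derivative g' k) (at k within {0..})"
    and "continuous_on {0..} g'"
    and "\<And>k. k \<in> {kl..ku} \<Longrightarrow> g k \<noteq> 0"
    and "\<And>x. x \<in> frontier (cube R) \<Longrightarrow> Ft x = boundary_coeffs kl ku g F x"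
    and "\<And>x. x \<in> Gamma_plus R \<Longrightarrow> Gt x = boundary_coeffs kl ku g G x"
    and "\<exists>\<Phi>. admissible R Ft Gt \<Phi>"
  shows "\<forall>\<epsilon>>0. \<exists>V. is_arg_min (J R kl ku a b c n \<epsilon>) (admissible R Ft Gt) V \<and>
           (\<forall>W. is_arg_min (J R kl ku a b c n \<epsilon>) (admissible R Ft Gt) W \<longrightarrow>
                (AE x in lebesgue_on (cube R). W x = V x))"
proof (intro allI impI)
  fix \<epsilon> :: real assume \<epsilon>: "\<epsilon> > 0"
  let ?\<Omega> = "cube R :: (real^'n::_) set"
  let ?Q = "J R kl ku a b c n \<epsilon> :: (real^'n::_ \<Rightarrow> complex^'m::_) \<Rightarrow> real"
  let ?H = "Hk_vec 2 ?\<Omega> :: (real^'n::_ \<Rightarrow> complex^'m::_) \<Rightarrow> bool"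
  define T where "T k V x = residual R (matrix_inv (D_matrix kl ku) ** S_matrix kl ku) a b c n V x $ k"
    for k :: 'm and V :: "real^'n::_ \<Rightarrow> complex^'m::_" and x
  have cont: "continuous_on UNIV f" if "C_k 1 f" for f :: "real^'n::_ \<Rightarrow> real"
    using C_k_Suc_imp_C_k[of 0 f] that by (simp only: One_nat_def C_k.simps(1))
  have T: "H2_operator ?\<Omega> (T k)" for k
    unfolding T_def[abs_def] 
    by (rule H2_operator_residual_component[OF cont[OF assms(2)] assms(3,4) cont[OF assms(13)]])
  have Q_eq: "?Q V = (\<Sum>k\<in>UNIV. (L2_norm (lebesgue_on ?\<Omega>) (T k V))\<^sup>2) + \<epsilon> * (Hk_norm_vec 2 ?\<Omega> V)\<^sup>2" if "?H V" for V
    using J_eq_sum_L2_norms[OF T[unfolded T_def[abs_def]] that] by (simp add: T_def[abs_def])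
  have H_diff: "?H (\<lambda>x. V x - W x)" if "?H V" "?H W" for V W
    using Hk_vec_lincomb[OF open_cube that, of 1 "-1"] by simp
  have H_add: "?H (\<lambda>x. V x + W x)" if "?H V" "?H W" for V W
    using Hk_vec_lincomb[OF open_cube that, of 1 1] by simp
  have norm_le_Q: "\<epsilon> * (Hk_norm_vec 2 ?\<Omega> V)\<^sup>2 \<le> ?Q V" if "?H V" for V
    unfolding Q_eq[OF that] by (simp add: sum_nonneg)
  have adm_H: "?H V" if "admissible R Ft Gt V" for V using that by (simp add: admissible_def)
  have "\<exists>V. is_arg_min ?Q (admissible R Ft Gt) V \<and>
      (\<forall>W. is_arg_min ?Q (admissible R Ft Gt) W \<longrightarrow> ?Q (\<lambda>x. W x - V x) = 0)"
  proof (rule quadratic_minimizer_exists_unique[where H = ?H])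
    show "0 \<le> ?Q V" for V
      using \<epsilon> by (auto simp: J_def set_lebesgue_integral_def intro!: add_nonneg_nonneg integral_nonneg)
    show "?H (\<lambda>x. s *\<^sub>R V x + t *\<^sub>R W x)" if "?H V" "?H W" for V W s t
      by (rule Hk_vec_lincomb[OF open_cube that])
    show "?Q (\<lambda>x. V x + W x) + ?Q (\<lambda>x. V x - W x) = 2 * ?Q V + 2 * ?Q W" if V: "?H V" and W: "?H W" for V W
    proof -
      have "(\<Sum>k\<in>UNIV. (L2_norm (lebesgue_on ?\<Omega>) (T k (\<lambda>x. V x + W x)))\<^sup>2) +
          (\<Sum>k\<in>UNIV. (L2_norm (lebesgue_on ?\<Omega>) (T k (\<lambda>x. V x - W x)))\<^sup>2) =
          2 * (\<Sum>k\<in>UNIV. (L2_norm (lebesgue_on ?\<Omega>) (T k V))\<^sup>2) + 2 * (\<Sum>k\<in>UNIV. (L2_norm (lebesgue_on ?\<Omega>) (T k W))\<^sup>2)"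
        using H2_operator_parallelogram[OF open_cube T V W] by (simp add: sum_distrib_left flip: sum.distrib)
      moreover have "\<epsilon> * (Hk_norm_vec 2 ?\<Omega> (\<lambda>x. V x + W x))\<^sup>2 + \<epsilon> * (Hk_norm_vec 2 ?\<Omega> (\<lambda>x. V x - W x))\<^sup>2 =
          2 * (\<epsilon> * (Hk_norm_vec 2 ?\<Omega> V)\<^sup>2) + 2 * (\<epsilon> * (Hk_norm_vec 2 ?\<Omega> W)\<^sup>2)"
        using arg_cong[OF Hk_norm_vec_parallelogram[OF open_cube V W], of "(*) \<epsilon>"] by (simp add: algebra_simps)
      ultimately show ?thesis
        unfolding Q_eq[OF V] Q_eq[OF W] Q_eq[OF H_add[OF V W]] Q_eq[OF H_diff[OF V W]] by algebra
    qed
    show "?H V" if "admissible R Ft Gt V" for V by (rule adm_H[OF that])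
    show "\<exists>V. admissible R Ft Gt V" by (rule assms)
    show "admissible R Ft Gt (\<lambda>x. s *\<^sub>R V x + t *\<^sub>R W x)"
      if "admissible R Ft Gt V" "admissible R Ft Gt W" "s + t = 1" for V W s t
      by (rule admissible_affine[OF that])
    fix U :: "nat \<Rightarrow> real^'n::_ \<Rightarrow> complex^'m::_"
    assume U: "\<And>j. admissible R Ft Gt (U j)"
      and cauchy: "\<And>e. e > 0 \<Longrightarrow> \<exists>N. \<forall>i\<ge>N. \<forall>j\<ge>N. ?Q (\<lambda>x. U i x - U j x) < e"
    note HU = adm_H[OF U]
    have "\<exists>N. \<forall>i\<ge>N. \<forall>j\<ge>N. (Hk_norm_vec 2 ?\<Omega> (\<lambda>x. U i x - U j x))\<^sup>2 < e" if "e > 0" for e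
    proof -
      obtain N where N: "\<forall>i\<ge>N. \<forall>j\<ge>N. ?Q (\<lambda>x. U i x - U j x) < \<epsilon> * e"
        using cauchy[of "\<epsilon> * e"] \<epsilon> \<open>e > 0\<close> by auto
      have "(Hk_norm_vec 2 ?\<Omega> (\<lambda>x. U i x - U j x))\<^sup>2 < e" if "N \<le> i" "N \<le> j" for i j
      proof -
        have "\<epsilon> * (Hk_norm_vec 2 ?\<Omega> (\<lambda>x. U i x - U j x))\<^sup>2 < \<epsilon> * e"
          using norm_le_Q[OF H_diff[OF HU[of i] HU[of j]]] N that by (meson le_less_trans)
        then show ?thesis using \<epsilon> by simp
      qed
      then show ?thesis by blast
    qed
    from Hk_vec_complete[OF open_cube HU this]
    obtain V where V: "?H V" and lim: "\<forall>m. (\<lambda>j. (Hk_norm 2 ?\<Omega> (\<lambda>x. U j x $ m - V x $ m))\<^sup>2) \<longlonglongrightarrow> 0"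
      by blast
    have adm: "admissible R Ft Gt V" by (rule admissible_closed[OF U V lim[rule_format]])
    have "(\<lambda>j. \<Sum>m\<in>UNIV. (Hk_norm 2 ?\<Omega> (\<lambda>x. U j x $ m - V x $ m))\<^sup>2) \<longlonglongrightarrow> (\<Sum>m\<in>(UNIV :: 'm set). 0)"
      using lim by (intro tendsto_sum) blast
    then have N0: "(\<lambda>j. (Hk_norm_vec 2 ?\<Omega> (\<lambda>x. U j x - V x))\<^sup>2) \<longlonglongrightarrow> 0"
      by (simp add: Hk_norm_vec_sq)
    have T0: "(\<lambda>j. (L2_norm (lebesgue_on ?\<Omega>) (T k (\<lambda>x. U j x - V x)))\<^sup>2) \<longlonglongrightarrow> 0" for k
    proof -
      obtain C where C: "\<forall>V. ?H V \<longrightarrow> (L2_norm (lebesgue_on ?\<Omega>) (T k V))\<^sup>2 \<le> C * (Hk_norm_vec 2 ?\<Omega> V)\<^sup>2"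
        using H2_operator_bounded[OF T] ..
      show ?thesis
        by (rule tendsto_0_if_le[OF tendsto_mult_right_zero[OF N0] zero_le_power2 C[rule_format, OF H_diff[OF HU V]]])
    qed
    have "(\<lambda>j. ?Q (\<lambda>x. U j x - V x)) \<longlonglongrightarrow> (\<Sum>k\<in>(UNIV :: 'm set). 0) + \<epsilon> * 0"
      unfolding Q_eq[OF H_diff[OF HU V]] by (intro tendsto_intros T0 N0)
    then show "\<exists>V. admissible R Ft Gt V \<and> (\<lambda>j. ?Q (\<lambda>x. U j x - V x)) \<longlonglongrightarrow> 0"
      using adm by auto
  qed
  then obtain V where V: "is_arg_min ?Q (admissible R Ft Gt) V"
    and uniq: "\<forall>W. is_arg_min ?Q (admissible R Ft Gt) W \<longrightarrow> ?Q (\<lambda>x. W x - V x) = 0"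
    by blast
  have "AE x in lebesgue_on ?\<Omega>. W x = V x" if W: "is_arg_min ?Q (admissible R Ft Gt) W" for W
  proof -
    have H: "?H (\<lambda>x. W x - V x)"
      using V W by (intro H_diff adm_H) (simp_all add: is_arg_min_def)
    have "\<epsilon> * (Hk_norm_vec 2 ?\<Omega> (\<lambda>x. W x - V x))\<^sup>2 \<le> 0"
      using norm_le_Q[OF H] uniq W by simp
    then have "(Hk_norm_vec 2 ?\<Omega> (\<lambda>x. W x - V x))\<^sup>2 = 0"
      using \<epsilon> by (simp add: mult_le_0_iff)
    from AE_eq_0_if_Hk_norm_vec_0[OF open_cube H this] show ?thesis by simp
  qed
  with V show "\<exists>V. is_arg_min ?Q (admissible R Ft Gt) V \<and>
      (\<forall>W. is_arg_min ?Q (admissible R Ft Gt) W \<longrightarrow> (AE x in lebesgue_on (cube R). W x = V x))"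
    by blast
qed

end
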